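(* Let $\gamma:I\to\mathbb{R}^2$ be a $C^\infty$ curve with $0\in I$ and suppose $\gamma'(0)=\gamma''(0)=\gamma'''(0)=\mathbf{0}$ and $A\neq0$ (so $\kappa_q$ is defined). (1) $\gamma$ is $\mathcal{A}$-equivalent at $t=0$ to $(t^4,t^5)$ if and only if $\kappa_q=0$. (2) $\gamma$ is $\mathcal{A}$-equivalent at $t=0$ to $(t^4,t^5+t^7)$ if and only if $\kappa_q>0$. (3) $\gamma$ is $\mathcal{A}$-equivalent at $t=0$ to $(t^4,t^5-t^7)$ if and only if $\kappa_q<0$. (4) The three germs $(t^4,t^5)$, $(t^4,t^5+t^7)$, $(t^4,t^5-t^7)$ at $t=0$ are pairwise not $\mathcal{A}$-equivalent, but they are pairwise $C^1$-equivalent at $t=0$. (Moreover, a $C^\infty$ curve with $\gamma'(0)=\gamma''(0)=\gamma'''(0)=\mathbf 0$ and $A\ne0$ is required in each "if and only if": i.e. $\gamma$ is $\mathcal{A}$-equivalent to one of the three germs iff it satisfies these conditions together with the stated condition on $\kappa_q$.)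
   Context: $A=\det(\gamma^{(5)}(0),\gamma^{(4)}(0))$, $B=\det(\gamma^{(6)}(0),\gamma^{(4)}(0))$, $C=\det(\gamma^{(7)}(0),\gamma^{(4)}(0))$, $D=\det(\gamma^{(6)}(0),\gamma^{(5)}(0))$. The $(4,5;\pm7)$-cuspidal curvature is $\kappa_q=\dfrac{-77B^2+105AD+60AC}{\|\gamma^{(4)}(0)\|^5}$. For $r\in\mathbb{N}_{>0}\cup\{\infty,\omega\}$, germs $\gamma_1,\gamma_2$ are $C^r$-equivalent if there exist $C^r$ diffeomorphism germs $\psi$ of $(\mathbb{R},0)$ and $\Psi$ of $\mathbb{R}^2$ with $\Psi\circ\gamma_1\circ\psi^{-1}=\gamma_2$; $\mathcal{A}$-equivalence is $C^\infty$-equivalence. *)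

theory Defs
  imports "HOL-Analysis.Analysis" "HOL-Library.Extended_Nat"
begin

definition pder :: "'a::euclidean_space \<Rightarrow> ('a \<Rightarrow> real) \<Rightarrow> 'a \<Rightarrow> real" where
  "pder b g x = deriv (\<lambda>s. g (x + s *\<^sub>R b)) 0"

fun Ck :: "nat \<Rightarrow> 'a::euclidean_space set \<Rightarrow> ('a \<Rightarrow> real) \<Rightarrow> bool" where
  "Ck 0 U g = continuous_on U g"
| "Ck (Suc k) U g =
     (continuous_on U g \<and>
      (\<forall>b\<in>Basis. \<forall>x\<in>U. (\<lambda>s. g (x + s *\<^sub>R b)) differentiable (at 0)) \<and>
      (\<forall>b\<in>Basis. Ck k U (pder b g)))"

definition Cr :: "enat \<Rightarrow> 'a::euclidean_space set \<Rightarrow> ('a \<Rightarrow> 'b::euclidean_space) \<Rightarrow> bool" where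
  "Cr r U f = (\<forall>k. enat k \<le> r \<longrightarrow> (\<forall>c\<in>Basis. Ck k U (\<lambda>x. f x \<bullet> c)))"

definition Cr_diffeo :: "enat \<Rightarrow> 'a::euclidean_space set \<Rightarrow> ('a \<Rightarrow> 'a) \<Rightarrow> bool" where
  "Cr_diffeo r U f = (open U \<and> Cr r U f \<and> inj_on f U \<and> open (f ` U) \<and> Cr r (f ` U) (inv_into U f))"

definition Cr_equiv :: "enat \<Rightarrow> (real \<Rightarrow> real \<times> real) \<Rightarrow> (real \<Rightarrow> real \<times> real) \<Rightarrow> bool" where
  "Cr_equiv r \<gamma>1 \<gamma>2 =
    (\<exists>U \<psi> V \<Psi>. 0 \<in> U \<and> Cr_diffeo r U \<psi> \<and> \<psi> 0 = 0 \<and>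
        \<gamma>1 0 \<in> V \<and> Cr_diffeo r V \<Psi> \<and>
        (\<forall>\<^sub>F s in nhds 0. \<Psi> (\<gamma>1 (inv_into U \<psi> s)) = \<gamma>2 s))"

definition A_equiv :: "(real \<Rightarrow> real \<times> real) \<Rightarrow> (real \<Rightarrow> real \<times> real) \<Rightarrow> bool" where
  "A_equiv \<gamma>1 \<gamma>2 = Cr_equiv \<infinity> \<gamma>1 \<gamma>2"

definition cder :: "nat \<Rightarrow> (real \<Rightarrow> real \<times> real) \<Rightarrow> real \<Rightarrow> real \<times> real" where
  "cder k \<gamma> t = ((deriv ^^ k) (\<lambda>s. fst (\<gamma> s)) t, (deriv ^^ k) (\<lambda>s. snd (\<gamma> s)) t)"

definition det2 :: "real \<times> real \<Rightarrow> real \<times> real \<Rightarrow> real" where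
  "det2 u v = fst u * snd v - snd u * fst v"

definition kappa_q :: "(real \<Rightarrow> real \<times> real) \<Rightarrow> real" where
  "kappa_q \<gamma> =
    (let A = det2 (cder 5 \<gamma> 0) (cder 4 \<gamma> 0);
         B = det2 (cder 6 \<gamma> 0) (cder 4 \<gamma> 0);
         C = det2 (cder 7 \<gamma> 0) (cder 4 \<gamma> 0);
         D = det2 (cder 6 \<gamma> 0) (cder 5 \<gamma> 0)
     in (-77 * B^2 + 105 * A * D + 60 * A * C) / norm (cder 4 \<gamma> 0) ^ 5)"

definition cusp45 :: "(real \<Rightarrow> real \<times> real) \<Rightarrow> bool" where
  "cusp45 \<gamma> = (cder 1 \<gamma> 0 = 0 \<and> cder 2 \<gamma> 0 = 0 \<and> cder 3 \<gamma> 0 = 0 \<and>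
                det2 (cder 5 \<gamma> 0) (cder 4 \<gamma> 0) \<noteq> 0)"

end

theory Submission
  imports Defs "HOL-Library.Landau_Symbols"
begin


text \<open>
  Sufficiency. Precomposing with \<open>c t / (1 + t^2)\<close> makes the curve defined on the whole line. Linear,
  quadratic and polynomial changes of coordinates in source and target bring it to
  \<open>(t^4 + t^12 u, t^5 + e t^7 + t^12 v)\<close> with \<open>e\<close> in \<open>{0, 1, -1}\<close>. The semigroup generated by 4 and 5
  contains every integer from 12 on; accordingly, splitting a smooth function as
  \<open>h0(t^4) + t h1(t^4) + t^2 h2(t^4) + t^3 h3(t^4)\<close> (Whitney's theorem on even functions, used twice,
  which rests on Borel's theorem) shows that the terms of order 12 are smooth functions of
  \<open>x = t^4\<close> and \<open>y = t^5 + e t^7\<close>, so a local diffeomorphism of the plane removes them.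

  Necessity. Modulo order 8 only the linear part of the diffeomorphism of the plane matters. If its
  determinant is \<open>\<Delta>\<close> and the reparametrisation has derivative c at 0, the numerator of the curvature
  is a positive constant times \<open>e c^20 \<Delta>^2\<close>; hence its sign is e.

  The map \<open>(x, y) \<mapsto> (x, y + e y |y|^(2/5))\<close> is a local diffeomorphism of class C^1 and carries
  \<open>(t^4, t^5)\<close> to \<open>(t^4, t^5 + e t^7)\<close>.
\<close>

section \<open>Calculus of functions of class C^k\<close>

text \<open>The gaps of the semigroup above the multiplicity 4 are 6, 7 and 11, and the reductions
  are shaped by what can move these orders. A parameter change acts on both components at once: a
  term of relative order k moves order 4 + k of the first and order 5 + k of the second. For k = 1
  and k = 6 the side effect on the first component lands at order 5 or 10 and is absorbed by y or
  y^2. For k = 2 the effects land at orders 6 and 7, both gaps, so one parameter faces two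
  coefficients; the one that remains is e. Scaling t by l multiplies it by l^2, which leaves only
  its sign.

  The numerator of the curvature is the combination in which the second and third derivatives of the
  parameter change cancel; this fixes the ratios of 77, 105 and 60.

  Passing to curves on the whole line lets Hadamard quotients, Borel sums and their compositions be
  used without tracking domains. \<open>Ck\<close> speaks only of iterated partial derivatives, so
  the chain rule and the regularity of inverse maps have to be derived from that form.\<close>

lemma Ck_continuous: "Ck k U f \<Longrightarrow> continuous_on U f"
  by (cases k) auto

lemma Ck_subset: "Ck k U f \<Longrightarrow> V \<subseteq> U \<Longrightarrow> Ck k V f"
proof (induction k arbitrary: f)
  case 0
  then show ?case using continuous_on_subset by auto
next
  case (Suc k)
  then show ?case using continuous_on_subset by (auto simp: subset_eq)
qed

lemma Ck_Suc_imp: "Ck (Suc k) U f \<Longrightarrow> Ck k U f"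
  by (induction k arbitrary: f) auto

lemma Ck_mono: "Ck k U f \<Longrightarrow> j \<le> k \<Longrightarrow> Ck j U f"
  by (induction k) (auto simp: le_Suc_eq simp del: Ck.simps dest: Ck_Suc_imp)

lemma eventually_line_in_open:
  fixes x b :: "'a::real_normed_vector"
  assumes "open U" "x \<in> U"
  shows "\<forall>\<^sub>F s in nhds (0::real). x + s *\<^sub>R b \<in> U"
proof -
  have "((\<lambda>s. x + s *\<^sub>R b) \<longlongrightarrow> x + 0 *\<^sub>R b) (nhds (0::real))"
    by (intro tendsto_intros filterlim_ident)
  then show ?thesis using assms by (auto dest: topological_tendstoD)
qed

lemma pder_cong_open:
  assumes "open U" "x \<in> U" "\<And>y. y \<in> U \<Longrightarrow> f y = g y"
  shows "pder b f x = pder b g x"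
  unfolding pder_def
  by (rule deriv_cong_ev)
    (use eventually_line_in_open[OF assms(1,2), of b] assms(3) in \<open>auto elim: eventually_mono\<close>)

text \<open>Openness enters because \<open>pder\<close> at a point reads values along a short
  segment, which has to stay inside \<open>U\<close>.\<close>

lemma Ck_cong:
  assumes "open U" "\<And>y. y \<in> U \<Longrightarrow> f y = g y" "Ck k U f"
  shows "Ck k U g"
  using assms(2,3)
proof (induction k arbitrary: f g)
  case 0
  then show ?case by (auto cong: continuous_on_cong)
next
  case (Suc k)
  have "(\<lambda>s. g (x + s *\<^sub>R b)) differentiable (at 0)" if "b \<in> Basis" "x \<in> U" for b x
  proof -
    have "(\<lambda>s. f (x + s *\<^sub>R b)) differentiable (at 0)" using Suc.prems that by auto
    then obtain D where D: "((\<lambda>s. f (x + s *\<^sub>R b)) has_derivative D) (at 0)"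
      by (auto simp: differentiable_def)
    from eventually_line_in_open[OF assms(1) that(2), of b]
    have "\<forall>\<^sub>F s in at 0. f (x + s *\<^sub>R b) = g (x + s *\<^sub>R b)"
      using Suc.prems by (auto simp: eventually_at_filter elim: eventually_mono)
    then have "((\<lambda>s. g (x + s *\<^sub>R b)) has_derivative D) (at 0)"
      using has_derivative_transform_eventually[OF D] Suc.prems(1)[OF that(2)] by simp
    then show ?thesis by (auto simp: differentiable_def)
  qed
  moreover have "Ck k U (pder b g)" if "b \<in> Basis" for b
  proof (rule Suc.IH)
    show "pder b f y = pder b g y" if "y \<in> U" for y
      by (rule pder_cong_open[OF assms(1) that Suc.prems(1)])
    show "Ck k U (pder b f)" using Suc.prems(2) that by simp
  qed
  moreover have "continuous_on U g"
    using Suc.prems by (auto cong: continuous_on_cong)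
  ultimately show ?case by auto
qed

section \<open>Total derivatives from continuous partial derivatives\<close>

lemma pder_bound:
  fixes f :: "'a::euclidean_space \<Rightarrow> real"
  assumes diff: "\<And>s. \<bar>s\<bar> \<le> \<bar>\<sigma>\<bar> \<Longrightarrow> (\<lambda>u. f ((y + s *\<^sub>R b) + u *\<^sub>R b)) differentiable (at 0)"
    and bd: "\<And>s. \<bar>s\<bar> \<le> \<bar>\<sigma>\<bar> \<Longrightarrow> \<bar>pder b f (y + s *\<^sub>R b) - g\<bar> \<le> e"
  shows "\<bar>f (y + \<sigma> *\<^sub>R b) - f y - \<sigma> * g\<bar> \<le> e * \<bar>\<sigma>\<bar>"
proof -
  let ?S = "{-\<bar>\<sigma>\<bar>..\<bar>\<sigma>\<bar>}"
  have der: "((\<lambda>u. f (y + u *\<^sub>R b)) has_field_derivative pder b f (y + s *\<^sub>R b)) (at s)" if "\<bar>s\<bar> \<le> \<bar>\<sigma>\<bar>" for s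
  proof -
    have "((\<lambda>u. f ((y + s *\<^sub>R b) + u *\<^sub>R b)) has_field_derivative pder b f (y + s *\<^sub>R b)) (at 0)"
      unfolding pder_def using diff[OF that] by (simp add: DERIV_deriv_iff_real_differentiable)
    then have "((\<lambda>u. f (y + (u + s) *\<^sub>R b)) has_field_derivative pder b f (y + s *\<^sub>R b)) (at (0::real))"
      by (simp add: algebra_simps)
    then show ?thesis
      using DERIV_shift[of "\<lambda>u. f (y + u *\<^sub>R b)" "pder b f (y + s *\<^sub>R b)" 0 s] by simp
  qed
  \<comment> \<open>Mean value inequality for s -> f(y + s b) - s g. The number \<open>g\<close> is
    free, so that it can be the partial derivative at a point other than \<open>y\<close>.\<close>
  have "norm ((f (y + \<sigma> *\<^sub>R b) - \<sigma> * g) - (f (y + 0 *\<^sub>R b) - 0 * g)) \<le> e * norm (\<sigma> - 0)"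
    by (rule field_differentiable_bound[of ?S "\<lambda>s. f (y + s *\<^sub>R b) - s * g"
          "\<lambda>s. pder b f (y + s *\<^sub>R b) - g" e \<sigma> 0])
      (auto intro!: derivative_eq_intros has_field_derivative_at_within[OF der] bd)
  then show ?thesis by (simp add: algebra_simps)
qed

lemma norm_partial_sum_Basis_le:
  fixes h :: "'a::euclidean_space"
  assumes "J \<subseteq> Basis"
  shows "norm (\<Sum>b\<in>J. (h \<bullet> b) *\<^sub>R b) \<le> real DIM('a) * norm h"
proof -
  have "norm (\<Sum>b\<in>J. (h \<bullet> b) *\<^sub>R b) \<le> (\<Sum>b\<in>J. norm h)"
    by (rule sum_norm_le) (use assms in \<open>auto simp: subset_eq Basis_le_norm\<close>)
  also have "\<dots> = real (card J) * norm h" by simp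
  also have "\<dots> \<le> real DIM('a) * norm h"
    by (intro mult_right_mono) (auto intro!: card_mono assms)
  finally show ?thesis .
qed

text \<open>The increment of f is split into increments along the basis vectors, one at a time.\<close>

lemma continuous_partials_increment:
  fixes f :: "'a::euclidean_space \<Rightarrow> real"
  assumes U: "open U" "x \<in> U"
    and diff: "\<And>b y. b \<in> Basis \<Longrightarrow> y \<in> U \<Longrightarrow> (\<lambda>s. f (y + s *\<^sub>R b)) differentiable (at 0)"
    and cont: "\<And>b. b \<in> Basis \<Longrightarrow> continuous_on U (pder b f)"
    and J: "J \<subseteq> Basis" and e: "e > 0"
  shows "\<exists>d>0. \<forall>h. norm h < d \<longrightarrow>
    \<bar>f (x + (\<Sum>b\<in>J. (h \<bullet> b) *\<^sub>R b)) - f x - (\<Sum>b\<in>J. (h \<bullet> b) * pder b f x)\<bar> \<le> e * norm h"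
proof -
  have "finite J" using J finite_Basis finite_subset by blast
  then show ?thesis using J e
  proof (induction J arbitrary: e rule: finite_induct)
    case empty
    then show ?case by (auto intro!: exI[of _ 1])
  next
    case (insert c J)
    then have c: "c \<in> Basis" and JB: "J \<subseteq> Basis" by auto
    obtain d1 where d1: "d1 > 0" "\<And>h. norm h < d1 \<Longrightarrow>
       \<bar>f (x + (\<Sum>b\<in>J. (h \<bullet> b) *\<^sub>R b)) - f x - (\<Sum>b\<in>J. (h \<bullet> b) * pder b f x)\<bar> \<le> e/2 * norm h"
      using insert.IH[OF JB, of "e/2"] insert.prems by auto
    have "\<forall>\<^sub>F y in nhds x. y \<in> U \<and> dist (pder c f y) (pder c f x) < e/2"
    proof (intro eventually_conj)
      show "\<forall>\<^sub>F y in nhds x. y \<in> U" using U by (simp add: eventually_nhds_in_open)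
      have "isCont (pder c f) x" using cont[OF c] U by (simp add: continuous_on_eq_continuous_at)
      then have "(pder c f \<longlongrightarrow> pder c f x) (nhds x)"
        by (simp add: isCont_def tendsto_at_iff_tendsto_nhds)
      then show "\<forall>\<^sub>F y in nhds x. dist (pder c f y) (pder c f x) < e/2"
        using insert.prems by (intro tendstoD) auto
    qed
    then obtain d2 where d2: "d2 > 0" "\<And>y. dist y x < d2 \<Longrightarrow> y \<in> U \<and> dist (pder c f y) (pder c f x) < e/2"
      by (auto simp: eventually_nhds_metric)
    \<comment> \<open>The intermediate points differ from \<open>x\<close> by a partial sum of norm
      at most \<open>DIM('a)\<close> times \<open>norm h\<close>, plus one further coordinate of
      size at most \<open>norm h\<close>.\<close>
    define K where "K = real DIM('a) + 1"
    have K: "K > 0" by (simp add: K_def)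
    have "\<bar>f (x + (\<Sum>b\<in>insert c J. (h \<bullet> b) *\<^sub>R b)) - f x - (\<Sum>b\<in>insert c J. (h \<bullet> b) * pder b f x)\<bar> \<le> e * norm h"
      if h: "norm h < min d1 (d2/K)" for h
    proof -
      define y where "y = x + (\<Sum>b\<in>J. (h \<bullet> b) *\<^sub>R b)"
      have hc: "\<bar>h \<bullet> c\<bar> \<le> norm h" using c Basis_le_norm by auto
      have near: "dist (y + s *\<^sub>R c) x < d2" if "\<bar>s\<bar> \<le> \<bar>h \<bullet> c\<bar>" for s
      proof -
        have "dist (y + s *\<^sub>R c) x \<le> norm (\<Sum>b\<in>J. (h \<bullet> b) *\<^sub>R b) + norm (s *\<^sub>R c)"
          unfolding dist_norm y_def by (metis add.assoc add_diff_cancel_left' norm_triangle_ineq)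
        also have "\<dots> \<le> real DIM('a) * norm h + norm h"
          using norm_partial_sum_Basis_le[OF JB, of h] that hc c by (intro add_mono) auto
        also have "\<dots> = K * norm h" by (simp add: K_def algebra_simps)
        also have "\<dots> < d2" using h K by (simp add: pos_less_divide_eq mult.commute)
        finally show ?thesis .
      qed
      have 1: "\<bar>f (y + (h \<bullet> c) *\<^sub>R c) - f y - (h \<bullet> c) * pder c f x\<bar> \<le> e/2 * \<bar>h \<bullet> c\<bar>"
      proof (rule pder_bound)
        fix s assume s: "\<bar>s\<bar> \<le> \<bar>h \<bullet> c\<bar>"
        show "(\<lambda>u. f ((y + s *\<^sub>R c) + u *\<^sub>R c)) differentiable (at 0)"
          using diff[OF c] d2(2)[OF near[OF s]] by blast
        show "\<bar>pder c f (y + s *\<^sub>R c) - pder c f x\<bar> \<le> e/2"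
          using d2(2)[OF near[OF s]] by (simp add: dist_real_def)
      qed
      have 2: "\<bar>f y - f x - (\<Sum>b\<in>J. (h \<bullet> b) * pder b f x)\<bar> \<le> e/2 * norm h"
        using d1(2)[of h] h by (simp add: y_def)
      have 3: "e/2 * \<bar>h \<bullet> c\<bar> \<le> e/2 * norm h" using hc insert.prems by simp
      have "x + (\<Sum>b\<in>insert c J. (h \<bullet> b) *\<^sub>R b) = y + (h \<bullet> c) *\<^sub>R c"
        using insert.hyps by (simp add: y_def)
      moreover have "(\<Sum>b\<in>insert c J. (h \<bullet> b) * pder b f x)
          = (h \<bullet> c) * pder c f x + (\<Sum>b\<in>J. (h \<bullet> b) * pder b f x)"
        using insert.hyps by simp
      ultimately show ?thesis using 1 2 3 by (smt (verit) field_sum_of_halves distrib_right)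
    qed
    then show ?case using d1 d2 K by (intro exI[of _ "min d1 (d2/K)"]) auto
  qed
qed

text \<open>This is the increment estimate for \<open>J = Basis\<close>, where the partial sum is
  the whole of \<open>h\<close>.\<close>

lemma Ck_Suc_has_derivative:
  fixes f :: "'a::euclidean_space \<Rightarrow> real"
  assumes U: "open U" "x \<in> U" and f: "Ck (Suc k) U f"
  shows "(f has_derivative (\<lambda>h. \<Sum>b\<in>Basis. (h \<bullet> b) * pder b f x)) (at x)"
  unfolding has_derivative_at_alt
proof (intro conjI allI impI)
  show "bounded_linear (\<lambda>h. \<Sum>b\<in>Basis. (h \<bullet> b) * pder b f x)"
    by (intro bounded_linear_intros)
  fix e :: real assume "e > 0"
  then obtain d where d: "d > 0" "\<And>h. norm h < d \<Longrightarrow>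
      \<bar>f (x + (\<Sum>b\<in>Basis. (h \<bullet> b) *\<^sub>R b)) - f x - (\<Sum>b\<in>Basis. (h \<bullet> b) * pder b f x)\<bar> \<le> e * norm h"
    using continuous_partials_increment[OF U, of f Basis e] f Ck_continuous by fastforce
  show "\<exists>d>0. \<forall>y. norm (y - x) < d \<longrightarrow>
      norm (f y - f x - (\<Sum>b\<in>Basis. ((y - x) \<bullet> b) * pder b f x)) \<le> e * norm (y - x)"
    using d(1) d(2)[of "_ - x"] by (intro exI[of _ d]) (auto simp: euclidean_representation)
qed

lemma Ck_Suc_pder: "Ck (Suc k) U f \<Longrightarrow> b \<in> Basis \<Longrightarrow> Ck k U (pder b f)"
  by simp

lemma has_derivative_partial:
  fixes f :: "'a::euclidean_space \<Rightarrow> real"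
  assumes "(f has_derivative f') (at x)"
  shows "((\<lambda>s. f (x + s *\<^sub>R b)) has_field_derivative f' b) (at 0)"
proof -
  have lin: "linear f'" using assms has_derivative_linear by blast
  have "((\<lambda>s. f (x + s *\<^sub>R b)) has_derivative (\<lambda>s. f' (s *\<^sub>R b))) (at 0)"
    by (rule has_derivative_compose[where f = "\<lambda>s. x + s *\<^sub>R b" and g = f])
      (auto intro!: derivative_eq_intros simp: assms)
  then show ?thesis
    by (simp add: has_field_derivative_def linear_cmul[OF lin] mult_commute_abs)
qed

lemma has_derivative_pder:
  fixes f :: "'a::euclidean_space \<Rightarrow> real"
  assumes "(f has_derivative f') (at x)"
  shows "pder b f x = f' b"
  unfolding pder_def using has_derivative_partial[OF assms] by (rule DERIV_imp_deriv)

text \<open>Once a total derivative is known, its values on basis vectors replace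
  \<open>pder\<close>. The closure properties below thus reduce to differentiation rules and an
  induction on k, without difference quotients.\<close>

lemma Ck_SucI:
  fixes f :: "'a::euclidean_space \<Rightarrow> real"
  assumes U: "open U"
    and der: "\<And>x. x \<in> U \<Longrightarrow> (f has_derivative f' x) (at x)"
    and Ck: "\<And>b. b \<in> Basis \<Longrightarrow> Ck k U (\<lambda>x. f' x b)"
  shows "Ck (Suc k) U f"
proof -
  have "continuous_on U f"
    by (intro continuous_at_imp_continuous_on ballI has_derivative_continuous[OF der])
  moreover have "Ck k U (pder b f)" if "b \<in> Basis" for b
    by (rule Ck_cong[OF U _ Ck[OF that]]) (simp add: has_derivative_pder[OF der])
  moreover have "(\<lambda>s. f (x + s *\<^sub>R b)) differentiable (at 0)" if "x \<in> U" for x b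
    using has_derivative_partial[OF der[OF that]] real_differentiable_def by blast
  ultimately show ?thesis by simp
qed

section \<open>Algebra of C^k functions and the chain rule\<close>

lemma Ck_const: "open U \<Longrightarrow> Ck k U (\<lambda>x. c)"
proof (induction k arbitrary: c)
  case (Suc k)
  show ?case by (rule Ck_SucI[where f' = "\<lambda>x h. 0"]) (use Suc in auto)
qed simp

lemma Ck_bounded_linear:
  assumes "open U" "bounded_linear f"
  shows "Ck k U f"
proof (cases k)
  case 0
  then show ?thesis using assms by (simp add: linear_continuous_on)
next
  case (Suc j)
  show ?thesis unfolding Suc
    by (rule Ck_SucI[where f' = "\<lambda>x. f"])
      (use assms in \<open>auto intro!: Ck_const bounded_linear_imp_has_derivative\<close>)
qed

lemma sum_Basis_inner:
  fixes u :: "'a::euclidean_space \<Rightarrow> real"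
  assumes "b \<in> Basis"
  shows "(\<Sum>c\<in>Basis. (b \<bullet> c) * u c) = u b"
  using assms by (simp add: inner_Basis if_distrib[of "\<lambda>x. x * _"] cong: if_cong)

lemma Ck_add:
  assumes "open U"
  shows "Ck k U f \<Longrightarrow> Ck k U g \<Longrightarrow> Ck k U (\<lambda>x. f x + g x)"
proof (induction k arbitrary: f g)
  case (Suc k)
  show ?case
  proof (rule Ck_SucI[OF assms])
    fix x assume x: "x \<in> U"
    show "((\<lambda>x. f x + g x) has_derivative (\<lambda>h. (\<Sum>b\<in>Basis. (h \<bullet> b) * pder b f x)
       + (\<Sum>b\<in>Basis. (h \<bullet> b) * pder b g x))) (at x)"
      by (intro has_derivative_add Ck_Suc_has_derivative[OF assms x Suc.prems(1)] Ck_Suc_has_derivative[OF assms x Suc.prems(2)])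
  next
    fix b :: 'a assume b: "b \<in> Basis"
    show "Ck k U (\<lambda>x. (\<Sum>c\<in>Basis. (b \<bullet> c) * pder c f x) + (\<Sum>c\<in>Basis. (b \<bullet> c) * pder c g x))"
      unfolding sum_Basis_inner[OF b] using b Suc.prems by (intro Suc.IH) auto
  qed
qed (auto intro!: continuous_on_add)

lemma Ck_minus:
  assumes "open U"
  shows "Ck k U f \<Longrightarrow> Ck k U (\<lambda>x. - f x)"
proof (induction k arbitrary: f)
  case (Suc k)
  show ?case
  proof (rule Ck_SucI[OF assms])
    fix x assume x: "x \<in> U"
    show "((\<lambda>x. - f x) has_derivative (\<lambda>h. - (\<Sum>b\<in>Basis. (h \<bullet> b) * pder b f x))) (at x)"
      by (intro has_derivative_minus Ck_Suc_has_derivative[OF assms x Suc.prems(1)])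
  next
    fix b :: 'a assume b: "b \<in> Basis"
    show "Ck k U (\<lambda>x. - (\<Sum>c\<in>Basis. (b \<bullet> c) * pder c f x))"
      unfolding sum_Basis_inner[OF b] using b Suc.prems by (intro Suc.IH) auto
  qed
qed (auto intro!: continuous_on_minus)

lemma Ck_diff:
  assumes "open U" "Ck k U f" "Ck k U g"
  shows "Ck k U (\<lambda>x. f x - g x)"
  using Ck_add[OF assms(1,2) Ck_minus[OF assms(1,3)]] by simp

lemma Ck_sum:
  assumes "open U" "\<And>i. i \<in> S \<Longrightarrow> Ck k U (f i)"
  shows "Ck k U (\<lambda>x. \<Sum>i\<in>S. f i x)"
  using assms(2)
  by (induction S rule: infinite_finite_induct) (auto intro!: Ck_const Ck_add assms(1))

lemma Ck_mult:
  assumes "open U"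
  shows "Ck k U f \<Longrightarrow> Ck k U g \<Longrightarrow> Ck k U (\<lambda>x. f x * g x)"
proof (induction k arbitrary: f g)
  case (Suc k)
  have fg: "Ck k U f" "Ck k U g" using Suc.prems Ck_Suc_imp by blast+
  show ?case
  proof (rule Ck_SucI[OF assms])
    fix x assume x: "x \<in> U"
    show "((\<lambda>x. f x * g x) has_derivative (\<lambda>h. f x * (\<Sum>b\<in>Basis. (h \<bullet> b) * pder b g x)
       + (\<Sum>b\<in>Basis. (h \<bullet> b) * pder b f x) * g x)) (at x)"
      by (intro has_derivative_mult Ck_Suc_has_derivative[OF assms x Suc.prems(1)] Ck_Suc_has_derivative[OF assms x Suc.prems(2)])
  next
    fix b :: 'a assume b: "b \<in> Basis"
    show "Ck k U (\<lambda>x. f x * (\<Sum>c\<in>Basis. (b \<bullet> c) * pder c g x)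
       + (\<Sum>c\<in>Basis. (b \<bullet> c) * pder c f x) * g x)"
      unfolding sum_Basis_inner[OF b] using b Suc.prems by (intro Ck_add[OF assms] Suc.IH fg) auto
  qed
qed (auto intro!: continuous_on_mult)

lemma Ck_power: "open U \<Longrightarrow> Ck k U f \<Longrightarrow> Ck k U (\<lambda>x. f x ^ n)"
  by (induction n) (auto intro!: Ck_const Ck_mult)

lemma Ck_inverse:
  assumes "open U" "\<And>x. x \<in> U \<Longrightarrow> f x \<noteq> 0"
  shows "Ck k U f \<Longrightarrow> Ck k U (\<lambda>x. inverse (f x))"
proof (induction k)
  case (Suc k)
  have I: "Ck k U (\<lambda>x. inverse (f x))" using Suc Ck_Suc_imp by blast
  show ?case
  proof (rule Ck_SucI[OF assms(1)])
    fix x assume x: "x \<in> U"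
    show "((\<lambda>x. inverse (f x)) has_derivative
      (\<lambda>h. - (inverse (f x) * (\<Sum>b\<in>Basis. (h \<bullet> b) * pder b f x) * inverse (f x)))) (at x)"
      using assms(2)[OF x] Ck_Suc_has_derivative[OF assms(1) x Suc.prems]
      by (rule Deriv.has_derivative_inverse)
  next
    fix b :: 'a assume b: "b \<in> Basis"
    show "Ck k U (\<lambda>x. - (inverse (f x) * (\<Sum>c\<in>Basis. (b \<bullet> c) * pder c f x) * inverse (f x)))"
      unfolding sum_Basis_inner[OF b] using b Suc.prems by (intro Ck_minus Ck_mult assms(1) I) auto
  qed
qed (use assms in \<open>auto intro!: continuous_on_inverse\<close>)

text \<open>Each partial derivative of the composite is a sum of products of a partial derivative of
  \<open>g\<close> with \<open>pder d f\<close> after \<open>g\<close>. The induction therefore runs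
  over all \<open>f\<close> with \<open>g\<close> fixed, and \<open>g\<close> has to be kept at both
  levels k + 1 and k.\<close>

lemma Ck_compose:
  fixes g :: "'a::euclidean_space \<Rightarrow> 'b::euclidean_space"
  assumes "open U" "open V" "g ` U \<subseteq> V"
  shows "Ck k V f \<Longrightarrow> (\<And>c. c \<in> Basis \<Longrightarrow> Ck k U (\<lambda>x. g x \<bullet> c)) \<Longrightarrow> Ck k U (\<lambda>x. f (g x))"
proof (induction k arbitrary: f)
  case 0
  then have "continuous_on U g" by (intro continuous_on_componentwise[THEN iffD2]) auto
  then show ?case using 0 assms(3) by (auto intro: continuous_on_compose2)
next
  case (Suc k)
  have gk: "Ck k U (\<lambda>x. g x \<bullet> c)" if "c \<in> Basis" for c
    using Suc.prems(2)[OF that] Ck_Suc_imp by blast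
  show ?case
  proof (rule Ck_SucI[OF assms(1)])
    fix x assume x: "x \<in> U"
    have 1: "(g has_derivative (\<lambda>h. \<Sum>c\<in>Basis. (\<Sum>b\<in>Basis. (h \<bullet> b) * pder b (\<lambda>x. g x \<bullet> c) x) *\<^sub>R c)) (at x)"
      unfolding has_derivative_componentwise_within[of g]
      using Ck_Suc_has_derivative[OF assms(1) x Suc.prems(2)]
      by (auto simp: inner_sum_left inner_Basis if_distrib cong: if_cong)
    have 2: "(f has_derivative (\<lambda>h. \<Sum>c\<in>Basis. (h \<bullet> c) * pder c f (g x))) (at (g x))"
      using x assms(3) by (intro Ck_Suc_has_derivative[OF assms(2) _ Suc.prems(1)]) auto
    have "((\<lambda>x. f (g x)) has_derivative (\<lambda>h. \<Sum>d\<in>Basis. ((\<Sum>c\<in>Basis. (\<Sum>b\<in>Basis. (h \<bullet> b) * pder b (\<lambda>x. g x \<bullet> c) x) *\<^sub>R c) \<bullet> d) * pder d f (g x))) (at x)"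
      by (rule has_derivative_compose[OF 1 2])
    then show "((\<lambda>x. f (g x)) has_derivative (\<lambda>h. \<Sum>d\<in>Basis. (\<Sum>b\<in>Basis. (h \<bullet> b) * pder b (\<lambda>x. g x \<bullet> d) x) * pder d f (g x))) (at x)"
      by (simp add: inner_sum_left inner_Basis if_distrib cong: if_cong)
  next
    fix b :: 'a assume b: "b \<in> Basis"
    show "Ck k U (\<lambda>x. \<Sum>d\<in>Basis. (\<Sum>c\<in>Basis. (b \<bullet> c) * pder c (\<lambda>x. g x \<bullet> d) x) * pder d f (g x))"
      unfolding sum_Basis_inner[OF b]
    proof (intro Ck_sum Ck_mult assms(1))
      fix d :: 'b assume d: "d \<in> Basis"
      show "Ck k U (pder b (\<lambda>x. g x \<bullet> d))" using Suc.prems(2)[OF d] b by simp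
      show "Ck k U (\<lambda>x. pder d f (g x))"
        by (rule Suc.IH) (use Suc.prems(1) d gk in auto)
    qed
  qed
qed


section \<open>Inverse functions and germs of diffeomorphisms\<close>

text \<open>Bootstrapping: the derivative of \<open>g\<close> is \<open>L\<close> after
  \<open>g\<close>, so if \<open>g\<close> is C^j and the entries of \<open>L\<close> are C^k with j
  at most k, then \<open>g\<close> is C^(j+1). Taking the inverse derivative \<open>L\<close> as a
  parameter avoids the regularity of inversion of linear maps in general.\<close>

lemma Ck_inverse_map:
  fixes f g :: "'a::euclidean_space \<Rightarrow> 'a"
  assumes U: "open U" and V: "open V" and gV: "g ` V \<subseteq> U" and contg: "continuous_on V g"
    and fg: "\<And>y. y \<in> V \<Longrightarrow> f (g y) = y"
    and der: "\<And>x. x \<in> U \<Longrightarrow> (f has_derivative f' x) (at x)"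
    and L: "\<And>x. x \<in> U \<Longrightarrow> bounded_linear (L x)" "\<And>x. x \<in> U \<Longrightarrow> L x \<circ> f' x = id"
    and Ck: "\<And>b c. b \<in> Basis \<Longrightarrow> c \<in> Basis \<Longrightarrow> Ck k U (\<lambda>x. L x b \<bullet> c)"
    and c: "c \<in> Basis"
  shows "Ck (Suc k) V (\<lambda>y. g y \<bullet> c)"
proof -
  have derg: "(g has_derivative L (g y)) (at y)" if "y \<in> V" for y
  proof (rule has_derivative_inverse_basic[of f "f' (g y)"])
    show "continuous (at y) g" using contg V that by (simp add: continuous_on_eq_continuous_at)
  qed (use that gV V fg der L in auto)
  have "j \<le> Suc k \<Longrightarrow> c \<in> Basis \<Longrightarrow> Ck j V (\<lambda>y. g y \<bullet> c)" for j c
  proof (induction j arbitrary: c)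
    case 0
    then show ?case using contg by (auto intro!: continuous_on_inner)
  next
    case (Suc j)
    show ?case
    proof (rule Ck_SucI[OF V])
      fix y assume "y \<in> V"
      then show "((\<lambda>y. g y \<bullet> c) has_derivative (\<lambda>h. L (g y) h \<bullet> c)) (at y)"
        by (intro has_derivative_inner_left derg)
    next
      fix b :: 'a assume b: "b \<in> Basis"
      show "Ck j V (\<lambda>y. L (g y) b \<bullet> c)"
      proof (rule Ck_compose[OF V U gV, of j "\<lambda>x. L x b \<bullet> c"])
        show "Ck j U (\<lambda>x. L x b \<bullet> c)" using Ck_mono[OF Ck[OF b Suc.prems(2)]] Suc.prems(1) by simp
      qed (use Suc in simp)
    qed
  qed
  then show ?thesis using c by blast
qed

lemma Cr_continuous: "Cr r U f \<Longrightarrow> continuous_on U f"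
  unfolding Cr_def
  by (rule continuous_on_componentwise[THEN iffD2]) (metis Ck_continuous zero_enat_def zero_le)

lemma Cr_subset: "Cr r U f \<Longrightarrow> V \<subseteq> U \<Longrightarrow> Cr r V f"
  unfolding Cr_def using Ck_subset by blast

lemma Cr_cong: "open U \<Longrightarrow> (\<And>x. x \<in> U \<Longrightarrow> f x = g x) \<Longrightarrow> Cr r U f \<Longrightarrow> Cr r U g"
  unfolding Cr_def by (metis (mono_tags, lifting) Ck_cong)

lemma Cr_compose:
  assumes "open U" "open V" "g ` U \<subseteq> V" "Cr r V f" "Cr r U g"
  shows "Cr r U (\<lambda>x. f (g x))"
  using assms unfolding Cr_def
  by (auto intro!: Ck_compose[OF assms(1-3), of _ "\<lambda>x. f x \<bullet> _"])

lemma Cr_id: "open U \<Longrightarrow> Cr r U (\<lambda>x. x)"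
  unfolding Cr_def by (auto intro!: Ck_bounded_linear bounded_linear_inner_left)

lemma Cr_real_iff: "Cr r U (f :: 'a::euclidean_space \<Rightarrow> real) \<longleftrightarrow> (\<forall>k. enat k \<le> r \<longrightarrow> Ck k U f)"
  unfolding Cr_def by auto

lemma Basis_real2: "(Basis :: (real \<times> real) set) = {(1,0), (0,1)}"
  by (auto simp: Basis_prod_def)

lemma Cr_pair_iff:
  "Cr r U (f :: 'a::euclidean_space \<Rightarrow> real \<times> real) \<longleftrightarrow>
    (\<forall>k. enat k \<le> r \<longrightarrow> Ck k U (\<lambda>x. fst (f x)) \<and> Ck k U (\<lambda>x. snd (f x)))"
  unfolding Cr_def by (auto simp: Basis_real2 inner_prod_def)

text \<open>The inverse function theorem gives a local homeomorphism; its inverse gains its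
  regularity from the bootstrapping above. The hypothesis on \<open>L\<close> is one order below
  that on \<open>f\<close>, as befits an inverse of the first derivative.\<close>

lemma local_diffeo_exists:
  fixes f :: "'a::euclidean_space \<Rightarrow> 'a"
  assumes W: "open W" "p \<in> W" and f: "Cr r W f"
    and der: "\<And>x. x \<in> W \<Longrightarrow> (f has_derivative f' x) (at x)"
    and contf: "\<And>b. b \<in> Basis \<Longrightarrow> continuous_on W (\<lambda>x. f' x b)"
    and L: "\<And>x. x \<in> W \<Longrightarrow> bounded_linear (L x)" "\<And>x. x \<in> W \<Longrightarrow> L x \<circ> f' x = id"
    and Ck: "\<And>b c k. b \<in> Basis \<Longrightarrow> c \<in> Basis \<Longrightarrow> enat (Suc k) \<le> r \<Longrightarrow> Ck k W (\<lambda>x. L x b \<bullet> c)"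
  shows "\<exists>U. p \<in> U \<and> Cr_diffeo r U f"
proof -
  have bl: "bounded_linear (f' x)" if "x \<in> W" for x
    using der[OF that] has_derivative_bounded_linear by blast
  define F where "F x = Blinfun (f' x)" for x
  have F: "blinfun_apply (F x) = f' x" if "x \<in> W" for x
    unfolding F_def using bl[OF that] by (simp add: bounded_linear_Blinfun_apply)
  have contF: "continuous_on W F"
  proof (rule continuous_on_blinfun_componentwise)
    fix b :: 'a assume "b \<in> Basis"
    from contf[OF this] show "continuous_on W (\<lambda>x. blinfun_apply (F x) b)"
      by (rule continuous_on_eq) (simp add: F)
  qed
  have inv: "Blinfun (L p) o\<^sub>L F p = id_blinfun"
    using L(2)[OF W(2)]
    by (intro blinfun_eqI) (simp add: F[OF W(2)] bounded_linear_Blinfun_apply[OF L(1)[OF W(2)]] fun_eq_iff)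
  have derF: "(f has_derivative blinfun_apply (F x)) (at x)" if "x \<in> W" for x
    using der[OF that] by (simp add: F[OF that])
  obtain U V g g' where U: "open U" "U \<subseteq> W" "p \<in> U" "open V" "f p \<in> V"
    and hom: "homeomorphism U V f g"
    using inverse_function_theorem[OF W(1) derF contF W(2) inv] by metis
  have gV: "g ` V = U" and fU: "f ` U = V" and fg: "\<And>y. y \<in> V \<Longrightarrow> f (g y) = y"
    and gf: "\<And>x. x \<in> U \<Longrightarrow> g (f x) = x" and cg: "continuous_on V g"
    using hom by (auto simp: homeomorphism_def)
  have inj: "inj_on f U" using gf by (metis inj_on_inverseI)
  have "Cr r V g" unfolding Cr_def
  proof (intro allI impI ballI)
    fix k and c :: 'a assume k: "enat k \<le> r" and c: "c \<in> Basis"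
    show "Ck k V (\<lambda>y. g y \<bullet> c)"
    proof (cases k)
      case 0
      then show ?thesis using cg by (auto intro!: continuous_on_inner)
    next
      case (Suc j)
      show ?thesis unfolding Suc
      proof (rule Ck_inverse_map[OF U(1,4) _ cg fg, of f' L])
        show "Ck j U (\<lambda>x. L x b \<bullet> c)" if "b \<in> Basis" "c \<in> Basis" for b c
          using Ck_subset[OF Ck U(2)] that k Suc by simp
      qed (use gV der L U(2) c in auto)
    qed
  qed
  then have "Cr r V (inv_into U f)"
    by (rule Cr_cong[OF U(4), rotated]) (metis gV fg inj inv_into_f_eq imageI)
  then show ?thesis
    using U Cr_subset[OF f U(2)] inj fU by (auto simp: Cr_diffeo_def)
qed

lemma Ck_real_Suc:
  fixes f :: "real \<Rightarrow> real"
  shows "Ck (Suc k) U f \<longleftrightarrow> continuous_on U f \<and> (\<forall>x\<in>U. f differentiable (at x)) \<and> Ck k U (deriv f)"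
proof -
  have "(\<lambda>s. f (x + s)) differentiable (at 0) \<longleftrightarrow> f differentiable (at x)" for x
    using DERIV_shift[of f _ 0 x] by (simp add: real_differentiable_def add.commute)
  moreover have "pder 1 f = deriv f"
    using DERIV_shift[of f _ 0] by (auto simp: fun_eq_iff pder_def deriv_def add.commute)
  ultimately show ?thesis by simp
qed

lemma local_diffeo_real:
  fixes f :: "real \<Rightarrow> real"
  assumes W: "open W" "p \<in> W" and f: "Cr r W f" and r: "1 \<le> r" and d: "deriv f p \<noteq> 0"
  shows "\<exists>U. p \<in> U \<and> Cr_diffeo r U f"
proof -
  have C1: "Ck (Suc 0) W f" using f r by (simp add: Cr_real_iff one_enat_def del: Ck.simps)
  then have cont: "continuous_on W (deriv f)" and diff: "\<And>x. x \<in> W \<Longrightarrow> f differentiable (at x)"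
    by (auto simp: Ck_real_Suc simp del: Ck.simps(2))
  define W' where "W' = W \<inter> deriv f -` (- {0})"
  have W': "open W'" "p \<in> W'" "W' \<subseteq> W"
    unfolding W'_def using W d by (auto intro!: continuous_open_preimage cont)
  show ?thesis
  proof (rule local_diffeo_exists[OF W'(1,2), where f' = "\<lambda>x h. deriv f x * h" and L = "\<lambda>x h. inverse (deriv f x) * h"])
    show "Cr r W' f" using Cr_subset[OF f W'(3)] .
    show "(f has_derivative (\<lambda>h. deriv f x * h)) (at x)" if "x \<in> W'" for x
    proof -
      have "f differentiable (at x)" using diff that W'(3) by blast
      then show ?thesis
        by (simp add: DERIV_deriv_iff_real_differentiable[symmetric] has_field_derivative_def)
    qed
    show "continuous_on W' (\<lambda>x. deriv f x * b)" for b
      using continuous_on_subset[OF cont W'(3)] by (intro continuous_on_mult_right)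
    show "(\<lambda>h. inverse (deriv f x) * h) \<circ> (\<lambda>h. deriv f x * h) = id" if "x \<in> W'" for x
      using that by (auto simp: W'_def)
    fix k and b c :: real
    assume "enat (Suc k) \<le> r"
    then have "Ck (Suc k) W' f" using f Ck_subset[OF _ W'(3)] by (simp add: Cr_real_iff del: Ck.simps)
    then have "Ck k W' (deriv f)" by (simp add: Ck_real_Suc del: Ck.simps)
    then have "Ck k W' (\<lambda>x. inverse (deriv f x) * (b * c))"
      using W' by (intro Ck_mult Ck_inverse Ck_const) (auto simp: W'_def)
    then show "Ck k W' (\<lambda>x. (inverse (deriv f x) * b) \<bullet> c)" by (simp add: mult.assoc)
  qed (rule bounded_linear_mult_right)
qed

lemma Ck_Suc_has_derivative2:
  fixes f :: "real \<times> real \<Rightarrow> real"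
  assumes "open U" "x \<in> U" "Ck (Suc k) U f"
  shows "(f has_derivative (\<lambda>h. pder (1,0) f x * fst h + pder (0,1) f x * snd h)) (at x)"
  using Ck_Suc_has_derivative[OF assms]
  by (simp add: Basis_real2 inner_prod_def algebra_simps)

lemma local_diffeo_real2:
  fixes f g :: "real \<times> real \<Rightarrow> real"
  assumes W: "open W" "p \<in> W"
    and f: "\<And>k. enat k \<le> r \<Longrightarrow> Ck k W f" and g: "\<And>k. enat k \<le> r \<Longrightarrow> Ck k W g" and r: "1 \<le> r"
    and df: "(f has_derivative (\<lambda>h. a * fst h + b * snd h)) (at p)"
    and dg: "(g has_derivative (\<lambda>h. c * fst h + d * snd h)) (at p)"
    and det: "a * d - b * c \<noteq> 0"
  shows "\<exists>U. p \<in> U \<and> Cr_diffeo r U (\<lambda>x. (f x, g x))"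
proof -
  have C1: "Ck (Suc 0) W f" "Ck (Suc 0) W g" using f g r by (simp_all add: one_enat_def del: Ck.simps)
  define f1 f2 g1 g2 where defs: "f1 = pder (1,0) f" "f2 = pder (0,1) f" "g1 = pder (1,0) g" "g2 = pder (0,1) g"
  define J where "J x = f1 x * g2 x - f2 x * g1 x" for x
  have Ckp: "Ck k W f1 \<and> Ck k W f2 \<and> Ck k W g1 \<and> Ck k W g2" if "enat (Suc k) \<le> r" for k
    using f[OF that] g[OF that] by (auto simp: defs Basis_real2)
  have cont: "continuous_on W f1" "continuous_on W f2" "continuous_on W g1" "continuous_on W g2"
    using C1 by (auto simp: defs Basis_real2)
  have contJ: "continuous_on W J" unfolding J_def
    by (intro continuous_on_diff continuous_on_mult cont)
  have "f1 p = a" "f2 p = b" "g1 p = c" "g2 p = d"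
    by (simp_all add: defs has_derivative_pder[OF df] has_derivative_pder[OF dg])
  then have Jp: "J p \<noteq> 0" using det by (simp add: J_def)
  define W' where "W' = W \<inter> J -` (- {0})"
  have W': "open W'" "p \<in> W'" "W' \<subseteq> W" "\<And>x. x \<in> W' \<Longrightarrow> J x \<noteq> 0"
    unfolding W'_def using W Jp by (auto intro!: continuous_open_preimage contJ)
  define f' where "f' x h = (f1 x * fst h + f2 x * snd h, g1 x * fst h + g2 x * snd h)" for x and h :: "real \<times> real"
  \<comment> \<open>Cramer's rule: the inverse matrix is the adjugate divided by the Jacobian
    \<open>J\<close>, so its entries are as regular as the first partial derivatives.\<close>
  define L where "L x h = (inverse (J x) * g2 x * fst h - inverse (J x) * f2 x * snd h,
    inverse (J x) * f1 x * snd h - inverse (J x) * g1 x * fst h)" for x and h :: "real \<times> real"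
  show ?thesis
  proof (rule local_diffeo_exists[OF W'(1,2), of r _ f' L])
    show "Cr r W' (\<lambda>x. (f x, g x))" using f g Ck_subset[OF _ W'(3)] by (auto simp: Cr_pair_iff)
    show "((\<lambda>x. (f x, g x)) has_derivative f' x) (at x)" if "x \<in> W'" for x
    proof -
      have "x \<in> W" using that W'(3) by blast
      from Ck_Suc_has_derivative2[OF W(1) this C1(1)] Ck_Suc_has_derivative2[OF W(1) this C1(2)]
      show ?thesis unfolding f'_def defs by (rule has_derivative_Pair)
    qed
    show "continuous_on W' (\<lambda>x. f' x b)" for b :: "real \<times> real"
      unfolding f'_def
      by (intro continuous_on_Pair continuous_on_add continuous_on_mult_right continuous_on_subset[OF _ W'(3)] cont)
    show "L x \<circ> f' x = id" if "x \<in> W'" for x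
    proof -
      have "inverse (J x) * J x = 1" using W'(4)[OF that] by simp
      then have i: "inverse (J x) * (f1 x * g2 x) = 1 + inverse (J x) * (f2 x * g1 x)"
        by (simp add: J_def algebra_simps)
      have "inverse (J x) * g2 x * (f1 x * u + f2 x * v) - inverse (J x) * f2 x * (g1 x * u + g2 x * v)
          = (inverse (J x) * (f1 x * g2 x)) * u - inverse (J x) * (f2 x * g1 x) * u" for u v
        by (simp add: algebra_simps)
      then have 1: "inverse (J x) * g2 x * (f1 x * u + f2 x * v) - inverse (J x) * f2 x * (g1 x * u + g2 x * v) = u" for u v
        unfolding i by (simp add: algebra_simps)
      have "inverse (J x) * f1 x * (g1 x * u + g2 x * v) - inverse (J x) * g1 x * (f1 x * u + f2 x * v)
          = (inverse (J x) * (f1 x * g2 x)) * v - inverse (J x) * (f2 x * g1 x) * v" for u v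
        by (simp add: algebra_simps)
      then have 2: "inverse (J x) * f1 x * (g1 x * u + g2 x * v) - inverse (J x) * g1 x * (f1 x * u + f2 x * v) = v" for u v
        unfolding i by (simp add: algebra_simps)
      show ?thesis by (rule ext) (simp only: f'_def L_def o_def fst_conv snd_conv 1 2 id_def prod.collapse)
    qed
    show "bounded_linear (L x)" for x unfolding L_def
      by (intro bounded_linear_Pair bounded_linear_sub bounded_linear_const_mult bounded_linear_fst bounded_linear_snd)
    fix k and b c :: "real \<times> real"
    assume k: "enat (Suc k) \<le> r" and "b \<in> Basis" "c \<in> Basis"
    have p: "Ck k W' f1" "Ck k W' f2" "Ck k W' g1" "Ck k W' g2"
      using Ckp[OF k] Ck_subset[OF _ W'(3)] by auto
    have "Ck k W' J" unfolding J_def by (intro Ck_diff Ck_mult p W'(1))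
    then have J: "Ck k W' (\<lambda>x. inverse (J x))" by (intro Ck_inverse[OF W'(1)] W'(4))
    show "Ck k W' (\<lambda>x. L x b \<bullet> c)"
      unfolding L_def inner_prod_def fst_conv snd_conv inner_real_def
      by (intro Ck_add Ck_diff Ck_mult Ck_const p J W'(1))
  qed
qed

section \<open>Restriction, inversion, composition and germs of diffeomorphisms\<close>

lemma Cr_diffeo_open_image:
  assumes d: "Cr_diffeo r U f" and W: "open W" "W \<subseteq> U"
  shows "open (f ` W)"
proof -
  have o: "open (f ` U)" "inj_on f U" and "continuous_on (f ` U) (inv_into U f)"
    using d Cr_continuous by (auto simp: Cr_diffeo_def)
  then have "open (f ` U \<inter> inv_into U f -` W)" using W by (intro continuous_open_preimage)
  moreover have "f ` U \<inter> inv_into U f -` W = f ` W"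
    using W o by (auto simp: inv_into_f_f subset_eq)
  ultimately show ?thesis by simp
qed

lemma Cr_diffeo_subset:
  assumes d: "Cr_diffeo r U f" and W: "open W" "W \<subseteq> U"
  shows "Cr_diffeo r W f"
proof -
  have o: "open (f ` W)" using Cr_diffeo_open_image[OF assms] .
  have inj: "inj_on f U" "inj_on f W" using d W inj_on_subset by (auto simp: Cr_diffeo_def)
  have "Cr r (f ` W) (inv_into W f)"
  proof (rule Cr_cong[OF o])
    show "Cr r (f ` W) (inv_into U f)"
      using d W Cr_subset[of r "f ` U" "inv_into U f" "f ` W"] by (auto simp: Cr_diffeo_def)
    show "inv_into U f y = inv_into W f y" if "y \<in> f ` W" for y
      using that inj W by (auto simp: inv_into_f_f subset_eq)
  qed
  moreover have "Cr r W f" using d W Cr_subset by (auto simp: Cr_diffeo_def)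
  ultimately show ?thesis using W o inj by (simp add: Cr_diffeo_def)
qed

lemma Cr_diffeo_inv_into:
  assumes d: "Cr_diffeo r U f"
  shows "Cr_diffeo r (f ` U) (inv_into U f)"
proof -
  have o: "open U" "open (f ` U)" "inj_on f U" "Cr r U f" using d by (auto simp: Cr_diffeo_def)
  have im: "inv_into U f ` f ` U = U" using o by (simp add: image_image)
  have inj: "inj_on (inv_into U f) (f ` U)" by (simp add: inj_on_inv_into)
  have "Cr r U (inv_into (f ` U) (inv_into U f))"
  proof (rule Cr_cong[OF o(1) _ o(4)])
    show "f x = inv_into (f ` U) (inv_into U f) x" if "x \<in> U" for x
      using inv_into_f_f[OF inj, of "f x"] that o(3) by simp
  qed
  then show ?thesis using d im inj by (simp add: Cr_diffeo_def)
qed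

lemma Cr_diffeo_compose:
  assumes f: "Cr_diffeo r U f" and g: "Cr_diffeo r V g" and sub: "f ` U \<subseteq> V"
  shows "Cr_diffeo r U (\<lambda>x. g (f x))"
proof -
  have fo: "open U" "open (f ` U)" "inj_on f U" "Cr r U f" using f by (auto simp: Cr_diffeo_def)
  have g': "Cr_diffeo r (f ` U) g" by (rule Cr_diffeo_subset[OF g fo(2) sub])
  then have go: "open (g ` f ` U)" "inj_on g (f ` U)" "Cr r (f ` U) g" by (auto simp: Cr_diffeo_def)
  have inj: "inj_on (\<lambda>x. g (f x)) U" using fo(3) go(2) by (auto simp: inj_on_def)
  have im: "inv_into (f ` U) g ` g ` f ` U \<subseteq> f ` U"
    using go(2) by (auto simp: inv_into_f_f)
  have "Cr r (g ` f ` U) (\<lambda>y. inv_into U f (inv_into (f ` U) g y))"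
    by (rule Cr_compose[OF go(1) fo(2) im]) (use f g' in \<open>auto simp: Cr_diffeo_def\<close>)
  then have "Cr r (g ` f ` U) (inv_into U (\<lambda>x. g (f x)))"
  proof (rule Cr_cong[OF go(1), rotated])
    fix y assume "y \<in> g ` f ` U"
    then obtain x where "x \<in> U" "y = g (f x)" by auto
    then show "inv_into U f (inv_into (f ` U) g y) = inv_into U (\<lambda>x. g (f x)) y"
      using fo(3) go(2) inv_into_f_f[OF inj] by simp
  qed
  moreover have "(\<lambda>x. g (f x)) ` U = g ` f ` U" by auto
  moreover have "Cr r U (\<lambda>x. g (f x))" by (rule Cr_compose[OF fo(1,2) _ go(3) fo(4)]) simp
  ultimately show ?thesis using fo go inj by (simp add: Cr_diffeo_def)
qed

text \<open>The image of \<open>p\<close> is left arbitrary, since \<open>Cr_equiv\<close> does not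
  require the curves to pass through the origin of the plane.\<close>

definition diffeo_germ :: "enat \<Rightarrow> ('a::euclidean_space \<Rightarrow> 'a) \<Rightarrow> 'a \<Rightarrow> bool" where
  "diffeo_germ r f p \<longleftrightarrow> (\<exists>U. p \<in> U \<and> Cr_diffeo r U f)"

lemma diffeo_germ_tendsto:
  assumes "diffeo_germ r f p"
  shows "(f \<longlongrightarrow> f p) (nhds p)"
proof -
  obtain U where "p \<in> U" "Cr_diffeo r U f" using assms by (auto simp: diffeo_germ_def)
  then have "open U" "continuous_on U f" "p \<in> U" using Cr_continuous by (auto simp: Cr_diffeo_def)
  then show ?thesis
    by (metis continuous_on_eq_continuous_at isCont_def tendsto_at_iff_tendsto_nhds)
qed

lemma diffeo_germ_compose:
  assumes "diffeo_germ r f p" "diffeo_germ r g (f p)"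
  shows "diffeo_germ r (\<lambda>x. g (f x)) p"
proof -
  obtain U V where U: "p \<in> U" "Cr_diffeo r U f" and V: "f p \<in> V" "Cr_diffeo r V g"
    using assms by (auto simp: diffeo_germ_def)
  have o: "open U" "open V" "continuous_on U f" using U V Cr_continuous by (auto simp: Cr_diffeo_def)
  define W where "W = U \<inter> f -` V"
  have W: "open W" "W \<subseteq> U" "p \<in> W"
    unfolding W_def using o U V by (auto intro: continuous_open_preimage)
  have "Cr_diffeo r W (\<lambda>x. g (f x))"
    by (rule Cr_diffeo_compose[OF Cr_diffeo_subset[OF U(2) W(1,2)] V(2)]) (auto simp: W_def)
  then show ?thesis using W(3) by (auto simp: diffeo_germ_def)
qed

lemma diffeo_germ_inverse:
  assumes "diffeo_germ r f p"
  obtains g where "diffeo_germ r g (f p)" "g (f p) = p"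
    "\<forall>\<^sub>F x in nhds p. g (f x) = x" "\<forall>\<^sub>F y in nhds (f p). f (g y) = y"
proof -
  obtain U where U: "p \<in> U" "Cr_diffeo r U f" using assms by (auto simp: diffeo_germ_def)
  then have o: "open U" "open (f ` U)" "inj_on f U" by (auto simp: Cr_diffeo_def)
  show ?thesis
  proof (rule that[of "inv_into U f"])
    show "diffeo_germ r (inv_into U f) (f p)"
      using Cr_diffeo_inv_into[OF U(2)] U(1) by (auto simp: diffeo_germ_def)
    show "inv_into U f (f p) = p" using o U by simp
    show "\<forall>\<^sub>F x in nhds p. inv_into U f (f x) = x"
      using eventually_nhds_in_open[OF o(1) U(1)] by eventually_elim (use o in auto)
    have "f p \<in> f ` U" using U(1) by simp
    from eventually_nhds_in_open[OF o(2) this]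
    show "\<forall>\<^sub>F y in nhds (f p). f (inv_into U f y) = y"
      by eventually_elim (simp add: f_inv_into_f)
  qed
qed

text \<open>With \<open>\<psi>\<close> moved to the right-hand side, \<open>inv_into\<close> and the
  explicit domains disappear, and transitivity and symmetry become composition and inversion of
  germs.\<close>

lemma Cr_equiv_iff:
  "Cr_equiv r \<gamma>1 \<gamma>2 \<longleftrightarrow> (\<exists>\<psi> \<Psi>. diffeo_germ r \<psi> 0 \<and> \<psi> 0 = 0 \<and> diffeo_germ r \<Psi> (\<gamma>1 0) \<and>
     (\<forall>\<^sub>F t in nhds 0. \<Psi> (\<gamma>1 t) = \<gamma>2 (\<psi> t)))" (is "?L \<longleftrightarrow> ?R")
proof
  assume ?L
  then obtain U \<psi> V \<Psi> where *: "0 \<in> U" "Cr_diffeo r U \<psi>" "\<psi> 0 = 0" "\<gamma>1 0 \<in> V" "Cr_diffeo r V \<Psi>"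
    and ev: "\<forall>\<^sub>F s in nhds 0. \<Psi> (\<gamma>1 (inv_into U \<psi> s)) = \<gamma>2 s"
    unfolding Cr_equiv_def by blast
  have d: "diffeo_germ r \<psi> 0" "diffeo_germ r \<Psi> (\<gamma>1 0)" using * by (auto simp: diffeo_germ_def)
  have o: "open U" "inj_on \<psi> U" using * by (auto simp: Cr_diffeo_def)
  have "filterlim \<psi> (nhds 0) (nhds 0)" using diffeo_germ_tendsto[OF d(1)] *(3) by simp
  from eventually_compose_filterlim[OF ev this] eventually_nhds_in_open[OF o(1) *(1)]
  have "\<forall>\<^sub>F t in nhds 0. \<Psi> (\<gamma>1 t) = \<gamma>2 (\<psi> t)"
    by eventually_elim (use o in simp)
  then show ?R using d * by blast
next
  assume ?R
  then obtain \<psi> \<Psi> where *: "diffeo_germ r \<psi> 0" "\<psi> 0 = 0" "diffeo_germ r \<Psi> (\<gamma>1 0)"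
    and ev: "\<forall>\<^sub>F t in nhds 0. \<Psi> (\<gamma>1 t) = \<gamma>2 (\<psi> t)" by blast
  then obtain U V where U: "0 \<in> U" "Cr_diffeo r U \<psi>" and V: "\<gamma>1 0 \<in> V" "Cr_diffeo r V \<Psi>"
    by (auto simp: diffeo_germ_def)
  then have o: "open U" "open (\<psi> ` U)" "inj_on \<psi> U" by (auto simp: Cr_diffeo_def)
  have "diffeo_germ r (inv_into U \<psi>) (\<psi> 0)"
    using Cr_diffeo_inv_into[OF U(2)] U(1) by (auto simp: diffeo_germ_def)
  from diffeo_germ_tendsto[OF this] have "filterlim (inv_into U \<psi>) (nhds 0) (nhds 0)"
    using *(2) inv_into_f_f[OF o(3) U(1)] by simp
  from eventually_compose_filterlim[OF ev this]
  have "\<forall>\<^sub>F s in nhds 0. \<Psi> (\<gamma>1 (inv_into U \<psi> s)) = \<gamma>2 (\<psi> (inv_into U \<psi> s))" .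
  moreover have "0 \<in> \<psi> ` U" using U(1) *(2) by (metis imageI)
  then have "\<forall>\<^sub>F s in nhds 0. s \<in> \<psi> ` U"
    by (rule eventually_nhds_in_open[OF o(2)])
  ultimately have "\<forall>\<^sub>F s in nhds 0. \<Psi> (\<gamma>1 (inv_into U \<psi> s)) = \<gamma>2 s"
    by eventually_elim (simp add: f_inv_into_f)
  then show ?L unfolding Cr_equiv_def using U V *(2) by blast
qed

lemma Cr_equiv_trans:
  assumes "Cr_equiv r \<gamma>1 \<gamma>2" "Cr_equiv r \<gamma>2 \<gamma>3"
  shows "Cr_equiv r \<gamma>1 \<gamma>3"
proof -
  obtain \<psi> \<Psi> where a: "diffeo_germ r \<psi> 0" "\<psi> 0 = 0" "diffeo_germ r \<Psi> (\<gamma>1 0)"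
    "\<forall>\<^sub>F t in nhds 0. \<Psi> (\<gamma>1 t) = \<gamma>2 (\<psi> t)"
    using assms(1) unfolding Cr_equiv_iff by blast
  obtain \<phi> \<Phi> where b: "diffeo_germ r \<phi> 0" "\<phi> 0 = 0" "diffeo_germ r \<Phi> (\<gamma>2 0)"
    "\<forall>\<^sub>F t in nhds 0. \<Phi> (\<gamma>2 t) = \<gamma>3 (\<phi> t)"
    using assms(2) unfolding Cr_equiv_iff by blast
  have "\<Psi> (\<gamma>1 0) = \<gamma>2 0" using eventually_nhds_x_imp_x[OF a(4)] a(2) by simp
  then have "diffeo_germ r (\<lambda>x. \<Phi> (\<Psi> x)) (\<gamma>1 0)" using diffeo_germ_compose[OF a(3)] b(3) by simp
  moreover have "diffeo_germ r (\<lambda>x. \<phi> (\<psi> x)) 0" using diffeo_germ_compose[OF a(1)] b(1) a(2) by simp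
  moreover have "filterlim \<psi> (nhds 0) (nhds 0)" using diffeo_germ_tendsto[OF a(1)] a(2) by simp
  from eventually_compose_filterlim[OF b(4) this] a(4)
  have "\<forall>\<^sub>F t in nhds 0. \<Phi> (\<Psi> (\<gamma>1 t)) = \<gamma>3 (\<phi> (\<psi> t))"
    by eventually_elim simp
  moreover have "\<phi> (\<psi> 0) = 0" using a(2) b(2) by simp
  ultimately show ?thesis unfolding Cr_equiv_iff
    by (intro exI[of _ "\<lambda>x. \<phi> (\<psi> x)"] exI[of _ "\<lambda>x. \<Phi> (\<Psi> x)"] conjI)
qed

text \<open>The germ \<open>\<Phi>\<close> inverts \<open>\<Psi>\<close> only near
  \<open>\<gamma>1 0\<close>; continuity of \<open>\<gamma>1\<close> at 0 keeps the curve in that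
  neighbourhood.\<close>

lemma Cr_equiv_sym:
  assumes "Cr_equiv r \<gamma>1 \<gamma>2" and cont: "isCont \<gamma>1 0"
  shows "Cr_equiv r \<gamma>2 \<gamma>1"
proof -
  obtain \<psi> \<Psi> where a: "diffeo_germ r \<psi> 0" "\<psi> 0 = 0" "diffeo_germ r \<Psi> (\<gamma>1 0)"
    and ev: "\<forall>\<^sub>F t in nhds 0. \<Psi> (\<gamma>1 t) = \<gamma>2 (\<psi> t)"
    using assms(1) unfolding Cr_equiv_iff by blast
  obtain \<phi> where p: "diffeo_germ r \<phi> (\<psi> 0)" "\<phi> (\<psi> 0) = 0" "\<forall>\<^sub>F y in nhds (\<psi> 0). \<psi> (\<phi> y) = y"
    by (rule diffeo_germ_inverse[OF a(1)])
  obtain \<Phi> where P: "diffeo_germ r \<Phi> (\<Psi> (\<gamma>1 0))" "\<forall>\<^sub>F x in nhds (\<gamma>1 0). \<Phi> (\<Psi> x) = x"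
    by (rule diffeo_germ_inverse[OF a(3)])
  have "\<Psi> (\<gamma>1 0) = \<gamma>2 0" using eventually_nhds_x_imp_x[OF ev] a(2) by simp
  then have d: "diffeo_germ r \<Phi> (\<gamma>2 0)" "diffeo_germ r \<phi> 0" "\<phi> 0 = 0" using P p a by simp_all
  have lim: "filterlim \<phi> (nhds 0) (nhds 0)" using diffeo_germ_tendsto[OF d(2)] d(3) by simp
  have "filterlim \<gamma>1 (nhds (\<gamma>1 0)) (nhds 0)"
    using cont by (simp add: isCont_def tendsto_at_iff_tendsto_nhds)
  from eventually_compose_filterlim[OF eventually_compose_filterlim[OF P(2) this] lim]
    eventually_compose_filterlim[OF ev lim] p(3)[unfolded a(2)]
  have "\<forall>\<^sub>F s in nhds 0. \<Phi> (\<gamma>2 s) = \<gamma>1 (\<phi> s)"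
    by eventually_elim metis
  then show ?thesis unfolding Cr_equiv_iff using d by blast
qed

lemma diffeo_germ_id: "diffeo_germ r (\<lambda>x. x) p"
proof -
  have "inv_into UNIV (\<lambda>x::'a. x) = (\<lambda>x. x)" using inv_id by (simp add: id_def)
  then show ?thesis
    unfolding diffeo_germ_def Cr_diffeo_def by (intro exI[of _ UNIV]) (auto intro: Cr_id)
qed

lemma Cr_equiv_refl: "Cr_equiv r \<gamma> \<gamma>"
  unfolding Cr_equiv_iff
  by (intro exI[of _ "\<lambda>x. x"] conjI diffeo_germ_id) auto


section \<open>Smooth functions of one variable\<close>

text \<open>For real-valued functions this is \<open>Cr \<infinity>\<close>, without the detour
  through components of the value.\<close>

definition smooth_on :: "'a::euclidean_space set \<Rightarrow> ('a \<Rightarrow> real) \<Rightarrow> bool" where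
  "smooth_on U f \<longleftrightarrow> (\<forall>k. Ck k U f)"

abbreviation smooth :: "(real \<Rightarrow> real) \<Rightarrow> bool" where
  "smooth \<equiv> smooth_on UNIV"

named_theorems smooth_intros

lemma smooth_on_const [smooth_intros]: "open U \<Longrightarrow> smooth_on U (\<lambda>x. c)"
  and smooth_on_linear: "open U \<Longrightarrow> bounded_linear l \<Longrightarrow> smooth_on U l"
  and smooth_on_add [smooth_intros]: "open U \<Longrightarrow> smooth_on U f \<Longrightarrow> smooth_on U g \<Longrightarrow> smooth_on U (\<lambda>x. f x + g x)"
  and smooth_on_diff [smooth_intros]: "open U \<Longrightarrow> smooth_on U f \<Longrightarrow> smooth_on U g \<Longrightarrow> smooth_on U (\<lambda>x. f x - g x)"
  and smooth_on_minus [smooth_intros]: "open U \<Longrightarrow> smooth_on U f \<Longrightarrow> smooth_on U (\<lambda>x. - f x)"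
  and smooth_on_mult [smooth_intros]: "open U \<Longrightarrow> smooth_on U f \<Longrightarrow> smooth_on U g \<Longrightarrow> smooth_on U (\<lambda>x. f x * g x)"
  and smooth_on_power [smooth_intros]: "open U \<Longrightarrow> smooth_on U f \<Longrightarrow> smooth_on U (\<lambda>x. f x ^ n)"
  and smooth_on_inverse: "open U \<Longrightarrow> smooth_on U f \<Longrightarrow> (\<And>x. x \<in> U \<Longrightarrow> f x \<noteq> 0) \<Longrightarrow> smooth_on U (\<lambda>x. inverse (f x))"
  and smooth_on_sum [smooth_intros]: "open U \<Longrightarrow> (\<And>i. i \<in> S \<Longrightarrow> smooth_on U (F i)) \<Longrightarrow> smooth_on U (\<lambda>x. \<Sum>i\<in>S. F i x)"
  unfolding smooth_on_def
  by (simp_all add: Ck_const Ck_bounded_linear Ck_add Ck_diff Ck_minus Ck_mult Ck_power Ck_inverse Ck_sum del: Ck.simps)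

lemma smooth_on_id [smooth_intros]: "open U \<Longrightarrow> smooth_on U (\<lambda>x::real. x)"
  and smooth_on_fst [smooth_intros]: "open V \<Longrightarrow> smooth_on V (fst :: real \<times> real \<Rightarrow> real)"
  and smooth_on_snd [smooth_intros]: "open V \<Longrightarrow> smooth_on V (snd :: real \<times> real \<Rightarrow> real)"
  by (simp_all add: smooth_on_linear bounded_linear_fst bounded_linear_snd bounded_linear_ident)

lemma smooth_on_compose_real:
  assumes "open U" "open V" "smooth_on V f" "smooth_on U g" "g ` U \<subseteq> V"
  shows "smooth_on U (\<lambda>x. f (g x :: real))"
proof -
  have "Ck k U (\<lambda>x. f (g x))" for k
    by (rule Ck_compose[OF assms(1,2,5)]) (use assms(3,4) in \<open>simp_all add: smooth_on_def\<close>)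
  then show ?thesis by (simp add: smooth_on_def)
qed

lemma smooth_compose:
  assumes "smooth f" "open U" "smooth_on U g"
  shows "smooth_on U (\<lambda>x. f (g x))"
  by (rule smooth_on_compose_real[of U UNIV]) (use assms in auto)

lemma smooth_on_has_derivative:
  fixes f :: "real \<Rightarrow> real"
  assumes "smooth_on U f" "x \<in> U"
  shows "(f has_real_derivative deriv f x) (at x)"
  using assms Ck_real_Suc[of 0 U f] unfolding smooth_on_def
  by (simp add: DERIV_deriv_iff_real_differentiable del: Ck.simps)

lemma smooth_on_deriv: "smooth_on U (f :: real \<Rightarrow> real) \<Longrightarrow> smooth_on U (deriv f)"
  unfolding smooth_on_def using Ck_real_Suc by blast

lemma smooth_on_continuous: "smooth_on U f \<Longrightarrow> continuous_on U f"
  unfolding smooth_on_def using Ck_continuous by blast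

text \<open>A class of functions closed under differentiation consists of smooth functions. This
  suits functions given by an integral, a series or a case distinction, whose derivatives have the
  same shape again.\<close>

lemma smooth_coinduct:
  assumes "P f" and step: "\<And>f. P f \<Longrightarrow> \<exists>f'. P f' \<and> (\<forall>x. (f has_real_derivative f' x) (at x))"
  shows "smooth f"
proof -
  have cont: "continuous_on UNIV f" if "P f" for f
  proof -
    obtain f' where "\<And>x. (f has_real_derivative f' x) (at x)" using step[OF \<open>P f\<close>] by blast
    then show ?thesis by (intro continuous_at_imp_continuous_on ballI DERIV_isCont)
  qed
  have "P f \<Longrightarrow> Ck k UNIV f" for k f
  proof (induction k arbitrary: f)
    case 0
    then show ?case using cont by simp
  next
    case (Suc k)
    then obtain f' where f': "P f'" "\<And>x. (f has_real_derivative f' x) (at x)" using step by blast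
    then have "deriv f = f'" by (intro ext DERIV_imp_deriv)
    moreover have "\<forall>x. f differentiable (at x)" using f'(2) real_differentiable_def by blast
    ultimately show ?case using Suc.IH[OF f'(1)] cont[OF Suc.prems]
      unfolding Ck_real_Suc by simp
  qed
  then show ?thesis using assms(1) by (auto simp: smooth_on_def)
qed

text \<open>Differentiation under the integral sign turns s^n g(st) into s^(n+1) g'(st). The weight
  s^n is there to make the class closed under this operation.\<close>

lemma smooth_power_mean:
  assumes g: "smooth g"
  shows "smooth (\<lambda>t. integral {0..1} (\<lambda>s. s ^ n * g (s * t)))"
proof (rule smooth_coinduct[where P = "\<lambda>q. \<exists>n g. smooth g \<and> q = (\<lambda>t. integral {0..1} (\<lambda>s. s ^ n * g (s * t)))"])
  show "\<exists>m h. smooth h \<and> (\<lambda>t. integral {0..1} (\<lambda>s. s ^ n * g (s * t))) = (\<lambda>t. integral {0..1} (\<lambda>s. s ^ m * h (s * t)))"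
    using g by blast
  fix q assume "\<exists>n g. smooth g \<and> q = (\<lambda>t. integral {0..1} (\<lambda>s. s ^ n * g (s * t)))"
  then obtain n g where g: "smooth g" and q: "q = (\<lambda>t. integral {0..1} (\<lambda>s. s ^ n * g (s * t)))" by blast
  have contg: "continuous_on UNIV g" "continuous_on UNIV (deriv g)"
    using smooth_on_continuous g smooth_on_deriv by auto
  have der: "(q has_real_derivative integral {0..1} (\<lambda>s. s ^ Suc n * deriv g (s * t))) (at t)" for t
  proof -
    have "((\<lambda>t. integral (cbox 0 1) (\<lambda>s. s ^ n * g (s * t))) has_field_derivative
        integral (cbox 0 1) (\<lambda>s. s ^ Suc n * deriv g (s * t))) (at t within UNIV)"
    proof (rule leibniz_rule_field_derivative)
      fix t s :: real
      have "((\<lambda>t. g (s * t)) has_real_derivative deriv g (s * t) * s) (at t)"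
        by (rule DERIV_chain2[OF smooth_on_has_derivative[OF g]]) (auto intro!: derivative_eq_intros)
      then have "((\<lambda>t. s ^ n * g (s * t)) has_real_derivative s ^ n * (deriv g (s * t) * s)) (at t)"
        by (rule DERIV_cmult)
      then show "((\<lambda>t. s ^ n * g (s * t)) has_field_derivative s ^ Suc n * deriv g (s * t)) (at t within UNIV)"
        by (simp add: mult_ac)
    next
      fix t :: real
      have "continuous_on (cbox 0 1) (\<lambda>s. s ^ n * g (s * t))"
        by (intro continuous_intros continuous_on_compose2[OF contg(1)]) auto
      then show "(\<lambda>s. s ^ n * g (s * t)) integrable_on cbox 0 1" by (rule integrable_continuous)
    next
      show "continuous_on (UNIV \<times> cbox 0 1) (\<lambda>(t, s). s ^ Suc n * deriv g (s * t))"
        unfolding case_prod_unfold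
        by (intro continuous_intros continuous_on_compose2[OF contg(2)]) auto
    qed auto
    then show ?thesis by (simp add: q)
  qed
  then show "\<exists>f'. (\<exists>n g. smooth g \<and> f' = (\<lambda>t. integral {0..1} (\<lambda>s. s ^ n * g (s * t)))) \<and>
      (\<forall>x. (q has_real_derivative f' x) (at x))"
    using smooth_on_deriv[OF g] by blast
qed

text \<open>The quotient is the mean of f'(st) over s in [0,1]: integrate d/ds f(st) from 0 to
  1.\<close>

lemma Hadamard:
  assumes f: "smooth f"
  obtains q where "smooth q" "\<And>t. f t = f 0 + t * q t"
proof (rule that)
  show "smooth (\<lambda>t. integral {0..1} (\<lambda>s. s ^ 0 * deriv f (s * t)))"
    by (rule smooth_power_mean[OF smooth_on_deriv[OF f]])
  fix t :: real
  have "((\<lambda>s. deriv f (s * t) * t) has_integral (f (1 * t) - f (0 * t))) {0..1}"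
  proof (rule fundamental_theorem_of_calculus)
    fix s :: real
    have "((\<lambda>s. f (s * t)) has_real_derivative deriv f (s * t) * t) (at s)"
      by (rule DERIV_chain2[OF smooth_on_has_derivative[OF f]]) (auto intro!: derivative_eq_intros)
    then show "((\<lambda>s. f (s * t)) has_vector_derivative deriv f (s * t) * t) (at s within {0..1})"
      by (simp add: has_real_derivative_iff_has_vector_derivative has_vector_derivative_at_within)
  qed simp
  from integral_unique[OF this]
  have "integral {0..1} (\<lambda>s. deriv f (s * t) * t) = f t - f 0" by (simp only: mult_1 mult_zero_left)
  then show "f t = f 0 + t * integral {0..1} (\<lambda>s. s ^ 0 * deriv f (s * t))" by (simp add: mult.commute)
qed

text \<open>Iterating the Hadamard quotient gives a remainder t^n r with r smooth, not merely
  bounded. The coefficients are identified with derivatives only later, by uniqueness.\<close>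

lemma smooth_Taylor_sequence:
  assumes f: "smooth f"
  shows "\<exists>c. \<forall>n. \<exists>r. smooth r \<and> (\<forall>t. f t = (\<Sum>i<n. c i * t ^ i) + t ^ n * r t)"
proof -
  have "\<exists>q. smooth q \<and> (\<forall>t. g t = g 0 + t * q t)" if "smooth g" for g
    by (rule Hadamard[OF that]) blast
  then obtain H where H: "\<And>g. smooth g \<Longrightarrow> smooth (H g) \<and> (\<forall>t. g t = g 0 + t * H g t)" by metis
  have sm: "smooth ((H ^^ n) f)" for n by (induction n) (use f H in auto)
  have "f t = (\<Sum>i<n. (H ^^ i) f 0 * t ^ i) + t ^ n * (H ^^ n) f t" for n t
  proof (induction n)
    case (Suc n)
    have "(H ^^ n) f t = (H ^^ n) f 0 + t * (H ^^ Suc n) f t"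
      using H[OF sm[of n]] unfolding funpow.simps o_apply by blast
    then have "t ^ n * (H ^^ n) f t = (H ^^ n) f 0 * t ^ n + t ^ Suc n * (H ^^ Suc n) f t"
      by (simp only: algebra_simps power_Suc)
    then show ?case using Suc by (simp only: sum.lessThan_Suc add.assoc)
  qed simp
  then show ?thesis using sm by (intro exI[of _ "\<lambda>i. (H ^^ i) f 0"]) blast
qed

section \<open>Order estimates and Taylor polynomials at 0\<close>

lemma bigo_integrate:
  fixes f :: "real \<Rightarrow> real"
  assumes "open U" "0 \<in> U" and der: "\<And>x. x \<in> U \<Longrightarrow> (f has_real_derivative f' x) (at x)"
    and "f 0 = 0" and O: "f' \<in> O[nhds 0](\<lambda>t. t ^ n)"
  shows "f \<in> O[nhds 0](\<lambda>t. t ^ Suc n)"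
proof -
  obtain C where C: "C > 0" "\<forall>\<^sub>F t in nhds 0. norm (f' t) \<le> C * norm (t ^ n)"
    using landau_o.bigE[OF O] by blast
  have "\<forall>\<^sub>F t in nhds 0. t \<in> U \<and> norm (f' t) \<le> C * norm (t ^ n)"
    using eventually_nhds_in_open[OF assms(1,2)] C(2) by eventually_elim auto
  then obtain d where d: "d > 0" "\<And>t. \<bar>t\<bar> < d \<Longrightarrow> t \<in> U \<and> norm (f' t) \<le> C * norm (t ^ n)"
    by (auto simp: eventually_nhds_metric dist_real_def)
  have "norm (f t) \<le> C * norm (t ^ Suc n)" if t: "\<bar>t\<bar> < d" for t
  proof -
    \<comment> \<open>Mean value inequality on the interval from -|t| to |t|, where the derivative
      is at most C |t|^n. As the filter is \<open>nhds 0\<close>, the point t = 0 is covered as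
      well; there the estimate says f 0 = 0.\<close>
    have "norm (f t - f 0) \<le> (C * \<bar>t\<bar> ^ n) * norm (t - 0)"
    proof (rule field_differentiable_bound[of "{-\<bar>t\<bar>..\<bar>t\<bar>}" f f'])
      fix s assume s: "s \<in> {-\<bar>t\<bar>..\<bar>t\<bar>}"
      then have s': "\<bar>s\<bar> < d" "\<bar>s\<bar> \<le> \<bar>t\<bar>" using t by auto
      show "(f has_field_derivative f' s) (at s within {-\<bar>t\<bar>..\<bar>t\<bar>})"
        using der d(2)[OF s'(1)] by (auto intro: has_field_derivative_at_within)
      have "\<bar>s\<bar> ^ n \<le> \<bar>t\<bar> ^ n" using s' by (intro power_mono) auto
      then show "norm (f' s) \<le> C * \<bar>t\<bar> ^ n"
        using d(2)[OF s'(1)] C(1)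
        by (metis mult_left_mono less_imp_le norm_power order_trans real_norm_def)
    qed auto
    then show ?thesis using \<open>f 0 = 0\<close> by (simp add: power_abs abs_mult mult_ac)
  qed
  then have "\<forall>\<^sub>F t in nhds 0. norm (f t) \<le> C * norm (t ^ Suc n)"
    using d(1) by (auto simp: eventually_nhds_metric dist_real_def)
  then show ?thesis by (rule landau_o.bigI[OF C(1)])
qed

lemma continuous_bigo_1:
  assumes "isCont (f :: real \<Rightarrow> real) 0"
  shows "f \<in> O[nhds 0](\<lambda>t. 1)"
proof -
  have "(f \<longlongrightarrow> f 0) (nhds 0)" using assms by (simp add: isCont_def tendsto_at_iff_tendsto_nhds)
  then have "\<forall>\<^sub>F t in nhds 0. dist (f t) (f 0) < 1" by (rule tendstoD) simp
  then have "\<forall>\<^sub>F t in nhds 0. norm (f t) \<le> (\<bar>f 0\<bar> + 1) * norm (1::real)"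
    by eventually_elim (auto simp: dist_real_def)
  then show ?thesis by (intro landau_o.bigI) auto
qed

text \<open>The Taylor polynomial of f' is the derivative of that of f, so the estimate for f'
  integrates to the next order. Here a neighbourhood of 0 suffices as domain.\<close>

lemma Taylor_bigo:
  fixes f :: "real \<Rightarrow> real"
  assumes "open U" "0 \<in> U" "smooth_on U f"
  shows "(\<lambda>t. f t - (\<Sum>i<n. (deriv ^^ i) f 0 / fact i * t ^ i)) \<in> O[nhds 0](\<lambda>t. t ^ n)"
  using assms(3)
proof (induction n arbitrary: f)
  case 0
  have "isCont f 0" using smooth_on_continuous[OF 0] assms by (simp add: continuous_on_eq_continuous_at)
  then show ?case using continuous_bigo_1 by simp
next
  case (Suc n)
  let ?c = "\<lambda>i. (deriv ^^ i) f 0 / fact i"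
  show ?case
  proof (rule bigo_integrate[OF assms(1,2)])
    show "(\<lambda>t. deriv f t - (\<Sum>i<n. (deriv ^^ i) (deriv f) 0 / fact i * t ^ i)) \<in> O[nhds 0](\<lambda>t. t ^ n)"
      using Suc.IH[OF smooth_on_deriv[OF Suc.prems]] .
    show "f 0 - (\<Sum>i<Suc n. ?c i * 0 ^ i) = 0"
      by (simp add: sum.lessThan_Suc_shift del: sum.lessThan_Suc)
    fix x assume x: "x \<in> U"
    have "((\<lambda>t. ?c (Suc i) * t ^ Suc i) has_real_derivative (deriv ^^ i) (deriv f) 0 / fact i * x ^ i) (at x)" for i
    proof -
      have "((\<lambda>t. ?c (Suc i) * t ^ Suc i) has_real_derivative ?c (Suc i) * (real (Suc i) * x ^ i)) (at x)"
        using DERIV_cmult[OF DERIV_pow[of "Suc i" x UNIV], of "?c (Suc i)"] by (simp only: diff_Suc_Suc diff_zero)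
      moreover have "?c (Suc i) * (real (Suc i) * x ^ i) = (deriv ^^ i) (deriv f) 0 / fact i * x ^ i"
        by (simp add: funpow_swap1 fact_Suc del: of_nat_Suc)
      ultimately show ?thesis by (simp only:)
    qed
    then have "((\<lambda>t. \<Sum>i<n. ?c (Suc i) * t ^ Suc i) has_real_derivative (\<Sum>i<n. (deriv ^^ i) (deriv f) 0 / fact i * x ^ i)) (at x)"
      by (intro DERIV_sum)
    from DERIV_diff[OF smooth_on_has_derivative[OF Suc.prems x] DERIV_add[OF DERIV_const[of "?c 0"] this]]
    show "((\<lambda>t. f t - (\<Sum>i<Suc n. ?c i * t ^ i)) has_real_derivative
        deriv f x - (\<Sum>i<n. (deriv ^^ i) (deriv f) 0 / fact i * x ^ i)) (at x)"
      by (simp add: sum.lessThan_Suc_shift del: sum.lessThan_Suc funpow.simps)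
  qed
qed

lemma power_bigo_mono: "m \<le> n \<Longrightarrow> (\<lambda>t::real. t ^ n) \<in> O[nhds 0](\<lambda>t. t ^ m)"
proof -
  assume mn: "m \<le> n"
  have "\<forall>\<^sub>F t::real in nhds 0. norm (t ^ n) \<le> 1 * norm (t ^ m)"
    unfolding eventually_nhds_metric
    by (intro exI[of _ 1]) (auto simp: power_abs dist_real_def intro!: power_decreasing mn)
  then show ?thesis by (intro landau_o.bigI[of 1]) auto
qed

text \<open>A polynomial of degree below n that is O(t^n) is zero: its top term is O(t^(n-1)), which
  by induction kills the lower coefficients and leaves the top one.\<close>

lemma polynomial_bigo_unique:
  fixes a b :: "nat \<Rightarrow> real"
  assumes "(\<lambda>t. f t - (\<Sum>i<n. a i * t ^ i)) \<in> O[nhds 0](\<lambda>t. t ^ n)"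
    and "(\<lambda>t. f t - (\<Sum>i<n. b i * t ^ i)) \<in> O[nhds 0](\<lambda>t. t ^ n)" and "i < n"
  shows "a i = b i"
proof -
  have *: "(\<lambda>t. \<Sum>i<n. c i * t ^ i) \<in> O[nhds 0](\<lambda>t. t ^ n) \<Longrightarrow> i < n \<Longrightarrow> c i = 0"
    for c :: "nat \<Rightarrow> real" and n i
  proof (induction n arbitrary: i)
    case 0
    then show ?case by (simp only: not_less0)
  next
    case (Suc n)
    have "(\<lambda>t. \<Sum>i<Suc n. c i * t ^ i) \<in> O[nhds 0](\<lambda>t. t ^ n)"
      by (rule landau_o.big_trans[OF Suc.prems(1) power_bigo_mono]) simp
    moreover have "(\<lambda>t. c n * t ^ n) \<in> O[nhds 0](\<lambda>t. t ^ n)"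
      by (rule landau_o.bigI[of "\<bar>c n\<bar> + 1"]) (auto simp: abs_mult intro!: always_eventually mult_right_mono)
    ultimately have "(\<lambda>t. (\<Sum>i<Suc n. c i * t ^ i) - c n * t ^ n) \<in> O[nhds 0](\<lambda>t. t ^ n)"
      by (rule sum_in_bigo)
    then have IH: "c i = 0" if "i < n" for i using Suc.IH[OF _ that] by simp
    then have "(\<lambda>t. c n * t ^ n) \<in> O[nhds 0](\<lambda>t. t ^ Suc n)" using Suc.prems(1) by simp
    then obtain C where C: "C > 0" "\<forall>\<^sub>F t in nhds 0. norm (c n * t ^ n) \<le> C * norm (t ^ Suc n)"
      by (rule landau_o.bigE)
    \<comment> \<open>Away from 0 the factor |t|^n can be divided out; letting t tend to 0 then
      forces \<open>c n = 0\<close>.\<close>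
    have ev: "\<forall>\<^sub>F t in at (0::real). \<bar>c n\<bar> \<le> C * \<bar>t\<bar>"
      using C(2) unfolding eventually_at_filter
      by eventually_elim (auto simp: abs_mult power_abs mult_ac)
    have "((\<lambda>t. C * \<bar>t\<bar>) \<longlongrightarrow> C * \<bar>0\<bar>) (at (0::real))"
      by (intro tendsto_intros)
    from tendsto_lowerbound[OF this ev] have "\<bar>c n\<bar> \<le> C * \<bar>0\<bar>" by simp
    then show ?case using IH Suc.prems(2) by (cases "i = n") auto
  qed
  have "(\<lambda>t. (f t - (\<Sum>i<n. b i * t ^ i)) - (f t - (\<Sum>i<n. a i * t ^ i))) \<in> O[nhds 0](\<lambda>t. t ^ n)"
    by (rule sum_in_bigo(2)[OF assms(2,1)])
  moreover have "(\<lambda>t. (f t - (\<Sum>i<n. b i * t ^ i)) - (f t - (\<Sum>i<n. a i * t ^ i))) = (\<lambda>t. \<Sum>i<n. (a i - b i) * t ^ i)"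
    by (simp add: fun_eq_iff sum_subtractf left_diff_distrib)
  ultimately have "(\<lambda>t. \<Sum>i<n. (a i - b i) * t ^ i) \<in> O[nhds 0](\<lambda>t. t ^ n)"
    by (simp only:)
  from *[OF this assms(3)] show ?thesis by simp
qed

lemma smooth_remainder_bigo:
  assumes "smooth r" "\<And>t. f t = p t + t ^ n * r t"
  shows "(\<lambda>t. f t - p t) \<in> O[nhds 0](\<lambda>t. t ^ n)"
proof -
  have "isCont r 0" using smooth_on_continuous[OF assms(1)] by (simp add: continuous_on_eq_continuous_at)
  from landau_o.big.mult[OF landau_o.big_refl[of "\<lambda>t. t ^ n"] continuous_bigo_1[OF this]]
  have "(\<lambda>t. t ^ n * r t) \<in> O[nhds 0](\<lambda>t. t ^ n)" by (simp only: mult_1_right)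
  moreover have "(\<lambda>t. f t - p t) = (\<lambda>t. t ^ n * r t)" using assms(2) by auto
  ultimately show ?thesis by (simp only:)
qed

text \<open>The coefficients from iterated Hadamard quotients and the Taylor coefficients both
  approximate f modulo t^n, hence agree. This combines a smooth remainder with known
  coefficients.\<close>

lemma smooth_Taylor:
  assumes f: "smooth f"
  obtains r where "smooth r" "\<And>t. f t = (\<Sum>i<n. (deriv ^^ i) f 0 / fact i * t ^ i) + t ^ n * r t"
proof -
  obtain c where "\<forall>n. \<exists>r. smooth r \<and> (\<forall>t. f t = (\<Sum>i<n. c i * t ^ i) + t ^ n * r t)"
    using smooth_Taylor_sequence[OF f] by (rule exE)
  then obtain r where r: "smooth r" "\<And>t. f t = (\<Sum>i<n. c i * t ^ i) + t ^ n * r t" by blast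
  have "c i = (deriv ^^ i) f 0 / fact i" if "i < n" for i
    by (rule polynomial_bigo_unique[OF smooth_remainder_bigo[OF r] Taylor_bigo[OF _ _ f] that]) auto
  then have "(\<Sum>i<n. c i * t ^ i) = (\<Sum>i<n. (deriv ^^ i) f 0 / fact i * t ^ i)" for t
    by (intro sum.cong) auto
  then show ?thesis using r by (intro that[of r]) (simp_all only:)
qed


section \<open>Borel's theorem and even functions\<close>

text \<open>The k-th derivative of sin^a cos^b, as a recursion on k. The truncated
  \<open>a - 1\<close> and \<open>b - 1\<close> are harmless: at 0 their terms carry the factor
  0.\<close>

fun sin_cos_deriv :: "nat \<Rightarrow> nat \<Rightarrow> nat \<Rightarrow> real \<Rightarrow> real" where
  "sin_cos_deriv a b 0 x = sin x ^ a * cos x ^ b"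
| "sin_cos_deriv a b (Suc k) x =
     real a * sin_cos_deriv (a - 1) (b + 1) k x - real b * sin_cos_deriv (a + 1) (b - 1) k x"

lemma sin_cos_deriv_has_derivative:
  "(sin_cos_deriv a b k has_real_derivative sin_cos_deriv a b (Suc k) x) (at x)"
proof (induction k arbitrary: a b)
  case 0
  have "((\<lambda>x. sin x ^ a * cos x ^ b) has_real_derivative
      (real a * sin x ^ (a - 1) * cos x) * cos x ^ b + sin x ^ a * (real b * cos x ^ (b - 1) * (- sin x))) (at x)"
    by (auto intro!: derivative_eq_intros simp: algebra_simps)
  moreover have "(\<lambda>x. sin x ^ a * cos x ^ b) = sin_cos_deriv a b 0" by (simp add: fun_eq_iff)
  ultimately show ?case by (simp add: algebra_simps)
next
  case (Suc k)
  have "((\<lambda>x. real a * sin_cos_deriv (a - 1) (b + 1) k x - real b * sin_cos_deriv (a + 1) (b - 1) k x)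
      has_real_derivative real a * sin_cos_deriv (a - 1) (b + 1) (Suc k) x - real b * sin_cos_deriv (a + 1) (b - 1) (Suc k) x) (at x)"
    by (intro DERIV_diff DERIV_cmult Suc)
  moreover have "(\<lambda>x. real a * sin_cos_deriv (a - 1) (b + 1) k x - real b * sin_cos_deriv (a + 1) (b - 1) k x)
      = sin_cos_deriv a b (Suc k)" by (simp add: fun_eq_iff)
  ultimately show ?case by (simp only: sin_cos_deriv.simps(2)[of a b "Suc k"])
qed

text \<open>Differentiation preserves the total degree a + b in every term with nonzero coefficient,
  so each of the k steps costs at most a factor a + b.\<close>

lemma sin_cos_deriv_bound: "\<bar>sin_cos_deriv a b k x\<bar> \<le> real (a + b) ^ k"
proof (induction k arbitrary: a b)
  case 0
  have "\<bar>sin x\<bar> ^ a * \<bar>cos x\<bar> ^ b \<le> 1 * 1" by (intro mult_mono power_le_one) auto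
  then show ?case by (simp add: abs_mult power_abs)
next
  case (Suc k)
  have 1: "\<bar>real a * sin_cos_deriv (a - 1) (b + 1) k x\<bar> \<le> real a * real (a + b) ^ k"
  proof (cases a)
    case (Suc a')
    then show ?thesis using Suc.IH[of "a - 1" "b + 1"] by (simp add: abs_mult mult_left_mono)
  qed simp
  have 2: "\<bar>real b * sin_cos_deriv (a + 1) (b - 1) k x\<bar> \<le> real b * real (a + b) ^ k"
  proof (cases b)
    case (Suc b')
    then show ?thesis using Suc.IH[of "a + 1" "b - 1"] by (simp add: abs_mult mult_left_mono)
  qed simp
  have "\<bar>sin_cos_deriv a b (Suc k) x\<bar> \<le> real a * real (a + b) ^ k + real b * real (a + b) ^ k"
    using 1 2 abs_triangle_ineq4[of "real a * sin_cos_deriv (a - 1) (b + 1) k x" "real b * sin_cos_deriv (a + 1) (b - 1) k x"]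
    by simp
  then show ?case by (simp add: algebra_simps)
qed

lemma sin_cos_deriv_zero: "k < a \<Longrightarrow> sin_cos_deriv a b k 0 = 0"
  by (induction k arbitrary: a b) auto

text \<open>Near 0 the function sin^a cos^b is x^a up to higher order, so its derivative of order a
  there is a!.\<close>

lemma sin_cos_deriv_diagonal: "sin_cos_deriv a b a 0 = fact a"
proof (induction a arbitrary: b)
  case (Suc a)
  then show ?case by (simp add: sin_cos_deriv_zero)
qed simp

text \<open>The dilation l. For k < n the factor l^k / l^n is at most 1/l and the trigonometric
  factor at most n^n, so l at least |a| n^n 2^n brings the k-th derivative below 2^(-n); l at least
  1 justifies the first bound.\<close>

definition borel_scale :: "real \<Rightarrow> nat \<Rightarrow> real" where
  "borel_scale a n = max 1 (\<bar>a\<bar> * real n ^ n * 2 ^ n)"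

text \<open>The k-th derivative of \<open>a * (sin (l x) / l)^n\<close>, a substitute for \<open>a * x^n\<close> whose
  derivatives of order below n become small uniformly in x as l grows.\<close>

definition borel_term :: "real \<Rightarrow> nat \<Rightarrow> nat \<Rightarrow> real \<Rightarrow> real" where
  "borel_term a k n x = a * borel_scale a n ^ k / borel_scale a n ^ n * sin_cos_deriv n 0 k (borel_scale a n * x)"

lemma borel_scale_ge: "borel_scale a n \<ge> 1" "\<bar>a\<bar> * real n ^ n * 2 ^ n \<le> borel_scale a n"
  by (auto simp: borel_scale_def)

lemma borel_term_bound:
  assumes "k < n"
  shows "\<bar>borel_term a k n x\<bar> \<le> (1/2) ^ n"
proof -
  define l where "l = borel_scale a n"
  have l: "l \<ge> 1" "\<bar>a\<bar> * real n ^ n * 2 ^ n \<le> l" using borel_scale_ge by (auto simp: l_def)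
  have "l * l ^ k \<le> l ^ n"
    using power_increasing[of "Suc k" n l] assms l(1) by simp
  then have q: "l ^ k / l ^ n \<le> 1 / l" using l(1) by (simp add: field_simps)
  have "real n ^ k \<le> real n ^ n" using assms by (intro power_increasing) auto
  then have s: "\<bar>sin_cos_deriv n 0 k (l * x)\<bar> \<le> real n ^ n"
    using sin_cos_deriv_bound[of n 0 k "l * x"] by simp
  have "\<bar>borel_term a k n x\<bar> = \<bar>a\<bar> * (l ^ k / l ^ n) * \<bar>sin_cos_deriv n 0 k (l * x)\<bar>"
    using l(1) by (simp add: borel_term_def l_def abs_mult)
  also have "\<dots> \<le> \<bar>a\<bar> * (1 / l) * real n ^ n"
    using q s l(1) by (intro mult_mono mult_nonneg_nonneg) auto
  also have "\<dots> \<le> (1/2) ^ n"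
    using l by (simp add: field_simps power_one_over)
  finally show ?thesis .
qed

lemma borel_term_has_derivative:
  "(borel_term a k n has_real_derivative borel_term a (Suc k) n x) (at x)"
proof -
  define l where "l = borel_scale a n"
  have "((\<lambda>x. sin_cos_deriv n 0 k (l * x)) has_real_derivative sin_cos_deriv n 0 (Suc k) (l * x) * l) (at x)"
    by (rule DERIV_chain2[OF sin_cos_deriv_has_derivative]) (auto intro!: derivative_eq_intros)
  from DERIV_cmult[OF this, of "a * l ^ k / l ^ n"]
  have "((\<lambda>x. a * l ^ k / l ^ n * sin_cos_deriv n 0 k (l * x)) has_real_derivative
      a * l ^ k / l ^ n * (sin_cos_deriv n 0 (Suc k) (l * x) * l)) (at x)" .
  moreover have "(\<lambda>x. a * l ^ k / l ^ n * sin_cos_deriv n 0 k (l * x)) = borel_term a k n"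
    by (simp add: fun_eq_iff borel_term_def l_def)
  moreover have "a * l ^ k / l ^ n * (sin_cos_deriv n 0 (Suc k) (l * x) * l) = borel_term a (Suc k) n x"
    by (simp add: borel_term_def l_def del: sin_cos_deriv.simps)
  ultimately show ?thesis by (simp only:)
qed

text \<open>Since powers of sin are not monomials, term n contributes to derivatives at 0 of order
  above n too. The system for the coefficients is triangular with diagonal entries
  \<open>fact k\<close>; the contributions of earlier terms are subtracted.\<close>

function borel_coeff :: "(nat \<Rightarrow> real) \<Rightarrow> nat \<Rightarrow> real" where
  "borel_coeff c k = (c k - (\<Sum>n<k. borel_term (borel_coeff c n) k n 0)) / fact k"
  by pat_completeness auto
termination by (relation "Wellfounded.measure snd") auto

declare borel_coeff.simps [simp del]

theorem Borel:
  fixes c :: "nat \<Rightarrow> real"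
  obtains p where "smooth p" "\<And>k. (deriv ^^ k) p 0 = c k"
proof -
  define D where "D k n x = borel_term (borel_coeff c n) k n x" for k n x
  define F where "F k x = (\<Sum>n. D k n x)" for k x
  \<comment> \<open>The bound is available only for n > k, hence the eventual form of the
    Weierstrass test.\<close>
  have bnd: "\<forall>\<^sub>F n in sequentially. \<forall>x\<in>UNIV. norm (D k n x) \<le> (1/2) ^ n" for k
    using eventually_gt_at_top[of k] by eventually_elim (auto simp: D_def borel_term_bound)
  have sm: "summable (\<lambda>n. (1/2::real) ^ n)" by (rule summable_geometric) simp
  have unif: "uniformly_convergent_on UNIV (\<lambda>n x. \<Sum>i<n. D k i x)" for k
    using Weierstrass_m_test_ev[OF bnd sm] by (auto simp: uniformly_convergent_on_def)
  have summ: "summable (\<lambda>n. D k n x)" for k x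
    by (rule summable_comparison_test_ev[OF _ sm]) (use bnd[of k] in \<open>auto elim: eventually_mono\<close>)
  have der: "(F k has_real_derivative F (Suc k) x) (at x)" for k x
  proof -
    have "((\<lambda>x. \<Sum>n. D k n x) has_field_derivative (\<Sum>n. D (Suc k) n x)) (at x)"
    proof (rule has_field_derivative_series'(2)[OF convex_UNIV _ unif])
      show "(D k n has_field_derivative D (Suc k) n x) (at x within UNIV)" for n x
        unfolding D_def using borel_term_has_derivative by simp
      show "summable (\<lambda>n. D k n 0)" by (rule summ)
    qed auto
    then show ?thesis by (simp add: F_def[abs_def])
  qed
  have "smooth (F 0)"
  proof (rule smooth_coinduct[where P = "\<lambda>f. \<exists>k. f = F k"])
    fix f assume "\<exists>k. f = F k"
    then show "\<exists>f'. (\<exists>k. f' = F k) \<and> (\<forall>x. (f has_real_derivative f' x) (at x))" using der by blast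
  qed blast
  moreover have "(deriv ^^ k) (F 0) = F k" for k
  proof (induction k)
    case (Suc k)
    moreover have "deriv (F k) = F (Suc k)" by (intro ext DERIV_imp_deriv der)
    ultimately show ?case by simp
  qed simp
  moreover have "F k 0 = c k" for k
  proof -
    \<comment> \<open>At 0 a term with n > k vanishes to order n, so only finitely many terms remain
      and the recursion for the coefficients applies.\<close>
    have "(\<Sum>n. D k n 0) = (\<Sum>n\<le>k. D k n 0)"
      by (rule suminf_finite) (auto simp: D_def borel_term_def sin_cos_deriv_zero)
    also have "\<dots> = (\<Sum>n<k. D k n 0) + D k k 0" by (simp add: lessThan_Suc_atMost[symmetric])
    also have "D k k 0 = borel_coeff c k * fact k"
      using borel_scale_ge(1)[of "borel_coeff c k" k] by (simp add: D_def borel_term_def sin_cos_deriv_diagonal)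
    also have "\<dots> = c k - (\<Sum>n<k. D k n 0)"
      by (subst borel_coeff.simps) (simp add: D_def)
    finally show ?thesis by (simp add: F_def)
  qed
  ultimately show ?thesis by (intro that[of "F 0"]) auto
qed

section \<open>Flat functions and Whitney's theorem\<close>

definition flat :: "(real \<Rightarrow> real) \<Rightarrow> bool" where
  "flat f \<longleftrightarrow> (\<forall>n. \<exists>r. smooth r \<and> (\<forall>t. f t = t ^ n * r t))"

lemma flat_smooth: "flat f \<Longrightarrow> smooth f"
proof -
  assume "flat f"
  then obtain r where "smooth r" "\<forall>t. f t = t ^ 0 * r t" unfolding flat_def by blast
  then show ?thesis by (simp add: fun_eq_iff[symmetric])
qed

lemma eq_at_zero_of_continuous:
  fixes f g :: "real \<Rightarrow> real"
  assumes "isCont f 0" "isCont g 0" "\<And>t. t \<noteq> 0 \<Longrightarrow> f t = g t"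
  shows "f = g"
proof
  fix t
  have "(f \<longlongrightarrow> f 0) (at 0)" "(g \<longlongrightarrow> g 0) (at 0)" using assms by (auto simp: isCont_def)
  moreover have "\<forall>\<^sub>F t in at 0. f t = g t" using assms(3) by (auto simp: eventually_at_filter)
  ultimately have "f 0 = g 0" using tendsto_unique[of "at 0" g "f 0" "g 0"] tendsto_cong by force
  then show "f t = g t" using assms(3) by (cases "t = 0") auto
qed

lemma smooth_isCont: "smooth f \<Longrightarrow> isCont f x"
  using smooth_on_continuous[of UNIV f] by (simp add: continuous_on_eq_continuous_at)

text \<open>The quotient f'(t) / (2t) is what differentiating f(sqrt x) produces at t = sqrt x;
  flatness makes it smooth and flat again.\<close>

lemma flat_deriv_quotient:
  assumes "flat f"
  obtains g where "flat g" "\<And>t. deriv f t = 2 * t * g t"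
proof -
  have ex: "\<exists>q. smooth q \<and> (\<forall>t. deriv f t = t ^ Suc n * q t)" for n
  proof -
    obtain r where r: "smooth r" "\<And>t. f t = t ^ Suc (Suc n) * r t" using assms unfolding flat_def by blast
    have "deriv f t = t ^ Suc n * (real (Suc (Suc n)) * r t + t * deriv r t)" for t
    proof (rule DERIV_imp_deriv)
      have "((\<lambda>t. t ^ Suc (Suc n) * r t) has_real_derivative
          (real (Suc (Suc n)) * t ^ Suc n) * r t + deriv r t * t ^ Suc (Suc n)) (at t)"
        using DERIV_mult[OF DERIV_pow[of "Suc (Suc n)" t UNIV] smooth_on_has_derivative[OF r(1), of t]] by simp
      moreover have "(\<lambda>t. t ^ Suc (Suc n) * r t) = f" using r(2) by (simp add: fun_eq_iff)
      ultimately show "(f has_real_derivative t ^ Suc n * (real (Suc (Suc n)) * r t + t * deriv r t)) (at t)"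
        by (simp add: algebra_simps)
    qed
    moreover have "smooth (\<lambda>t. real (Suc (Suc n)) * r t + t * deriv r t)"
      by (intro smooth_intros r smooth_on_deriv open_UNIV)
    ultimately show ?thesis by blast
  qed
  obtain q where q: "smooth q" "\<And>t. deriv f t = t ^ Suc 0 * q t" using ex by blast
  show ?thesis
  proof (rule that[of "\<lambda>t. q t / 2"])
    show "deriv f t = 2 * t * (q t / 2)" for t using q(2) by simp
    show "flat (\<lambda>t. q t / 2)" unfolding flat_def
    proof
      fix n
      obtain p where p: "smooth p" "\<And>t. deriv f t = t ^ Suc n * p t" using ex by blast
      have s: "smooth (\<lambda>t. t ^ n * p t)" by (intro smooth_intros p open_UNIV)
      \<comment> \<open>Both sides are f'(t) / t for t different from 0; continuity extends the
        equality to 0.\<close>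
      have "q = (\<lambda>t. t ^ n * p t)"
      proof (rule eq_at_zero_of_continuous)
        show "q t = t ^ n * p t" if "t \<noteq> 0" for t using p(2)[of t] q(2)[of t] that by simp
      qed (use smooth_isCont q s in auto)
      then have "\<forall>t. q t / 2 = t ^ n * (p t * (1/2))" by simp
      moreover have "smooth (\<lambda>t. p t * (1/2))" by (intro smooth_intros p open_UNIV)
      ultimately show "\<exists>r. smooth r \<and> (\<forall>t. q t / 2 = t ^ n * r t)" by blast
    qed
  qed
qed

text \<open>For x > 0 the derivative of f(sqrt x) is g(sqrt x) with g(t) = f'(t) / (2t), again flat.
  So the class of such functions, extended by 0, is closed under differentiation; only x = 0 needs a
  separate argument.\<close>

lemma flat_sqrt_smooth:
  assumes "flat f"
  shows "smooth (\<lambda>x. if x > 0 then f (sqrt x) else 0)"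
proof (rule smooth_coinduct[where P = "\<lambda>h. \<exists>f. flat f \<and> h = (\<lambda>x. if x > 0 then f (sqrt x) else 0)"])
  fix h assume "\<exists>f. flat f \<and> h = (\<lambda>x. if x > 0 then f (sqrt x) else 0)"
  then obtain f where f: "flat f" and h: "h = (\<lambda>x. if x > 0 then f (sqrt x) else 0)" by blast
  obtain g where g: "flat g" "\<And>t. deriv f t = 2 * t * g t" by (rule flat_deriv_quotient[OF f]) blast
  have "(h has_real_derivative (if x > 0 then g (sqrt x) else 0)) (at x)" for x
  proof -
    consider "x > 0" | "x < 0" | "x = 0" by linarith
    then show ?thesis
    proof cases
      case 1
      have "((\<lambda>x. f (sqrt x)) has_real_derivative deriv f (sqrt x) * (inverse (sqrt x) / 2)) (at x)"
        by (rule DERIV_chain2[OF smooth_on_has_derivative[OF flat_smooth[OF f]] DERIV_real_sqrt[OF 1]]) simp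
      moreover have "deriv f (sqrt x) * (inverse (sqrt x) / 2) = g (sqrt x)" using 1 by (simp add: g(2))
      ultimately have "((\<lambda>x. f (sqrt x)) has_real_derivative g (sqrt x)) (at x)" by (simp only:)
      then have "(h has_real_derivative g (sqrt x)) (at x)"
        by (rule has_field_derivative_transform_within_open[where S = "{0<..}"]) (use 1 h in auto)
      then show ?thesis using 1 by simp
    next
      case 2
      have "((\<lambda>x. 0) has_real_derivative 0) (at x)" by simp
      then have "(h has_real_derivative 0) (at x)"
        by (rule has_field_derivative_transform_within_open[where S = "{..<0}"]) (use 2 h in auto)
      then show ?thesis using 2 by simp
    next
      case 3
      \<comment> \<open>The fourth power makes f(sqrt y) equal to y^2 r(sqrt y), so the difference
        quotient at 0 still has a factor y and tends to 0.\<close>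
      obtain r where r: "smooth r" "\<And>t. f t = t ^ 4 * r t" using f unfolding flat_def by blast
      have "((\<lambda>y. if y > 0 then y * r (sqrt y) else 0) \<longlongrightarrow> 0) (at (0::real))"
      proof (rule Lim_null_comparison)
        have "((\<lambda>y. r (sqrt \<bar>y\<bar>)) \<longlongrightarrow> r (sqrt \<bar>0\<bar>)) (at (0::real))"
          by (intro isCont_tendsto_compose[OF smooth_isCont[OF r(1)]] tendsto_intros)
        then have "((\<lambda>y. \<bar>y\<bar> * \<bar>r (sqrt \<bar>y\<bar>)\<bar>) \<longlongrightarrow> \<bar>0\<bar> * \<bar>r (sqrt \<bar>0\<bar>)\<bar>) (at (0::real))"
          by (intro tendsto_intros)
        then show "((\<lambda>y. \<bar>y\<bar> * \<bar>r (sqrt \<bar>y\<bar>)\<bar>) \<longlongrightarrow> 0) (at (0::real))" by simp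
        show "\<forall>\<^sub>F y in at 0. norm (if y > 0 then y * r (sqrt y) else 0) \<le> \<bar>y\<bar> * \<bar>r (sqrt \<bar>y\<bar>)\<bar>"
          by (auto intro!: always_eventually mult_nonpos_nonneg simp: abs_mult)
      qed
      moreover have "(\<lambda>y. if y > 0 then y * r (sqrt y) else 0) = (\<lambda>y. (h (0 + y) - h 0) / y)"
      proof
        fix y :: real
        have "sqrt y ^ 4 = y * y" if "y > 0"
          using that real_sqrt_pow2[of y] by (simp add: power4_eq_xxxx power2_eq_square)
        then show "(if y > 0 then y * r (sqrt y) else 0) = (h (0 + y) - h 0) / y"
          by (simp add: h r(2))
      qed
      ultimately have "(h has_real_derivative 0) (at 0)" by (simp add: DERIV_def)
      then show ?thesis using 3 by simp
    qed
  qed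
  then show "\<exists>f'. (\<exists>f. flat f \<and> f' = (\<lambda>x. if x > 0 then f (sqrt x) else 0)) \<and> (\<forall>x. (h has_real_derivative f' x) (at x))"
    using g(1) by blast
qed (use assms in blast)

lemma even_polynomial_sum:
  fixes c :: "nat \<Rightarrow> real"
  shows "(\<Sum>i<2 * n. c i * (- t) ^ i) + (\<Sum>i<2 * n. c i * t ^ i) = 2 * (\<Sum>i<n. c (2 * i) * (t\<^sup>2) ^ i)"
proof (induction n)
  case (Suc n)
  have "2 * Suc n = Suc (Suc (2 * n))" "(- t) ^ (2 * n) = (t\<^sup>2) ^ n" "t ^ (2 * n) = (t\<^sup>2) ^ n"
    by (simp_all add: power_mult)
  then show ?case using Suc by (simp add: distrib_left)
qed simp

text \<open>By Borel there is a smooth p such that p(t^2) has the same Taylor series as f. The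
  difference is even and flat, and composing it with the square root keeps it smooth.\<close>

theorem Whitney_even:
  assumes f: "smooth f" and even: "\<And>t. f (- t) = f t"
  obtains g where "smooth g" "\<And>t. f t = g (t\<^sup>2)"
proof -
  define c where "c i = (deriv ^^ i) f 0 / fact i" for i
  obtain p where p: "smooth p" "\<And>k. (deriv ^^ k) p 0 = c (2 * k) * fact k"
    using Borel[of "\<lambda>k. c (2 * k) * fact k"] by blast
  have "flat (\<lambda>t. f t - p (t\<^sup>2))" unfolding flat_def
  proof
    fix n
    obtain r where r: "smooth r" "\<And>t. f t = (\<Sum>i<2 * n. c i * t ^ i) + t ^ (2 * n) * r t"
      unfolding c_def using smooth_Taylor[OF f, of "2 * n"] by blast
    obtain s where s: "smooth s" "\<And>t. p t = (\<Sum>i<n. (deriv ^^ i) p 0 / fact i * t ^ i) + t ^ n * s t"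
      using smooth_Taylor[OF p(1), of n] by blast
    \<comment> \<open>Averaging the expansions at t and -t removes the odd powers. The even ones
      agree with those of p(t^2) below order 2n, and half of the remaining factor t^(2n) is kept
      inside \<open>R\<close> only through the one power shown here.\<close>
    define R where "R t = t ^ n * ((r t + r (- t)) * (1/2) - s (t\<^sup>2))" for t
    have "smooth R" unfolding R_def
      by (intro smooth_intros r s smooth_compose[OF r(1)] smooth_compose[OF s(1)] open_UNIV)
    moreover have "f t - p (t\<^sup>2) = t ^ n * R t" for t
    proof -
      have e: "(- t) ^ (2 * n) = t ^ n * t ^ n" "t ^ (2 * n) = t ^ n * t ^ n" "(t\<^sup>2) ^ n = t ^ n * t ^ n"
        by (simp_all add: power_mult power_even_eq power2_eq_square power_mult_distrib)
      have "2 * f t = f (- t) + f t" using even by simp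
      also have "\<dots> = 2 * (\<Sum>i<n. c (2 * i) * (t\<^sup>2) ^ i) + t ^ n * t ^ n * (r t + r (- t))"
        using even_polynomial_sum[of c t n] unfolding r(2)[of "- t"] r(2)[of t] e by (simp add: algebra_simps)
      finally have 1: "f t = (\<Sum>i<n. c (2 * i) * (t\<^sup>2) ^ i) + t ^ n * t ^ n * (r t + r (- t)) * (1/2)" by simp
      have 2: "p (t\<^sup>2) = (\<Sum>i<n. c (2 * i) * (t\<^sup>2) ^ i) + t ^ n * t ^ n * s (t\<^sup>2)"
        unfolding s(2)[of "t\<^sup>2"] p(2) e by simp
      show ?thesis unfolding 1 2 R_def by (simp add: algebra_simps)
    qed
    ultimately show "\<exists>r. smooth r \<and> (\<forall>t. f t - p (t\<^sup>2) = t ^ n * r t)" by blast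
  qed
  from flat_sqrt_smooth[OF this]
  have "smooth (\<lambda>x. p x + (if x > 0 then f (sqrt x) - p ((sqrt x)\<^sup>2) else 0))"
    by (intro smooth_intros p open_UNIV)
  moreover have "f t = p (t\<^sup>2) + (if t\<^sup>2 > 0 then f (sqrt (t\<^sup>2)) - p ((sqrt (t\<^sup>2))\<^sup>2) else 0)" for t
  proof (cases "t = 0")
    \<comment> \<open>At 0 the branch with the square root is switched off, so
      \<open>f 0 = p 0\<close> has to come from flatness.\<close>
    case True
    obtain r where "\<forall>t. f t - p (t\<^sup>2) = t ^ 1 * r t"
      using \<open>flat _\<close> unfolding flat_def by blast
    from this[rule_format, of 0] show ?thesis using True by simp
  next
    case False
    then show ?thesis using even[of t] by (simp add: abs_if)
  qed
  ultimately show ?thesis by (rule that)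
qed

text \<open>The even part is a function of t^2 by Whitney; the odd part is t times an even smooth
  function by Hadamard.\<close>

lemma smooth_split2:
  assumes h: "smooth h"
  obtains a b where "smooth a" "smooth b" "\<And>t. h t = a (t\<^sup>2) + t * b (t\<^sup>2)"
proof -
  have hm: "smooth (\<lambda>t. h (- t))" by (intro smooth_compose[OF h] smooth_intros open_UNIV)
  have "smooth (\<lambda>t. (h t + h (- t)) * (1/2))" by (intro smooth_intros h hm open_UNIV)
  then obtain a where a: "smooth a" "\<And>t. (h t + h (- t)) * (1/2) = a (t\<^sup>2)"
    by (rule Whitney_even) simp_all
  have "smooth (\<lambda>t. (h t - h (- t)) * (1/2))" by (intro smooth_intros h hm open_UNIV)
  then obtain q where q: "smooth q" "\<And>t. (h t - h (- t)) * (1/2) = t * q t"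
    by (rule Hadamard) simp
  have "q (- t) = q t" for t using q(2)[of t] q(2)[of "- t"] by (cases "t = 0") (auto simp: field_simps)
  with q(1) obtain b where b: "smooth b" "\<And>t. q t = b (t\<^sup>2)" by (rule Whitney_even) blast
  have "h t = a (t\<^sup>2) + t * b (t\<^sup>2)" for t
    using a(2)[of t] q(2)[of t] b(2)[of t] by (simp add: field_simps)
  then show ?thesis by (rule that[OF a(1) b(1)])
qed

lemma smooth_split4:
  assumes "smooth h"
  obtains h0 h1 h2 h3 where "smooth h0" "smooth h1" "smooth h2" "smooth h3"
    "\<And>t. h t = h0 (t ^ 4) + t * h1 (t ^ 4) + t ^ 2 * h2 (t ^ 4) + t ^ 3 * h3 (t ^ 4)"
proof -
  obtain a b where ab: "smooth a" "smooth b" "\<And>t. h t = a (t\<^sup>2) + t * b (t\<^sup>2)"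
    by (rule smooth_split2[OF assms]) blast
  obtain h0 h2 where a: "smooth h0" "smooth h2" "\<And>t. a t = h0 (t\<^sup>2) + t * h2 (t\<^sup>2)"
    by (rule smooth_split2[OF ab(1)]) blast
  obtain h1 h3 where b: "smooth h1" "smooth h3" "\<And>t. b t = h1 (t\<^sup>2) + t * h3 (t\<^sup>2)"
    by (rule smooth_split2[OF ab(2)]) blast
  have "(t\<^sup>2)\<^sup>2 = t ^ 4" for t :: real by simp
  then have "h t = h0 (t ^ 4) + t * h1 (t ^ 4) + t ^ 2 * h2 (t ^ 4) + t ^ 3 * h3 (t ^ 4)" for t
    unfolding ab(3)[of t] a(3)[of "t\<^sup>2"] b(3)[of "t\<^sup>2"] by (simp add: algebra_simps power3_eq_cube power2_eq_square)
  then show ?thesis by (rule that[OF a(1) b(1) a(2) b(2)])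
qed


section \<open>Reduction to a normal form modulo order twelve\<close>

lemma diffeo_germ_smooth_real:
  assumes "open W" "p \<in> W" "smooth_on W f" "(f has_real_derivative d) (at p)" "d \<noteq> 0"
  shows "diffeo_germ \<infinity> f p"
  unfolding diffeo_germ_def
  by (rule local_diffeo_real[OF assms(1,2)])
    (use assms DERIV_imp_deriv[OF assms(4)] in \<open>simp_all add: Cr_real_iff smooth_on_def\<close>)

lemma diffeo_germ_smooth_real2:
  assumes "open W" "p \<in> W" "smooth_on W f" "smooth_on W g"
    and "(f has_derivative (\<lambda>h. a * fst h + b * snd h)) (at p)"
    and "(g has_derivative (\<lambda>h. c * fst h + d * snd h)) (at p)"
    and "a * d - b * c \<noteq> 0"
  shows "diffeo_germ \<infinity> (\<lambda>x. (f x, g x)) p"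
  unfolding diffeo_germ_def
  by (rule local_diffeo_real2[OF assms(1,2) _ _ _ assms(5-7)])
    (use assms(3,4) in \<open>simp_all add: smooth_on_def\<close>)

lemma A_equiv_trans: "A_equiv \<gamma>1 \<gamma>2 \<Longrightarrow> A_equiv \<gamma>2 \<gamma>3 \<Longrightarrow> A_equiv \<gamma>1 \<gamma>3"
  unfolding A_equiv_def by (rule Cr_equiv_trans)

lemma A_equiv_reparam:
  assumes "smooth \<psi>" "\<psi> 0 = 0" "(\<psi> has_real_derivative d) (at 0)" "d \<noteq> 0"
  shows "A_equiv \<gamma> (\<lambda>t. \<gamma> (\<psi> t))"
proof -
  have "diffeo_germ \<infinity> \<psi> 0" by (rule diffeo_germ_smooth_real[OF open_UNIV _ assms(1,3,4)]) simp
  then obtain \<phi> where p: "diffeo_germ \<infinity> \<phi> (\<psi> 0)" "\<phi> (\<psi> 0) = 0" "\<forall>\<^sub>F y in nhds (\<psi> 0). \<psi> (\<phi> y) = y"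
    by (rule diffeo_germ_inverse)
  then have "\<forall>\<^sub>F t in nhds 0. \<gamma> t = \<gamma> (\<psi> (\<phi> t))" using assms(2) by (auto elim: eventually_mono)
  then show ?thesis unfolding A_equiv_def Cr_equiv_iff
    using p assms(2) by (intro exI[of _ \<phi>] exI[of _ "\<lambda>x. x"]) (auto intro: diffeo_germ_id)
qed

lemma A_equiv_reparam_mult:
  assumes w: "smooth w" "w 0 \<noteq> 0"
  shows "A_equiv \<gamma> (\<lambda>t. \<gamma> (t * w t))"
proof (rule A_equiv_reparam)
  show "smooth (\<lambda>t. t * w t)" by (intro smooth_intros w open_UNIV)
  show "((\<lambda>t. t * w t) has_real_derivative w 0) (at 0)"
    using DERIV_mult[OF DERIV_ident smooth_on_has_derivative[OF w(1)], of 0] by simp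
qed (use w in auto)

lemma A_equiv_left:
  assumes "open V" "\<gamma> 0 \<in> V" "smooth_on V F" "smooth_on V G"
    and "(F has_derivative (\<lambda>h. a * fst h + b * snd h)) (at (\<gamma> 0))"
    and "(G has_derivative (\<lambda>h. c * fst h + d * snd h)) (at (\<gamma> 0))"
    and "a * d - b * c \<noteq> 0"
  shows "A_equiv \<gamma> (\<lambda>t. (F (\<gamma> t), G (\<gamma> t)))"
  unfolding A_equiv_def Cr_equiv_iff
  by (intro exI[of _ "\<lambda>t. t"] exI[of _ "\<lambda>z. (F z, G z)"] conjI diffeo_germ_id
      diffeo_germ_smooth_real2[OF assms]) auto

text \<open>It lets the effect of a substitution t(1 + X) on each power of t be read off to first
  order in X, with an explicit smooth remainder in X^2.\<close>

lemma power_one_plus: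
  obtains q where "\<And>n. smooth (q n)" "\<And>n X. (1 + X) ^ n = 1 + real n * X + X\<^sup>2 * q n X"
proof -
  have "\<exists>q. smooth q \<and> (\<forall>X::real. (1 + X) ^ n = 1 + real n * X + X\<^sup>2 * q X)" for n
  proof (induction n)
    case 0
    show ?case by (intro exI[of _ "\<lambda>x. 0"]) (simp add: smooth_on_const)
  next
    case (Suc n)
    then obtain q where q: "smooth q" "\<And>X::real. (1 + X) ^ n = 1 + real n * X + X\<^sup>2 * q X" by blast
    have "smooth (\<lambda>X. real n + q X + X * q X)" by (intro smooth_intros q open_UNIV)
    moreover have "(1 + X) ^ Suc n = 1 + real (Suc n) * X + X\<^sup>2 * (real n + q X + X * q X)" for X
      by (simp add: q(2) algebra_simps power2_eq_square)
    ultimately show ?case by blast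
  qed
  then obtain q where "\<forall>n. smooth (q n) \<and> (\<forall>X::real. (1 + X) ^ n = 1 + real n * X + X\<^sup>2 * q n X)"
    using choice[of "\<lambda>n q. smooth q \<and> (\<forall>X::real. (1 + X) ^ n = 1 + real n * X + X\<^sup>2 * q X)"] by blast
  then show ?thesis by (intro that[of q]) blast+
qed

section \<open>Elimination of coefficients, order by order\<close>

lemma reduce_tangent:
  assumes u: "smooth u" and v: "smooth v"
    and d: "a4 * b5 - a5 * b4 \<noteq> 0"
  obtains u' v' where "smooth u'" "smooth v'"
    "A_equiv (\<lambda>t. (a0 + a4 * t ^ 4 + a5 * t ^ 5 + t ^ 6 * u t, b0 + b4 * t ^ 4 + b5 * t ^ 5 + t ^ 6 * v t))
       (\<lambda>t. (t ^ 4 + t ^ 6 * u' t, t ^ 5 + t ^ 6 * v' t))"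
proof -
  define D where "D = a4 * b5 - a5 * b4"
  have D: "D \<noteq> 0" using d by (simp add: D_def)
  define \<gamma> where "\<gamma> t = (a0 + a4 * t ^ 4 + a5 * t ^ 5 + t ^ 6 * u t, b0 + b4 * t ^ 4 + b5 * t ^ 5 + t ^ 6 * v t)" for t
  \<comment> \<open>Translation to the origin followed by the inverse of the matrix of the
    coefficient vectors of t^4 and t^5.\<close>
  define F where "F z = inverse D * (b5 * (fst z - a0) - a5 * (snd z - b0))" for z :: "real \<times> real"
  define G where "G z = inverse D * (a4 * (snd z - b0) - b4 * (fst z - a0))" for z :: "real \<times> real"
  define u' where "u' t = inverse D * (b5 * u t - a5 * v t)" for t
  define v' where "v' t = inverse D * (a4 * v t - b4 * u t)" for t
  have "A_equiv \<gamma> (\<lambda>t. (F (\<gamma> t), G (\<gamma> t)))"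
  proof (rule A_equiv_left[OF open_UNIV])
    show "smooth_on UNIV F" "smooth_on UNIV G"
      unfolding F_def G_def by (intro smooth_intros open_UNIV)+
    show "(F has_derivative (\<lambda>h. (inverse D * b5) * fst h + (- inverse D * a5) * snd h)) (at (\<gamma> 0))"
      unfolding F_def by (auto intro!: derivative_eq_intros simp: algebra_simps)
    show "(G has_derivative (\<lambda>h. (- inverse D * b4) * fst h + (inverse D * a4) * snd h)) (at (\<gamma> 0))"
      unfolding G_def by (auto intro!: derivative_eq_intros simp: algebra_simps)
    have "inverse D * b5 * (inverse D * a4) - - inverse D * a5 * (- inverse D * b4) = inverse D * inverse D * D"
      by (simp add: D_def algebra_simps)
    then show "inverse D * b5 * (inverse D * a4) - - inverse D * a5 * (- inverse D * b4) \<noteq> 0"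
      using D by simp
  qed auto
  moreover have "F (\<gamma> t) = t ^ 4 + t ^ 6 * u' t" for t
  proof -
    have "F (\<gamma> t) = (inverse D * D) * t ^ 4 + t ^ 6 * u' t"
      by (simp add: F_def \<gamma>_def u'_def D_def algebra_simps)
    then show ?thesis using D by simp
  qed
  moreover have "G (\<gamma> t) = t ^ 5 + t ^ 6 * v' t" for t
  proof -
    have "G (\<gamma> t) = (inverse D * D) * t ^ 5 + t ^ 6 * v' t"
      by (simp add: G_def \<gamma>_def v'_def D_def algebra_simps)
    then show ?thesis using D by simp
  qed
  moreover have "smooth u'" "smooth v'" unfolding u'_def v'_def by (intro smooth_intros u v open_UNIV)+
  ultimately show ?thesis by (intro that[of u' v']) (simp_all add: \<gamma>_def[abs_def])
qed

text \<open>Because the second coordinate vanishes at the base point, the quadratic term does not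
  affect the derivative there. The linear term serves to remove t^5 from the first component, the
  quadratic one to remove t^10.\<close>

lemma A_equiv_shear:
  assumes "snd (\<gamma> 0) = 0"
  shows "A_equiv \<gamma> (\<lambda>t. (fst (\<gamma> t) + c * snd (\<gamma> t) + d * (snd (\<gamma> t))\<^sup>2, snd (\<gamma> t)))"
proof (rule A_equiv_left[OF open_UNIV])
  show "smooth_on UNIV (\<lambda>z::real \<times> real. fst z + c * snd z + d * (snd z)\<^sup>2)"
    by (intro smooth_intros open_UNIV)
  show "((\<lambda>z. fst z + c * snd z + d * (snd z)\<^sup>2) has_derivative (\<lambda>h. 1 * fst h + c * snd h)) (at (\<gamma> 0))"
    using assms by (auto intro!: derivative_eq_intros simp: algebra_simps)
  show "(snd has_derivative (\<lambda>h. 0 * fst h + 1 * snd h)) (at (\<gamma> 0))"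
    by (auto intro!: derivative_eq_intros)
qed (auto intro: smooth_intros)

lemma reduce_order6:
  assumes u: "smooth u" and v: "smooth v"
  obtains u' v' where "smooth u'" "smooth v'"
    "A_equiv (\<lambda>t. (t ^ 4 + t ^ 6 * u t, t ^ 5 + t ^ 6 * v t)) (\<lambda>t. (t ^ 4 + t ^ 6 * u' t, t ^ 5 + t ^ 7 * v' t))"
proof -
  obtain v1 where v1: "smooth v1" "\<And>t. v t = v 0 + t * v1 t" by (rule Hadamard[OF v]) blast
  \<comment> \<open>In (t(1 + \<open>\<alpha>\<close> t))^5 the coefficient of t^6 is 5
    \<open>\<alpha>\<close>, which has to cancel \<open>v 0\<close>. The price is 4
    \<open>\<alpha>\<close> t^5 in the first component.\<close>
  define \<alpha> where "\<alpha> = - v 0 / 5"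
  obtain q where q: "\<And>n. smooth (q n)" "\<And>n X. (1 + X) ^ n = 1 + real n * X + X\<^sup>2 * q n X"
    by (rule power_one_plus) blast
  define \<psi> where "\<psi> t = t * (1 + \<alpha> * t)" for t
  have \<psi>: "smooth \<psi>" unfolding \<psi>_def by (intro smooth_intros open_UNIV)
  define u1 where "u1 t = \<alpha>\<^sup>2 * q 4 (\<alpha> * t) + (1 + \<alpha> * t) ^ 6 * u (\<psi> t)" for t
  define v2 where "v2 t = \<alpha>\<^sup>2 * q 5 (\<alpha> * t) + v 0 * (6 * \<alpha> + \<alpha>\<^sup>2 * t * q 6 (\<alpha> * t)) + (1 + \<alpha> * t) ^ 7 * v1 (\<psi> t)" for t
  \<comment> \<open>The shear x - 4 \<open>\<alpha>\<close> y removes the t^5 term; the added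
    product is what the t^7 part of y leaves behind.\<close>
  define u2 where "u2 t = u1 t + - 4 * \<alpha> * t * v2 t" for t
  let ?\<gamma> = "\<lambda>t. (t ^ 4 + t ^ 6 * u t, t ^ 5 + t ^ 6 * v t)"
  have "A_equiv ?\<gamma> (\<lambda>t. ?\<gamma> (\<psi> t))"
    unfolding \<psi>_def by (rule A_equiv_reparam_mult[of "\<lambda>t. 1 + \<alpha> * t"]) (auto intro!: smooth_intros)
  also have eq: "(\<lambda>t. ?\<gamma> (\<psi> t)) = (\<lambda>t. (t ^ 4 + 4 * \<alpha> * t ^ 5 + t ^ 6 * u1 t, t ^ 5 + t ^ 7 * v2 t))"
  proof
    fix t
    have x: "\<psi> t ^ 4 = t ^ 4 * (1 + 4 * (\<alpha> * t) + (\<alpha> * t)\<^sup>2 * q 4 (\<alpha> * t))"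
      "\<psi> t ^ 5 = t ^ 5 * (1 + 5 * (\<alpha> * t) + (\<alpha> * t)\<^sup>2 * q 5 (\<alpha> * t))"
      by (simp_all add: \<psi>_def power_mult_distrib q(2))
    have x6: "\<psi> t ^ 6 = t ^ 6 * (1 + \<alpha> * t) ^ 6" by (simp add: \<psi>_def power_mult_distrib)
    have "\<psi> t ^ 4 + \<psi> t ^ 6 * u (\<psi> t) = t ^ 4 + 4 * \<alpha> * t ^ 5 + t ^ 6 * u1 t"
      unfolding x x6 u1_def by algebra
    moreover have "\<psi> t ^ 6 * v (\<psi> t) = v 0 * (t ^ 6 * (1 + 6 * (\<alpha> * t) + (\<alpha> * t)\<^sup>2 * q 6 (\<alpha> * t))) + t ^ 6 * (1 + \<alpha> * t) ^ 6 * (t * (1 + \<alpha> * t) * v1 (\<psi> t))"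
    proof -
      have "\<psi> t ^ 6 * v (\<psi> t) = v 0 * \<psi> t ^ 6 + \<psi> t ^ 6 * (\<psi> t * v1 (\<psi> t))"
        unfolding v1(2)[of "\<psi> t"] by (simp add: algebra_simps)
      moreover have "\<psi> t ^ 6 = t ^ 6 * (1 + 6 * (\<alpha> * t) + (\<alpha> * t)\<^sup>2 * q 6 (\<alpha> * t))"
        by (simp add: \<psi>_def power_mult_distrib q(2))
      ultimately show ?thesis using x6 by (simp add: \<psi>_def)
    qed
    moreover have "v 0 = - 5 * \<alpha>" by (simp add: \<alpha>_def)
    ultimately have "\<psi> t ^ 5 + \<psi> t ^ 6 * v (\<psi> t) = t ^ 5 + t ^ 7 * v2 t"
      unfolding x v2_def by algebra
    with \<open>\<psi> t ^ 4 + \<psi> t ^ 6 * u (\<psi> t) = _\<close>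
    show "?\<gamma> (\<psi> t) = (t ^ 4 + 4 * \<alpha> * t ^ 5 + t ^ 6 * u1 t, t ^ 5 + t ^ 7 * v2 t)" by simp
  qed
  finally have 1: "A_equiv ?\<gamma> (\<lambda>t. (t ^ 4 + 4 * \<alpha> * t ^ 5 + t ^ 6 * u1 t, t ^ 5 + t ^ 7 * v2 t))" .
  have 2: "A_equiv (\<lambda>t. (t ^ 4 + 4 * \<alpha> * t ^ 5 + t ^ 6 * u1 t, t ^ 5 + t ^ 7 * v2 t)) (\<lambda>t. (t ^ 4 + t ^ 6 * u2 t, t ^ 5 + t ^ 7 * v2 t))"
  proof -
    have "t ^ 4 + 4 * \<alpha> * t ^ 5 + t ^ 6 * u1 t + - 4 * \<alpha> * (t ^ 5 + t ^ 7 * v2 t) + 0 * (t ^ 5 + t ^ 7 * v2 t)\<^sup>2 = t ^ 4 + t ^ 6 * u2 t" for t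
      unfolding u2_def by algebra
    then show ?thesis
      using A_equiv_shear[of "\<lambda>t. (t ^ 4 + 4 * \<alpha> * t ^ 5 + t ^ 6 * u1 t, t ^ 5 + t ^ 7 * v2 t)" "- 4 * \<alpha>" 0]
      by (simp only: fst_conv snd_conv) simp
  qed
  have sm: "smooth u2" "smooth v2" unfolding u2_def u1_def v2_def
    by (intro smooth_intros smooth_compose[OF u] smooth_compose[OF v1(1)] smooth_compose[OF q(1)] \<psi> open_UNIV)+
  show ?thesis by (rule that[OF sm A_equiv_trans[OF 1 2]])
qed

text \<open>Both coefficients of the parameter change are spent on orders 6 and 7 of the first
  component. The coefficient of t^7 in the second, shifted by 5 \<open>\<beta>\<close>, is the one
  that cannot be removed.\<close>

lemma reduce_order7:
  assumes u: "smooth u" and v: "smooth v"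
  obtains b u' v' where "smooth u'" "smooth v'"
    "A_equiv (\<lambda>t. (t ^ 4 + t ^ 6 * u t, t ^ 5 + t ^ 7 * v t)) (\<lambda>t. (t ^ 4 + t ^ 8 * u' t, t ^ 5 + b * t ^ 7 + t ^ 8 * v' t))"
proof -
  obtain v1 where v1: "smooth v1" "\<And>t. v t = v 0 + t * v1 t" by (rule Hadamard[OF v]) blast
  obtain u0 where u0: "smooth u0" "\<And>t. u t = u 0 + t * u0 t" by (rule Hadamard[OF u]) blast
  obtain u1 where u1: "smooth u1" "\<And>t. u0 t = u0 0 + t * u1 t" by (rule Hadamard[OF u0(1)]) blast
  \<comment> \<open>The fourth power of t(1 + t^2 (\<open>\<beta>\<close> + \<open>\<delta>\<close>
    t)) contributes 4 \<open>\<beta>\<close> t^6 + 4 \<open>\<delta>\<close> t^7, to be matched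
    against \<open>u 0\<close> and \<open>u0 0\<close>; its square terms start at order 8.\<close>
  define \<beta> \<delta> where "\<beta> = - u 0 / 4" and "\<delta> = - u0 0 / 4"
  obtain q where q: "\<And>n. smooth (q n)" "\<And>n X. (1 + X) ^ n = 1 + real n * X + X\<^sup>2 * q n X"
    by (rule power_one_plus) blast
  define z where "z t = \<beta> + \<delta> * t" for t
  define \<psi> where "\<psi> t = t * (1 + t\<^sup>2 * z t)" for t
  have z: "smooth z" unfolding z_def by (intro smooth_intros open_UNIV)
  have \<psi>: "smooth \<psi>" unfolding \<psi>_def by (intro smooth_intros z open_UNIV)
  define Q where "Q n t = q n (t\<^sup>2 * z t)" for n t
  define u2 where "u2 t = (z t)\<^sup>2 * Q 4 t + u 0 * (6 * z t + t\<^sup>2 * (z t)\<^sup>2 * Q 6 t)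
    + u0 0 * (7 * t * z t + t ^ 3 * (z t)\<^sup>2 * Q 7 t) + (1 + t\<^sup>2 * z t) ^ 8 * u1 (\<psi> t)" for t
  define v2 where "v2 t = 5 * \<delta> + t * (z t)\<^sup>2 * Q 5 t + v 0 * (7 * t * z t + t ^ 3 * (z t)\<^sup>2 * Q 7 t)
    + (1 + t\<^sup>2 * z t) ^ 8 * v1 (\<psi> t)" for t
  let ?\<gamma> = "\<lambda>t. (t ^ 4 + t ^ 6 * u t, t ^ 5 + t ^ 7 * v t)"
  have "A_equiv ?\<gamma> (\<lambda>t. ?\<gamma> (\<psi> t))"
    unfolding \<psi>_def by (rule A_equiv_reparam_mult[of "\<lambda>t. 1 + t\<^sup>2 * z t"]) (auto intro!: smooth_intros z)
  also have "(\<lambda>t. ?\<gamma> (\<psi> t)) = (\<lambda>t. (t ^ 4 + t ^ 8 * u2 t, t ^ 5 + (5 * \<beta> + v 0) * t ^ 7 + t ^ 8 * v2 t))"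
  proof
    fix t
    have p: "\<psi> t ^ n = t ^ n * (1 + real n * (t\<^sup>2 * z t) + (t\<^sup>2 * z t)\<^sup>2 * Q n t)" for n
      unfolding \<psi>_def power_mult_distrib Q_def q(2) by simp
    have p8: "\<psi> t ^ 8 = t ^ 8 * (1 + t\<^sup>2 * z t) ^ 8" by (simp add: \<psi>_def power_mult_distrib)
    have uu: "u (\<psi> t) = u 0 + \<psi> t * (u0 0 + \<psi> t * u1 (\<psi> t))" using u0(2) u1(2) by metis
    have "\<psi> t ^ 6 * u (\<psi> t) = u 0 * \<psi> t ^ 6 + u0 0 * \<psi> t ^ 7 + \<psi> t ^ 8 * u1 (\<psi> t)"
      unfolding uu by algebra
    then have X: "\<psi> t ^ 4 + \<psi> t ^ 6 * u (\<psi> t) = \<psi> t ^ 4 + u 0 * \<psi> t ^ 6 + u0 0 * \<psi> t ^ 7 + t ^ 8 * (1 + t\<^sup>2 * z t) ^ 8 * u1 (\<psi> t)"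
      using p8 by simp
    have uz: "u 0 = - 4 * \<beta>" "u0 0 = - 4 * \<delta>" by (simp_all add: \<beta>_def \<delta>_def)
    have zt: "4 * t ^ 6 * z t + u 0 * t ^ 6 + u0 0 * t ^ 7 = 0"
      unfolding uz z_def by algebra
    have "\<psi> t ^ 4 + \<psi> t ^ 6 * u (\<psi> t) = t ^ 4 + (4 * t ^ 6 * z t + u 0 * t ^ 6 + u0 0 * t ^ 7) + t ^ 8 * u2 t"
      unfolding X unfolding p[of 4] p[of 6] p[of 7] u2_def of_nat_numeral by algebra
    then have 1: "\<psi> t ^ 4 + \<psi> t ^ 6 * u (\<psi> t) = t ^ 4 + t ^ 8 * u2 t" using zt by simp
    have "\<psi> t ^ 7 * v (\<psi> t) = v 0 * \<psi> t ^ 7 + \<psi> t ^ 8 * v1 (\<psi> t)"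
      unfolding v1(2)[of "\<psi> t"] by algebra
    then have Y: "\<psi> t ^ 5 + \<psi> t ^ 7 * v (\<psi> t) = \<psi> t ^ 5 + v 0 * \<psi> t ^ 7 + t ^ 8 * (1 + t\<^sup>2 * z t) ^ 8 * v1 (\<psi> t)"
      using p8 by simp
    have zz: "5 * t ^ 7 * z t = 5 * \<beta> * t ^ 7 + 5 * \<delta> * t ^ 8" unfolding z_def by algebra
    have "\<psi> t ^ 5 + \<psi> t ^ 7 * v (\<psi> t) = t ^ 5 + 5 * t ^ 7 * z t - 5 * \<delta> * t ^ 8 + v 0 * t ^ 7 + t ^ 8 * v2 t"
      unfolding Y unfolding p[of 5] p[of 7] v2_def of_nat_numeral by algebra
    then have 2: "\<psi> t ^ 5 + \<psi> t ^ 7 * v (\<psi> t) = t ^ 5 + (5 * \<beta> + v 0) * t ^ 7 + t ^ 8 * v2 t"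
      using zz by (simp add: algebra_simps)
    show "?\<gamma> (\<psi> t) = (t ^ 4 + t ^ 8 * u2 t, t ^ 5 + (5 * \<beta> + v 0) * t ^ 7 + t ^ 8 * v2 t)"
      using 1 2 by simp
  qed
  finally have 1: "A_equiv ?\<gamma> (\<lambda>t. (t ^ 4 + t ^ 8 * u2 t, t ^ 5 + (5 * \<beta> + v 0) * t ^ 7 + t ^ 8 * v2 t))" .
  have sm: "smooth u2" "smooth v2" unfolding u2_def v2_def Q_def
    by (intro smooth_intros smooth_compose[OF u1(1)] smooth_compose[OF v1(1)] smooth_compose[OF q(1)] \<psi> z open_UNIV)+
  show ?thesis by (rule that[OF sm 1])
qed

text \<open>Replacing t by l t and dividing the components by l^4 and l^5 multiplies the coefficient
  of t^7 by l^2. With l = 1 / sqrt |b| this gives the sign of b.\<close>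

lemma reduce_scale:
  assumes u: "smooth u" and v: "smooth v"
  obtains e u' v' where "e \<in> {0, 1, -1}" "smooth u'" "smooth v'"
    "A_equiv (\<lambda>t. (t ^ 4 + t ^ 8 * u t, t ^ 5 + b * t ^ 7 + t ^ 8 * v t)) (\<lambda>t. (t ^ 4 + t ^ 8 * u' t, t ^ 5 + e * t ^ 7 + t ^ 8 * v' t))"
proof -
  obtain l e :: real where l: "l > 0" and e: "e \<in> {0, 1, -1}" "b * l\<^sup>2 = e"
  proof (cases "b = 0")
    case True
    then show ?thesis by (intro that[of 1 0]) auto
  next
    case False
    have "b * (1 / sqrt \<bar>b\<bar>)\<^sup>2 = sgn b" using False by (simp add: power_divide sgn_if)
    then show ?thesis using False by (intro that[of "1 / sqrt \<bar>b\<bar>" "sgn b"]) (auto simp: sgn_if)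
  qed
  define u' where "u' t = l ^ 4 * u (t * l)" for t
  define v' where "v' t = l ^ 3 * v (t * l)" for t
  define F where "F z = inverse (l ^ 4) * fst z" for z :: "real \<times> real"
  define G where "G z = inverse (l ^ 5) * snd z" for z :: "real \<times> real"
  let ?\<gamma> = "\<lambda>t. (t ^ 4 + t ^ 8 * u t, t ^ 5 + b * t ^ 7 + t ^ 8 * v t)"
  have 1: "A_equiv ?\<gamma> (\<lambda>t. ?\<gamma> (t * l))"
    by (rule A_equiv_reparam_mult[of "\<lambda>t. l"]) (use l in \<open>auto intro!: smooth_intros\<close>)
  have 2: "A_equiv (\<lambda>t. ?\<gamma> (t * l)) (\<lambda>t. (F (?\<gamma> (t * l)), G (?\<gamma> (t * l))))"
  proof (rule A_equiv_left[OF open_UNIV])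
    show "smooth_on UNIV F" "smooth_on UNIV G" unfolding F_def G_def by (intro smooth_intros open_UNIV)+
    show "(F has_derivative (\<lambda>h. inverse (l ^ 4) * fst h + 0 * snd h)) (at p)" for p
      unfolding F_def by (auto intro!: derivative_eq_intros)
    show "(G has_derivative (\<lambda>h. 0 * fst h + inverse (l ^ 5) * snd h)) (at p)" for p
      unfolding G_def by (auto intro!: derivative_eq_intros)
  qed (use l in auto)
  have "F (?\<gamma> (t * l)) = t ^ 4 + t ^ 8 * u' t" for t
  proof -
    have "(t * l) ^ 4 + (t * l) ^ 8 * u (t * l) = l ^ 4 * (t ^ 4 + t ^ 8 * u' t)"
      unfolding u'_def by algebra
    then show ?thesis using l by (simp add: F_def)
  qed
  moreover have "G (?\<gamma> (t * l)) = t ^ 5 + e * t ^ 7 + t ^ 8 * v' t" for t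
  proof -
    have "(t * l) ^ 5 + b * (t * l) ^ 7 + (t * l) ^ 8 * v (t * l) = l ^ 5 * (t ^ 5 + (b * l\<^sup>2) * t ^ 7 + t ^ 8 * v' t)"
      unfolding v'_def by algebra
    then show ?thesis using l e(2) by (simp add: G_def)
  qed
  ultimately have 3: "A_equiv ?\<gamma> (\<lambda>t. (t ^ 4 + t ^ 8 * u' t, t ^ 5 + e * t ^ 7 + t ^ 8 * v' t))"
    using A_equiv_trans[OF 1 2] by (simp only:)
  have sm: "smooth u'" "smooth v'" unfolding u'_def v'_def
    by (intro smooth_intros smooth_compose[OF u] smooth_compose[OF v] open_UNIV)+
  show ?thesis by (rule that[OF e(1) sm 3])
qed

lemma smooth_Taylor4:
  assumes "smooth f"
  obtains a b c d r where "smooth r" "\<And>t. f t = a + b * t + c * t\<^sup>2 + d * t ^ 3 + t ^ 4 * r t"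
proof -
  obtain r where r: "smooth r" "\<And>t. f t = (\<Sum>i<4. (deriv ^^ i) f 0 / fact i * t ^ i) + t ^ 4 * r t"
    by (rule smooth_Taylor[OF assms]) blast
  define c where "c i = (deriv ^^ i) f 0 / fact i" for i
  have "f t = c 0 + c 1 * t + c 2 * t\<^sup>2 + c 3 * t ^ 3 + t ^ 4 * r t" for t
    unfolding r(2)[of t] c_def[symmetric] by (simp add: eval_nat_numeral)
  then show ?thesis by (rule that[OF r(1)])
qed

text \<open>The monomials x^2, x y, y^2 start with t^8, t^9, t^10 and so clear these orders in both
  components. Below order 12 their only further term is e t^11 from x y, which merely changes the
  coefficients of t^11.\<close>

lemma reduce_quadratic:
  assumes u: "smooth u" and v: "smooth v"
  obtains a b u' v' where "smooth u'" "smooth v'"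
    "A_equiv (\<lambda>t. (t ^ 4 + t ^ 8 * u t, t ^ 5 + e * t ^ 7 + t ^ 8 * v t))
       (\<lambda>t. (t ^ 4 + a * t ^ 11 + t ^ 12 * u' t, t ^ 5 + e * t ^ 7 + b * t ^ 11 + t ^ 12 * v' t))"
proof -
  obtain a8 a9 a10 a11 u1 where u1: "smooth u1" "\<And>t. u t = a8 + a9 * t + a10 * t\<^sup>2 + a11 * t ^ 3 + t ^ 4 * u1 t"
    by (rule smooth_Taylor4[OF u]) blast
  obtain b8 b9 b10 b11 v1 where v1: "smooth v1" "\<And>t. v t = b8 + b9 * t + b10 * t\<^sup>2 + b11 * t ^ 3 + t ^ 4 * v1 t"
    by (rule smooth_Taylor4[OF v]) blast
  define F where "F z = fst z - (a8 * (fst z)\<^sup>2 + a9 * (fst z * snd z) + a10 * (snd z)\<^sup>2)" for z :: "real \<times> real"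
  define G where "G z = snd z - (b8 * (fst z)\<^sup>2 + b9 * (fst z * snd z) + b10 * (snd z)\<^sup>2)" for z :: "real \<times> real"
  \<comment> \<open>\<open>A\<close>, \<open>B\<close> and \<open>C\<close> are the parts of x^2, x
    y and y^2 of order at least 12, divided by t^12.\<close>
  define A where "A t = 2 * u t + t ^ 4 * (u t)\<^sup>2" for t
  define B where "B t = v t + t * u t + e * t ^ 3 * u t + t ^ 4 * u t * v t" for t
  define C where "C t = 2 * e + e\<^sup>2 * t\<^sup>2 + 2 * t * v t + 2 * e * t ^ 3 * v t + t ^ 4 * (v t)\<^sup>2" for t
  define u2 where "u2 t = u1 t - (a8 * A t + a9 * B t + a10 * C t)" for t
  define v2 where "v2 t = v1 t - (b8 * A t + b9 * B t + b10 * C t)" for t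
  let ?\<gamma> = "\<lambda>t. (t ^ 4 + t ^ 8 * u t, t ^ 5 + e * t ^ 7 + t ^ 8 * v t)"
  have 1: "A_equiv ?\<gamma> (\<lambda>t. (F (?\<gamma> t), G (?\<gamma> t)))"
  proof (rule A_equiv_left[OF open_UNIV])
    show "smooth_on UNIV F" "smooth_on UNIV G" unfolding F_def G_def by (intro smooth_intros open_UNIV)+
    show "(F has_derivative (\<lambda>h. 1 * fst h + 0 * snd h)) (at (?\<gamma> 0))"
      unfolding F_def by (auto intro!: derivative_eq_intros)
    show "(G has_derivative (\<lambda>h. 0 * fst h + 1 * snd h)) (at (?\<gamma> 0))"
      unfolding G_def by (auto intro!: derivative_eq_intros)
  qed auto
  have xx: "(t ^ 4 + t ^ 8 * u t)\<^sup>2 = t ^ 8 + t ^ 12 * A t" for t unfolding A_def by algebra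
  have xy: "(t ^ 4 + t ^ 8 * u t) * (t ^ 5 + e * t ^ 7 + t ^ 8 * v t) = t ^ 9 + e * t ^ 11 + t ^ 12 * B t" for t
    unfolding B_def by algebra
  have yy: "(t ^ 5 + e * t ^ 7 + t ^ 8 * v t)\<^sup>2 = t ^ 10 + t ^ 12 * C t" for t unfolding C_def by algebra
  have "F (?\<gamma> t) = t ^ 4 + (a11 - a9 * e) * t ^ 11 + t ^ 12 * u2 t" for t
    unfolding F_def fst_conv snd_conv xx xy yy u2_def unfolding u1(2)[of t] by algebra
  moreover have "G (?\<gamma> t) = t ^ 5 + e * t ^ 7 + (b11 - b9 * e) * t ^ 11 + t ^ 12 * v2 t" for t
    unfolding G_def fst_conv snd_conv xx xy yy v2_def unfolding v1(2)[of t] by algebra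
  ultimately have 2: "A_equiv ?\<gamma> (\<lambda>t. (t ^ 4 + (a11 - a9 * e) * t ^ 11 + t ^ 12 * u2 t, t ^ 5 + e * t ^ 7 + (b11 - b9 * e) * t ^ 11 + t ^ 12 * v2 t))"
    using 1 by (simp only:)
  have sm: "smooth u2" "smooth v2" unfolding u2_def v2_def A_def B_def C_def
    by (intro smooth_intros u v u1(1) v1(1) open_UNIV)+
  show ?thesis by (rule that[OF sm 2])
qed

lemma reduce_order11:
  assumes u: "smooth u" and v: "smooth v"
  obtains u' v' where "smooth u'" "smooth v'"
    "A_equiv (\<lambda>t. (t ^ 4 + a * t ^ 11 + t ^ 12 * u t, t ^ 5 + e * t ^ 7 + b * t ^ 11 + t ^ 12 * v t))
      (\<lambda>t. (t ^ 4 + t ^ 12 * u' t, t ^ 5 + e * t ^ 7 + t ^ 12 * v' t))"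
proof -
  \<comment> \<open>\<open>\<nu>\<close> clears t^11 from the second component and creates 4
    \<open>\<nu>\<close> t^10 in the first, which a multiple of y^2 removes. \<open>\<mu>\<close>
    clears t^11 from the first and disturbs the second only at order 12.\<close>
  define \<nu> \<mu> where "\<nu> = - b / 5" and "\<mu> = - a / 4"
  obtain q where q: "\<And>n. smooth (q n)" "\<And>n X. (1 + X) ^ n = 1 + real n * X + X\<^sup>2 * q n X"
    by (rule power_one_plus) blast
  define z where "z t = \<nu> + \<mu> * t" for t
  define \<psi> where "\<psi> t = t * (1 + t ^ 6 * z t)" for t
  have z: "smooth z" unfolding z_def by (intro smooth_intros open_UNIV)
  have \<psi>: "smooth \<psi>" unfolding \<psi>_def by (intro smooth_intros z open_UNIV)
  define Q where "Q n t = q n (t ^ 6 * z t)" for n t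
  define u2 where "u2 t = t ^ 4 * (z t)\<^sup>2 * Q 4 t + a * (11 * t ^ 5 * z t + t ^ 11 * (z t)\<^sup>2 * Q 11 t) + (1 + t ^ 6 * z t) ^ 12 * u (\<psi> t)" for t
  define v2 where "v2 t = 5 * \<mu> + t ^ 5 * (z t)\<^sup>2 * Q 5 t + e * (7 * t * z t + t ^ 7 * (z t)\<^sup>2 * Q 7 t)
     + b * (11 * t ^ 5 * z t + t ^ 11 * (z t)\<^sup>2 * Q 11 t) + (1 + t ^ 6 * z t) ^ 12 * v (\<psi> t)" for t
  define C where "C t = 2 * e + e\<^sup>2 * t\<^sup>2 + 2 * t ^ 5 * v2 t + 2 * e * t ^ 7 * v2 t + t ^ 12 * (v2 t)\<^sup>2" for t
  define u3 where "u3 t = u2 t + - 4 * \<nu> * C t" for t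
  let ?\<gamma> = "\<lambda>t. (t ^ 4 + a * t ^ 11 + t ^ 12 * u t, t ^ 5 + e * t ^ 7 + b * t ^ 11 + t ^ 12 * v t)"
  let ?\<delta> = "\<lambda>t. (t ^ 4 + 4 * \<nu> * t ^ 10 + t ^ 12 * u2 t, t ^ 5 + e * t ^ 7 + t ^ 12 * v2 t)"
  have "A_equiv ?\<gamma> (\<lambda>t. ?\<gamma> (\<psi> t))"
    unfolding \<psi>_def by (rule A_equiv_reparam_mult[of "\<lambda>t. 1 + t ^ 6 * z t"]) (auto intro!: smooth_intros z)
  also have "(\<lambda>t. ?\<gamma> (\<psi> t)) = ?\<delta>"
  proof
    fix t
    have p: "\<psi> t ^ n = t ^ n * (1 + real n * (t ^ 6 * z t) + (t ^ 6 * z t)\<^sup>2 * Q n t)" for n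
      unfolding \<psi>_def power_mult_distrib Q_def q(2) by simp
    have p12: "\<psi> t ^ 12 = t ^ 12 * (1 + t ^ 6 * z t) ^ 12" by (simp add: \<psi>_def power_mult_distrib)
    define w where "w = (1 + t ^ 6 * z t) ^ 12"
    have ab: "a = - 4 * \<mu>" "b = - 5 * \<nu>" by (simp_all add: \<nu>_def \<mu>_def)
    have "\<psi> t ^ 4 + a * \<psi> t ^ 11 + \<psi> t ^ 12 * u (\<psi> t) = t ^ 4 + (4 * t ^ 10 * z t + a * t ^ 11) + t ^ 12 * u2 t"
      unfolding p12 p[of 4] p[of 11] u2_def of_nat_numeral w_def[symmetric] by algebra
    moreover have "4 * t ^ 10 * z t + a * t ^ 11 = 4 * \<nu> * t ^ 10" unfolding ab z_def by algebra
    ultimately have 1: "\<psi> t ^ 4 + a * \<psi> t ^ 11 + \<psi> t ^ 12 * u (\<psi> t) = t ^ 4 + 4 * \<nu> * t ^ 10 + t ^ 12 * u2 t" by simp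
    have "\<psi> t ^ 5 + e * \<psi> t ^ 7 + b * \<psi> t ^ 11 + \<psi> t ^ 12 * v (\<psi> t) = t ^ 5 + e * t ^ 7 + (5 * t ^ 11 * z t + b * t ^ 11 - 5 * \<mu> * t ^ 12) + t ^ 12 * v2 t"
      unfolding p12 p[of 5] p[of 7] p[of 11] v2_def of_nat_numeral w_def[symmetric] by algebra
    moreover have "5 * t ^ 11 * z t + b * t ^ 11 - 5 * \<mu> * t ^ 12 = 0" unfolding ab z_def by algebra
    ultimately have 2: "\<psi> t ^ 5 + e * \<psi> t ^ 7 + b * \<psi> t ^ 11 + \<psi> t ^ 12 * v (\<psi> t) = t ^ 5 + e * t ^ 7 + t ^ 12 * v2 t" by simp
    show "?\<gamma> (\<psi> t) = ?\<delta> t" using 1 2 by simp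
  qed
  finally have 1: "A_equiv ?\<gamma> ?\<delta>" .
  have 2: "A_equiv ?\<delta> (\<lambda>t. (t ^ 4 + t ^ 12 * u3 t, t ^ 5 + e * t ^ 7 + t ^ 12 * v2 t))"
  proof -
    have "t ^ 4 + 4 * \<nu> * t ^ 10 + t ^ 12 * u2 t + 0 * (t ^ 5 + e * t ^ 7 + t ^ 12 * v2 t) + - 4 * \<nu> * (t ^ 5 + e * t ^ 7 + t ^ 12 * v2 t)\<^sup>2 = t ^ 4 + t ^ 12 * u3 t" for t
      unfolding u3_def C_def by algebra
    then show ?thesis
      using A_equiv_shear[of ?\<delta> 0 "- 4 * \<nu>"] by (simp only: fst_conv snd_conv) simp
  qed
  have sm: "smooth u3" "smooth v2" unfolding u3_def C_def u2_def v2_def Q_def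
    by (intro smooth_intros smooth_compose[OF u] smooth_compose[OF v] smooth_compose[OF q(1)] \<psi> z open_UNIV)+
  show ?thesis by (rule that[OF sm A_equiv_trans[OF 1 2]])
qed


section \<open>Determinacy and the normal forms\<close>

lemma A_equiv_cong_eventually:
  assumes "A_equiv \<gamma>1 \<gamma>2" "\<forall>\<^sub>F t in nhds 0. \<gamma>2 t = \<gamma>3 t"
  shows "A_equiv \<gamma>1 \<gamma>3"
proof -
  obtain U \<psi> V \<Psi> where *: "0 \<in> U" "Cr_diffeo \<infinity> U \<psi>" "\<psi> 0 = 0" "\<gamma>1 0 \<in> V" "Cr_diffeo \<infinity> V \<Psi>"
    and ev: "\<forall>\<^sub>F s in nhds 0. \<Psi> (\<gamma>1 (inv_into U \<psi> s)) = \<gamma>2 s"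
    using assms(1) unfolding A_equiv_def Cr_equiv_def by blast
  from ev assms(2) have "\<forall>\<^sub>F s in nhds 0. \<Psi> (\<gamma>1 (inv_into U \<psi> s)) = \<gamma>3 s" by eventually_elim simp
  then show ?thesis unfolding A_equiv_def Cr_equiv_def using * by blast
qed

lemma smooth_on_differentiable2:
  fixes f :: "real \<times> real \<Rightarrow> real"
  assumes "open U" "z \<in> U" "smooth_on U f"
  shows "(f has_derivative (\<lambda>h. pder (1,0) f z * fst h + pder (0,1) f z * snd h)) (at z)"
  by (rule Ck_Suc_has_derivative2[OF assms(1,2), of 0]) (use assms(3) in \<open>simp add: smooth_on_def del: Ck.simps\<close>)

text \<open>With \<open>x = t^4\<close> and \<open>y = t^5 + e t^7\<close> one has \<open>y^2 - 2e x^3 = t^10 (1 + e^2 x)\<close> and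
  \<open>y^3 - x^3 (3e + e^3 x) y = t^15 (1 - e^4 x^2)\<close>, so \<open>t^12 r\<close> is a function of x and y once r is
  split according to the exponents modulo 4.\<close>

lemma order12_factors:
  fixes e :: real
  assumes r: "smooth r" and e: "\<bar>e\<bar> \<le> 1"
  obtains F where "smooth_on {z. \<bar>fst z\<bar> < 1} F" "(F has_derivative (\<lambda>h. 0)) (at (0,0))"
    "\<And>t. \<bar>t\<bar> < 1 \<Longrightarrow> F (t ^ 4, t ^ 5 + e * t ^ 7) = t ^ 12 * r t"
proof -
  obtain k0 k1 k2 k3 where k: "smooth k0" "smooth k1" "smooth k2" "smooth k3"
    and rk: "\<And>t. r t = k0 (t ^ 4) + t * k1 (t ^ 4) + t ^ 2 * k2 (t ^ 4) + t ^ 3 * k3 (t ^ 4)"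
    by (rule smooth_split4[OF r]) blast
  let ?V = "{z :: real \<times> real. \<bar>fst z\<bar> < 1}"
  have V: "open ?V" by (intro open_Collect_less continuous_intros)
  \<comment> \<open>The two factors to be inverted stay away from 0 on the strip |x| < 1 because |e|
    is at most 1.\<close>
  have e1: "1 + e\<^sup>2 * x \<noteq> 0" and e2: "1 - e ^ 4 * x\<^sup>2 \<noteq> 0" if "\<bar>x\<bar> < 1" for x
  proof -
    have "\<bar>x\<bar> ^ 2 < 1" using that by (simp add: abs_square_less_1)
    moreover have "\<bar>e\<bar> ^ 2 * \<bar>x\<bar> \<le> 1 * \<bar>x\<bar>" "\<bar>e\<bar> ^ 4 * \<bar>x\<bar> ^ 2 \<le> 1 * \<bar>x\<bar> ^ 2"
      by (intro mult_right_mono power_le_one e abs_ge_zero zero_le_power)+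
    ultimately have "\<bar>e\<bar> ^ 2 * \<bar>x\<bar> < 1" "\<bar>e\<bar> ^ 4 * \<bar>x\<bar> ^ 2 < 1" using that by linarith+
    moreover have "\<bar>e\<^sup>2 * x\<bar> = \<bar>e\<bar> ^ 2 * \<bar>x\<bar>" "\<bar>e ^ 4 * x\<^sup>2\<bar> = \<bar>e\<bar> ^ 4 * \<bar>x\<bar> ^ 2"
      by (simp_all add: abs_mult power_abs)
    ultimately show "1 + e\<^sup>2 * x \<noteq> 0" "1 - e ^ 4 * x\<^sup>2 \<noteq> 0" by linarith+
  qed
  \<comment> \<open>\<open>F\<close> is x P + y R. The three terms of x P account for t^12 k0, t^14
    k2 and, through x^2 y k1, for t^13 k1 + e t^15 k1.\<close>
  define P where "P z = (fst z)\<^sup>2 * k0 (fst z) + k2 (fst z) * inverse (1 + e\<^sup>2 * fst z) * ((snd z)\<^sup>2 - 2 * e * fst z ^ 3)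
     + fst z * k1 (fst z) * snd z" for z :: "real \<times> real"
  \<comment> \<open>The remaining exponent 15 belongs to \<open>k3\<close>; subtracting e k1
    compensates the surplus left by x^2 y.\<close>
  define R where "R z = (k3 (fst z) - e * k1 (fst z)) * inverse (1 - e ^ 4 * (fst z)\<^sup>2) * ((snd z)\<^sup>2 - fst z ^ 3 * (3 * e + e ^ 3 * fst z))"
    for z :: "real \<times> real"
  define F where "F z = fst z * P z + snd z * R z" for z
  have P: "smooth_on ?V P" and R: "smooth_on ?V R" unfolding P_def R_def
    by (intro smooth_intros smooth_on_inverse smooth_compose[OF k(1)] smooth_compose[OF k(2)] smooth_compose[OF k(3)]
        smooth_compose[OF k(4)] V; use e1 e2 in auto)+
  show ?thesis
  proof (rule that[of F])
    show "smooth_on ?V F" unfolding F_def by (intro smooth_intros P R V)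
    \<comment> \<open>Both cofactors vanish at the origin, so x P + y R has zero derivative
      there.\<close>
    have 0: "(0,0) \<in> ?V" "P (0,0) = 0" "R (0,0) = 0" by (simp_all add: P_def R_def)
    have "((\<lambda>z. fst z * P z + snd z * R z) has_derivative
      (\<lambda>h. (fst (0::real,0::real) * (pder (1,0) P (0,0) * fst h + pder (0,1) P (0,0) * snd h) + fst h * P (0,0))
         + (snd (0::real,0::real) * (pder (1,0) R (0,0) * fst h + pder (0,1) R (0,0) * snd h) + snd h * R (0,0)))) (at (0,0))"
      by (intro has_derivative_add has_derivative_mult has_derivative_fst has_derivative_snd has_derivative_ident
          smooth_on_differentiable2[OF V 0(1)] P R)
    then show "(F has_derivative (\<lambda>h. 0)) (at (0,0))" using 0 by (simp add: F_def[abs_def])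
    fix t :: real assume "\<bar>t\<bar> < 1"
    then have t: "\<bar>t ^ 4\<bar> < 1" using power_less_one_iff[of "\<bar>t\<bar>" 4] by (simp add: power_abs)
    define i j where "i = inverse (1 + e\<^sup>2 * t ^ 4)" and "j = inverse (1 - e ^ 4 * (t ^ 4)\<^sup>2)"
    have i: "i * (1 + e\<^sup>2 * t ^ 4) = 1" and j: "j * (1 - e ^ 4 * (t ^ 4)\<^sup>2) = 1"
      using e1[OF t] e2[OF t] by (simp_all add: i_def j_def)
    define y where "y = t ^ 5 + e * t ^ 7"
    have y2: "y\<^sup>2 - 2 * e * (t ^ 4) ^ 3 = t ^ 10 * (1 + e\<^sup>2 * t ^ 4)" unfolding y_def by algebra
    have y3: "y * (y\<^sup>2 - (t ^ 4) ^ 3 * (3 * e + e ^ 3 * t ^ 4)) = t ^ 15 * (1 - e ^ 4 * (t ^ 4)\<^sup>2)" unfolding y_def by algebra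
    have "F (t ^ 4, y) = t ^ 4 * ((t ^ 4)\<^sup>2 * k0 (t ^ 4) + k2 (t ^ 4) * i * (y\<^sup>2 - 2 * e * (t ^ 4) ^ 3) + t ^ 4 * k1 (t ^ 4) * y)
        + (k3 (t ^ 4) - e * k1 (t ^ 4)) * j * (y * (y\<^sup>2 - (t ^ 4) ^ 3 * (3 * e + e ^ 3 * t ^ 4)))"
      unfolding F_def P_def R_def i_def j_def fst_conv snd_conv by (simp only: mult_ac)
    also have "\<dots> = t ^ 12 * k0 (t ^ 4) + t ^ 14 * k2 (t ^ 4) * (i * (1 + e\<^sup>2 * t ^ 4)) + t ^ 8 * k1 (t ^ 4) * y
        + (k3 (t ^ 4) - e * k1 (t ^ 4)) * t ^ 15 * (j * (1 - e ^ 4 * (t ^ 4)\<^sup>2))"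
      unfolding y2 y3 by algebra
    also have "\<dots> = t ^ 12 * r t" unfolding i j rk[of t] y_def by algebra
    finally show "F (t ^ 4, t ^ 5 + e * t ^ 7) = t ^ 12 * r t" by (simp add: y_def)
  qed
qed

lemma isCont_Pair_smooth:
  assumes "smooth f" "smooth g"
  shows "isCont (\<lambda>t. (f t, g t)) x"
  using smooth_isCont[OF assms(1)] smooth_isCont[OF assms(2)] by (rule isCont_Pair)

text \<open>The plane map with components x + F and y + G has the identity as derivative at the
  origin and carries the normal form to the perturbed curve; symmetry of the equivalence turns this
  around.\<close>

lemma determinacy:
  fixes e :: real
  assumes u: "smooth u" and v: "smooth v" and e: "\<bar>e\<bar> \<le> 1"
  shows "A_equiv (\<lambda>t. (t ^ 4 + t ^ 12 * u t, t ^ 5 + e * t ^ 7 + t ^ 12 * v t)) (\<lambda>t. (t ^ 4, t ^ 5 + e * t ^ 7))"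
proof -
  obtain F where F: "smooth_on {z. \<bar>fst z\<bar> < 1} F" "(F has_derivative (\<lambda>h. 0)) (at (0,0))"
    "\<And>t. \<bar>t\<bar> < 1 \<Longrightarrow> F (t ^ 4, t ^ 5 + e * t ^ 7) = t ^ 12 * u t" by (rule order12_factors[OF u e]) blast
  obtain G where G: "smooth_on {z. \<bar>fst z\<bar> < 1} G" "(G has_derivative (\<lambda>h. 0)) (at (0,0))"
    "\<And>t. \<bar>t\<bar> < 1 \<Longrightarrow> G (t ^ 4, t ^ 5 + e * t ^ 7) = t ^ 12 * v t" by (rule order12_factors[OF v e]) blast
  let ?V = "{z :: real \<times> real. \<bar>fst z\<bar> < 1}"
  have V: "open ?V" by (intro open_Collect_less continuous_intros)
  let ?g = "\<lambda>t. (t ^ 4, t ^ 5 + e * t ^ 7)"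
  have "A_equiv ?g (\<lambda>t. (fst (?g t) + F (?g t), snd (?g t) + G (?g t)))"
  proof (rule A_equiv_left[OF V])
    show "smooth_on ?V (\<lambda>z. fst z + F z)" "smooth_on ?V (\<lambda>z. snd z + G z)" by (intro smooth_intros F G V)+
    have 0: "?g 0 = (0,0)" by simp
    show "((\<lambda>z. fst z + F z) has_derivative (\<lambda>h. 1 * fst h + 0 * snd h)) (at (?g 0))"
      unfolding 0 by (auto intro!: derivative_eq_intros F)
    show "((\<lambda>z. snd z + G z) has_derivative (\<lambda>h. 0 * fst h + 1 * snd h)) (at (?g 0))"
      unfolding 0 by (auto intro!: derivative_eq_intros G)
  qed auto
  moreover have "\<forall>\<^sub>F t in nhds 0. (fst (?g t) + F (?g t), snd (?g t) + G (?g t)) = (t ^ 4 + t ^ 12 * u t, t ^ 5 + e * t ^ 7 + t ^ 12 * v t)"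
    unfolding eventually_nhds_metric by (intro exI[of _ 1]) (auto simp: F(3) G(3) dist_real_def)
  ultimately have "A_equiv ?g (\<lambda>t. (t ^ 4 + t ^ 12 * u t, t ^ 5 + e * t ^ 7 + t ^ 12 * v t))"
    by (rule A_equiv_cong_eventually)
  then show ?thesis unfolding A_equiv_def
    by (rule Cr_equiv_sym) (intro isCont_Pair_smooth smooth_intros open_UNIV)
qed

section \<open>Passage to a curve on the whole line\<close>

lemma smooth_of_bigo:
  assumes f: "smooth f" and O: "(\<lambda>t. f t - (\<Sum>i<n. a i * t ^ i)) \<in> O[nhds 0](\<lambda>t. t ^ n)"
  obtains r where "smooth r" "\<And>t. f t = (\<Sum>i<n. a i * t ^ i) + t ^ n * r t"
proof -
  obtain r where r: "smooth r" "\<And>t. f t = (\<Sum>i<n. (deriv ^^ i) f 0 / fact i * t ^ i) + t ^ n * r t"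
    by (rule smooth_Taylor[OF f]) blast
  have "(deriv ^^ i) f 0 / fact i = a i" if "i < n" for i
    by (rule polynomial_bigo_unique[OF smooth_remainder_bigo[OF r] O that])
  then have "(\<Sum>i<n. (deriv ^^ i) f 0 / fact i * t ^ i) = (\<Sum>i<n. a i * t ^ i)" for t
    by (intro sum.cong) auto
  then show ?thesis using r by (intro that[of r]) (simp_all only:)
qed

text \<open>The map c t / (1 + t^2) sends the line into (-c, c) and equals c t up to order 3. Hence
  it only rescales the coefficients of t^4 and t^5, and everything else goes into t^6 u.\<close>

lemma globalise_component:
  fixes f :: "real \<Rightarrow> real"
  assumes f: "open U" "smooth_on U f" and c: "c > 0" "{-c<..<c} \<subseteq> U"
    and z: "(deriv ^^ 1) f 0 = 0" "(deriv ^^ 2) f 0 = 0" "(deriv ^^ 3) f 0 = 0"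
  obtains u where "smooth u" "\<And>t. f (t * (c * inverse (1 + t\<^sup>2)))
     = f 0 + (deriv ^^ 4) f 0 / 24 * c ^ 4 * t ^ 4 + (deriv ^^ 5) f 0 / 120 * c ^ 5 * t ^ 5 + t ^ 6 * u t"
proof -
  define w where "w t = inverse (1 + t\<^sup>2)" for t :: real
  have pos: "1 + t\<^sup>2 > 0" for t :: real by (simp add: add_pos_nonneg)
  have w: "smooth w" unfolding w_def
    by (intro smooth_on_inverse smooth_intros open_UNIV) (metis pos less_irrefl)
  \<comment> \<open>This puts \<open>w\<close> in the form 1 + X with X of order 2, ready for the
    expansion of its powers.\<close>
  have w1: "w t = 1 + - t\<^sup>2 * w t" for t using pos[of t] by (simp add: w_def field_simps)
  define \<phi> where "\<phi> t = t * (c * w t)" for t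
  have \<phi>: "smooth \<phi>" unfolding \<phi>_def by (intro smooth_intros w open_UNIV)
  have "\<phi> t \<in> {-c<..<c}" for t
  proof -
    have "\<bar>t\<bar> < 1 + t\<^sup>2"
    proof -
      have "0 \<le> (\<bar>t\<bar> - 1)\<^sup>2" by simp
      then have "2 * \<bar>t\<bar> \<le> 1 + t\<^sup>2" by (simp add: power2_diff)
      then show ?thesis by (cases "t = 0") auto
    qed
    then have "\<bar>t\<bar> * w t < 1" using pos[of t] by (simp add: w_def field_simps)
    then have "c * (\<bar>t\<bar> * w t) < c * 1" using c by (intro mult_strict_left_mono)
    moreover have "\<bar>\<phi> t\<bar> = c * (\<bar>t\<bar> * w t)"
      using c pos[of t] by (simp add: \<phi>_def abs_mult w_def)
    ultimately show ?thesis by auto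
  qed
  then have "\<phi> ` UNIV \<subseteq> U" using c by auto
  then have f\<phi>: "smooth (\<lambda>t. f (\<phi> t))" by (intro smooth_on_compose_real[OF open_UNIV f \<phi>])
  have U0: "0 \<in> U" using c by auto
  let ?a = "\<lambda>i. (deriv ^^ i) f 0 / fact i"
  have sum6: "(\<Sum>i<6. ?a i * s ^ i) = f 0 + (deriv ^^ 4) f 0 / 24 * s ^ 4 + (deriv ^^ 5) f 0 / 120 * s ^ 5" for s
    using z by (simp add: eval_nat_numeral)
  have "filterlim \<phi> (nhds 0) (nhds 0)"
    using smooth_isCont[OF \<phi>, of 0] unfolding isCont_def tendsto_at_iff_tendsto_nhds by (simp add: \<phi>_def)
  from landau_o.big.compose[OF Taylor_bigo[OF f(1) U0 f(2), of 6] this]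
  have 1: "(\<lambda>t. f (\<phi> t) - (f 0 + (deriv ^^ 4) f 0 / 24 * \<phi> t ^ 4 + (deriv ^^ 5) f 0 / 120 * \<phi> t ^ 5)) \<in> O[nhds 0](\<lambda>t. \<phi> t ^ 6)"
    unfolding sum6 .
  have "(\<lambda>t. \<phi> t ^ 6 - 0) \<in> O[nhds 0](\<lambda>t. t ^ 6)"
  proof (rule smooth_remainder_bigo[of "\<lambda>t. (c * w t) ^ 6"])
    show "smooth (\<lambda>t. (c * w t) ^ 6)" by (intro smooth_intros w open_UNIV)
    show "\<phi> t ^ 6 = 0 + t ^ 6 * (c * w t) ^ 6" for t by (simp add: \<phi>_def power_mult_distrib)
  qed
  then have "(\<lambda>t. \<phi> t ^ 6) \<in> O[nhds 0](\<lambda>t. t ^ 6)" by (simp only: diff_zero)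
  note 2 = landau_o.big_trans[OF 1 this]
  obtain q where q: "\<And>n. smooth (q n)" "\<And>n X. (1 + X) ^ n = 1 + real n * X + X\<^sup>2 * q n X"
    by (rule power_one_plus) blast
  define s where "s n t = - real n * w t + t\<^sup>2 * (w t)\<^sup>2 * q n (- t\<^sup>2 * w t)" for n t
  have s: "smooth (s n)" for n unfolding s_def by (intro smooth_intros smooth_compose[OF q(1)] w open_UNIV)
  have \<phi>n: "\<phi> t ^ n = c ^ n * t ^ n + t ^ n * t\<^sup>2 * c ^ n * s n t" for n t
  proof -
    have "w t ^ n = (1 + - t\<^sup>2 * w t) ^ n" using w1[of t] by simp
    also have "\<dots> = 1 + t\<^sup>2 * s n t" unfolding q(2) s_def by algebra
    finally show ?thesis unfolding \<phi>_def power_mult_distrib by (simp add: algebra_simps)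
  qed
  define A B where "A = (deriv ^^ 4) f 0 / 24" and "B = (deriv ^^ 5) f 0 / 120"
  define v where "v t = A * c ^ 4 * s 4 t + B * t * c ^ 5 * s 5 t" for t
  have v: "smooth v" unfolding v_def by (intro smooth_intros s open_UNIV)
  have "(\<lambda>t. (f 0 + A * \<phi> t ^ 4 + B * \<phi> t ^ 5) - (f 0 + A * c ^ 4 * t ^ 4 + B * c ^ 5 * t ^ 5)) \<in> O[nhds 0](\<lambda>t. t ^ 6)"
  proof (rule smooth_remainder_bigo[OF v])
    show "f 0 + A * \<phi> t ^ 4 + B * \<phi> t ^ 5 = f 0 + A * c ^ 4 * t ^ 4 + B * c ^ 5 * t ^ 5 + t ^ 6 * v t" for t
      unfolding \<phi>n v_def by algebra
  qed
  from sum_in_bigo(1)[OF 2[folded A_def B_def] this]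
  have 3: "(\<lambda>t. f (\<phi> t) - (f 0 + A * c ^ 4 * t ^ 4 + B * c ^ 5 * t ^ 5)) \<in> O[nhds 0](\<lambda>t. t ^ 6)"
    by (simp only: diff_add_cancel add_diff_eq)
  define d where "d i = (if i = 0 then f 0 else if i = 4 then A * c ^ 4 else if i = 5 then B * c ^ 5 else 0)" for i :: nat
  have d: "(\<Sum>i<6. d i * t ^ i) = f 0 + A * c ^ 4 * t ^ 4 + B * c ^ 5 * t ^ 5" for t
    by (simp add: d_def eval_nat_numeral)
  obtain u where "smooth u" "\<And>t. f (\<phi> t) = (\<Sum>i<6. d i * t ^ i) + t ^ 6 * u t"
    by (rule smooth_of_bigo[OF f\<phi> 3[folded d]]) blast
  then show ?thesis by (intro that[of u]) (simp_all add: \<phi>_def w_def d A_def B_def)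
qed

theorem cusp45_A_equiv_normal_form:
  assumes I: "open I" "0 \<in> I" and \<gamma>: "Cr \<infinity> I \<gamma>" and cusp: "cusp45 \<gamma>"
  obtains e where "e \<in> {0, 1, -1}" "A_equiv \<gamma> (\<lambda>t. (t ^ 4, t ^ 5 + e * t ^ 7))"
proof -
  let ?x = "\<lambda>t. fst (\<gamma> t)" and ?y = "\<lambda>t. snd (\<gamma> t)"
  have sm: "smooth_on I ?x" "smooth_on I ?y" using \<gamma> by (simp_all add: Cr_pair_iff smooth_on_def)
  have z: "(deriv ^^ 1) ?x 0 = 0" "(deriv ^^ 2) ?x 0 = 0" "(deriv ^^ 3) ?x 0 = 0"
    "(deriv ^^ 1) ?y 0 = 0" "(deriv ^^ 2) ?y 0 = 0" "(deriv ^^ 3) ?y 0 = 0"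
    using cusp unfolding cusp45_def cder_def prod_eq_iff fst_conv snd_conv by simp_all
  have det: "(deriv ^^ 5) ?x 0 * (deriv ^^ 4) ?y 0 - (deriv ^^ 5) ?y 0 * (deriv ^^ 4) ?x 0 \<noteq> 0"
    using cusp unfolding cusp45_def cder_def det2_def by simp
  obtain c where c: "c > 0" "{-c<..<c} \<subseteq> I"
    using open_contains_ball[THEN iffD1, OF I(1)] I(2) by (auto simp: ball_eq_greaterThanLessThan)
  define w where "w t = c * inverse (1 + t\<^sup>2)" for t :: real
  have pos: "1 + t\<^sup>2 > 0" for t :: real by (simp add: add_pos_nonneg)
  have w: "smooth w" unfolding w_def
    by (intro smooth_intros smooth_on_inverse open_UNIV) (metis pos less_irrefl)
  obtain u where u: "smooth u" "\<And>t. ?x (t * w t) = ?x 0 + (deriv ^^ 4) ?x 0 / 24 * c ^ 4 * t ^ 4 + (deriv ^^ 5) ?x 0 / 120 * c ^ 5 * t ^ 5 + t ^ 6 * u t"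
    unfolding w_def by (rule globalise_component[OF I(1) sm(1) c z(1-3)]) blast
  obtain v where v: "smooth v" "\<And>t. ?y (t * w t) = ?y 0 + (deriv ^^ 4) ?y 0 / 24 * c ^ 4 * t ^ 4 + (deriv ^^ 5) ?y 0 / 120 * c ^ 5 * t ^ 5 + t ^ 6 * v t"
    unfolding w_def by (rule globalise_component[OF I(1) sm(2) c z(4-6)]) blast
  have "A_equiv \<gamma> (\<lambda>t. \<gamma> (t * w t))" by (rule A_equiv_reparam_mult[OF w]) (use c in \<open>simp add: w_def\<close>)
  moreover have "\<gamma> (t * w t) = (?x 0 + (deriv ^^ 4) ?x 0 / 24 * c ^ 4 * t ^ 4 + (deriv ^^ 5) ?x 0 / 120 * c ^ 5 * t ^ 5 + t ^ 6 * u t,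
      ?y 0 + (deriv ^^ 4) ?y 0 / 24 * c ^ 4 * t ^ 4 + (deriv ^^ 5) ?y 0 / 120 * c ^ 5 * t ^ 5 + t ^ 6 * v t)" for t
    unfolding prod_eq_iff fst_conv snd_conv using u(2) v(2) by blast
  ultimately have 0: "A_equiv \<gamma> (\<lambda>t. (?x 0 + (deriv ^^ 4) ?x 0 / 24 * c ^ 4 * t ^ 4 + (deriv ^^ 5) ?x 0 / 120 * c ^ 5 * t ^ 5 + t ^ 6 * u t,
      ?y 0 + (deriv ^^ 4) ?y 0 / 24 * c ^ 4 * t ^ 4 + (deriv ^^ 5) ?y 0 / 120 * c ^ 5 * t ^ 5 + t ^ 6 * v t))"
    by (simp only:)
  \<comment> \<open>Passing from derivatives to Taylor coefficients divides by 4! 5! = 2880, and the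
    dilation contributes c^4 c^5; the sign comes from the order of the columns.\<close>
  have "((deriv ^^ 4) ?x 0 / 24 * c ^ 4) * ((deriv ^^ 5) ?y 0 / 120 * c ^ 5) - ((deriv ^^ 5) ?x 0 / 120 * c ^ 5) * ((deriv ^^ 4) ?y 0 / 24 * c ^ 4)
    = - (c ^ 9 / 2880) * ((deriv ^^ 5) ?x 0 * (deriv ^^ 4) ?y 0 - (deriv ^^ 5) ?y 0 * (deriv ^^ 4) ?x 0)"
    by (simp add: algebra_simps flip: power_add)
  then have d: "((deriv ^^ 4) ?x 0 / 24 * c ^ 4) * ((deriv ^^ 5) ?y 0 / 120 * c ^ 5) - ((deriv ^^ 5) ?x 0 / 120 * c ^ 5) * ((deriv ^^ 4) ?y 0 / 24 * c ^ 4) \<noteq> 0"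
    using det c by simp
  obtain u1 v1 where 1: "smooth u1" "smooth v1"
    "A_equiv (\<lambda>t. (?x 0 + (deriv ^^ 4) ?x 0 / 24 * c ^ 4 * t ^ 4 + (deriv ^^ 5) ?x 0 / 120 * c ^ 5 * t ^ 5 + t ^ 6 * u t,
      ?y 0 + (deriv ^^ 4) ?y 0 / 24 * c ^ 4 * t ^ 4 + (deriv ^^ 5) ?y 0 / 120 * c ^ 5 * t ^ 5 + t ^ 6 * v t))
     (\<lambda>t. (t ^ 4 + t ^ 6 * u1 t, t ^ 5 + t ^ 6 * v1 t))"
    by (rule reduce_tangent[OF u(1) v(1) d]) blast
  obtain u2 v2 where 2: "smooth u2" "smooth v2"
    "A_equiv (\<lambda>t. (t ^ 4 + t ^ 6 * u1 t, t ^ 5 + t ^ 6 * v1 t)) (\<lambda>t. (t ^ 4 + t ^ 6 * u2 t, t ^ 5 + t ^ 7 * v2 t))"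
    by (rule reduce_order6[OF 1(1,2)]) blast
  obtain b u3 v3 where 3: "smooth u3" "smooth v3"
    "A_equiv (\<lambda>t. (t ^ 4 + t ^ 6 * u2 t, t ^ 5 + t ^ 7 * v2 t)) (\<lambda>t. (t ^ 4 + t ^ 8 * u3 t, t ^ 5 + b * t ^ 7 + t ^ 8 * v3 t))"
    by (rule reduce_order7[OF 2(1,2)]) blast
  obtain e u4 v4 where e: "e \<in> {0, 1, -1}" and 4: "smooth u4" "smooth v4"
    "A_equiv (\<lambda>t. (t ^ 4 + t ^ 8 * u3 t, t ^ 5 + b * t ^ 7 + t ^ 8 * v3 t)) (\<lambda>t. (t ^ 4 + t ^ 8 * u4 t, t ^ 5 + e * t ^ 7 + t ^ 8 * v4 t))"
    by (rule reduce_scale[OF 3(1,2)]) blast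
  obtain a' b' u5 v5 where 5: "smooth u5" "smooth v5"
    "A_equiv (\<lambda>t. (t ^ 4 + t ^ 8 * u4 t, t ^ 5 + e * t ^ 7 + t ^ 8 * v4 t))
       (\<lambda>t. (t ^ 4 + a' * t ^ 11 + t ^ 12 * u5 t, t ^ 5 + e * t ^ 7 + b' * t ^ 11 + t ^ 12 * v5 t))"
    by (rule reduce_quadratic[OF 4(1,2)]) blast
  obtain u6 v6 where 6: "smooth u6" "smooth v6"
    "A_equiv (\<lambda>t. (t ^ 4 + a' * t ^ 11 + t ^ 12 * u5 t, t ^ 5 + e * t ^ 7 + b' * t ^ 11 + t ^ 12 * v5 t))
       (\<lambda>t. (t ^ 4 + t ^ 12 * u6 t, t ^ 5 + e * t ^ 7 + t ^ 12 * v6 t))"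
    by (rule reduce_order11[OF 5(1,2)]) blast
  have "\<bar>e\<bar> \<le> 1" using e by auto
  note 7 = determinacy[OF 6(1,2) this]
  show ?thesis
    by (rule that[OF e]) (rule A_equiv_trans[OF 0] A_equiv_trans[OF 1(3)] A_equiv_trans[OF 2(3)] A_equiv_trans[OF 3(3)]
      A_equiv_trans[OF 4(3)] A_equiv_trans[OF 5(3)] A_equiv_trans[OF 6(3)] 7)+
qed


section \<open>The 7-jet of a curve equivalent to a normal form\<close>

lemma bigo_power:
  fixes f :: "real \<Rightarrow> real"
  assumes "f \<in> O[nhds 0](\<lambda>t. t ^ m)"
  shows "(\<lambda>t. f t ^ n) \<in> O[nhds 0](\<lambda>t. t ^ (m * n))"
proof (induction n)
  case 0
  show ?case unfolding power_0 mult_0_right by (rule landau_o.big_refl)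
next
  case (Suc n)
  from landau_o.big.mult[OF assms Suc] show ?case by (simp only: power_Suc power_add mult_Suc_right)
qed

lemma bigo_mult_power:
  fixes f g :: "real \<Rightarrow> real"
  assumes "f \<in> O[nhds 0](\<lambda>t. t ^ m)" "g \<in> O[nhds 0](\<lambda>t. t ^ n)"
  shows "(\<lambda>t. f t * g t) \<in> O[nhds 0](\<lambda>t. t ^ (m + n))"
  using landau_o.big.mult[OF assms] by (simp only: power_add)

text \<open>Every factor beyond the first raises the order of the error by one. A parameter change
  known modulo t^5 is therefore enough for its fourth power modulo t^8.\<close>

lemma bigo_power_diff:
  fixes f p :: "real \<Rightarrow> real"
  assumes "f \<in> O[nhds 0](\<lambda>t. t ^ 1)" "p \<in> O[nhds 0](\<lambda>t. t ^ 1)" "(\<lambda>t. f t - p t) \<in> O[nhds 0](\<lambda>t. t ^ k)"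
  shows "(\<lambda>t. f t ^ Suc n - p t ^ Suc n) \<in> O[nhds 0](\<lambda>t. t ^ (k + n))"
proof (induction n)
  case 0
  then show ?case using assms(3) by (simp only: power_Suc power_0 mult_1_right add_0_right)
next
  case (Suc n)
  have "(\<lambda>t. f t * (f t ^ Suc n - p t ^ Suc n)) \<in> O[nhds 0](\<lambda>t. t ^ (1 + (k + n)))"
    by (rule bigo_mult_power[OF assms(1) Suc])
  moreover have "(\<lambda>t. (f t - p t) * p t ^ Suc n) \<in> O[nhds 0](\<lambda>t. t ^ (k + 1 * Suc n))"
    by (rule bigo_mult_power[OF assms(3) bigo_power[OF assms(2)]])
  moreover have "1 + (k + n) = k + Suc n" "k + 1 * Suc n = k + Suc n" by simp_all
  ultimately have "(\<lambda>t. f t * (f t ^ Suc n - p t ^ Suc n) + (f t - p t) * p t ^ Suc n) \<in> O[nhds 0](\<lambda>t. t ^ (k + Suc n))"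
    by (simp only: sum_in_bigo)
  moreover have "(\<lambda>t. f t * (f t ^ Suc n - p t ^ Suc n) + (f t - p t) * p t ^ Suc n) = (\<lambda>t. f t ^ Suc (Suc n) - p t ^ Suc (Suc n))"
    by (simp add: fun_eq_iff algebra_simps)
  ultimately show ?case by (simp only:)
qed

lemma bigo_mono_power:
  fixes f :: "real \<Rightarrow> real"
  assumes "f \<in> O[nhds 0](\<lambda>t. t ^ n)" "m \<le> n"
  shows "f \<in> O[nhds 0](\<lambda>t. t ^ m)"
  by (rule landau_o.big_trans[OF assms(1) power_bigo_mono[OF assms(2)]])

lemma bigo_const_mult:
  fixes f :: "real \<Rightarrow> real"
  assumes "f \<in> O[nhds 0](\<lambda>t. t ^ n)"
  shows "(\<lambda>t. c * f t) \<in> O[nhds 0](\<lambda>t. t ^ n)"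
  using bigo_mult_power[of "\<lambda>t. c" 0 f n] continuous_bigo_1[of "\<lambda>t. c"] assms
  by (simp only: power_0 continuous_const add_0)

lemma smooth_on_pder: "smooth_on V f \<Longrightarrow> b \<in> Basis \<Longrightarrow> smooth_on V (pder b f)"
  unfolding smooth_on_def using Ck_Suc_pder by blast

section \<open>Plane maps along a curve of order four\<close>

lemma bigo_compose_first_order:
  fixes S :: "real \<times> real \<Rightarrow> real"
  assumes V: "open V" "(0,0) \<in> V" "smooth_on V S"
    and lim: "((\<lambda>t. (X t, Y t)) \<longlongrightarrow> (0,0)) (nhds 0)"
    and O: "X \<in> O[nhds 0](\<lambda>t. t ^ n)" "Y \<in> O[nhds 0](\<lambda>t. t ^ n)"
  shows "(\<lambda>t. S (X t, Y t) - S (0,0)) \<in> O[nhds 0](\<lambda>t. t ^ n)"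
proof -
  obtain a b where der: "(S has_derivative (\<lambda>h. a * fst h + b * snd h)) (at (0,0))"
    using smooth_on_differentiable2[OF V] by blast
  then obtain d where d: "d > 0" "\<And>z. norm (z - (0,0)) < d \<Longrightarrow>
      norm (S z - S (0,0) - (a * fst (z - (0,0)) + b * snd (z - (0,0)))) \<le> 1 * norm (z - (0,0))"
    unfolding has_derivative_at_alt using zero_less_one by blast
  obtain C1 where C1: "C1 > 0" "\<forall>\<^sub>F t in nhds 0. norm (X t) \<le> C1 * norm (t ^ n)" using landau_o.bigE[OF O(1)] by blast
  obtain C2 where C2: "C2 > 0" "\<forall>\<^sub>F t in nhds 0. norm (Y t) \<le> C2 * norm (t ^ n)" using landau_o.bigE[OF O(2)] by blast
  define K where "K = (\<bar>a\<bar> + 1) * C1 + (\<bar>b\<bar> + 1) * C2"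
  have K: "K > 0" unfolding K_def using C1(1) C2(1)
    by (intro add_pos_pos[OF mult_pos_pos mult_pos_pos]) linarith+
  have "\<forall>\<^sub>F t in nhds 0. dist (X t, Y t) (0,0) < d" using tendstoD[OF lim d(1)] .
  with C1(2) C2(2) have "\<forall>\<^sub>F t in nhds 0. norm (S (X t, Y t) - S (0,0)) \<le> K * norm (t ^ n)"
  proof eventually_elim
    case (elim t)
    have "\<bar>S (X t, Y t) - S (0,0) - (a * X t + b * Y t)\<bar> \<le> norm (X t, Y t)"
      using d(2)[of "(X t, Y t)"] elim(3) by (simp add: dist_norm)
    also have "\<dots> \<le> \<bar>X t\<bar> + \<bar>Y t\<bar>" using norm_Pair_le[of "X t" "Y t"] by simp
    finally have h: "\<bar>S (X t, Y t) - S (0,0) - (a * X t + b * Y t)\<bar> \<le> \<bar>X t\<bar> + \<bar>Y t\<bar>" .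
    have tri: "\<bar>x\<bar> \<le> \<bar>x - (u + v)\<bar> + \<bar>u\<bar> + \<bar>v\<bar>" for x u v :: real by linarith
    have "\<bar>S (X t, Y t) - S (0,0)\<bar> \<le> \<bar>S (X t, Y t) - S (0,0) - (a * X t + b * Y t)\<bar> + \<bar>a * X t\<bar> + \<bar>b * Y t\<bar>"
      by (rule tri)
    also have "\<dots> \<le> \<bar>X t\<bar> + \<bar>Y t\<bar> + \<bar>a * X t\<bar> + \<bar>b * Y t\<bar>" using h by (intro add_right_mono)
    also have "\<dots> = (\<bar>a\<bar> + 1) * \<bar>X t\<bar> + (\<bar>b\<bar> + 1) * \<bar>Y t\<bar>" by (simp add: abs_mult algebra_simps)
    also have "\<dots> \<le> (\<bar>a\<bar> + 1) * (C1 * norm (t ^ n)) + (\<bar>b\<bar> + 1) * (C2 * norm (t ^ n))"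
      using elim by (intro add_mono mult_left_mono) auto
    finally show ?case by (simp add: K_def algebra_simps)
  qed
  then show ?thesis by (rule landau_o.bigI[OF K])
qed

text \<open>Differentiating the remainder along the curve gives (P1 - P1(0,0)) X' + (P2 - P2(0,0))
  Y', of order 4 + 3, and integration yields order 8. First-order estimates for the partial
  derivatives thus replace a second-order Taylor formula in two variables.\<close>

lemma bigo_compose_second_order:
  fixes P :: "real \<times> real \<Rightarrow> real"
  assumes V: "open V" "(0,0) \<in> V" "smooth_on V P"
    and W: "open W" "0 \<in> W"
    and der: "\<And>t. t \<in> W \<Longrightarrow> (X has_real_derivative X' t) (at t)" "\<And>t. t \<in> W \<Longrightarrow> (Y has_real_derivative Y' t) (at t)"
    and z: "X 0 = 0" "Y 0 = 0"
    and O: "X \<in> O[nhds 0](\<lambda>t. t ^ 4)" "Y \<in> O[nhds 0](\<lambda>t. t ^ 4)" "X' \<in> O[nhds 0](\<lambda>t. t ^ 3)" "Y' \<in> O[nhds 0](\<lambda>t. t ^ 3)"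
  shows "(\<lambda>t. P (X t, Y t) - (P (0,0) + pder (1,0) P (0,0) * X t + pder (0,1) P (0,0) * Y t)) \<in> O[nhds 0](\<lambda>t. t ^ 8)"
proof -
  define P1 P2 where "P1 = pder (1,0) P" and "P2 = pder (0,1) P"
  have sm: "smooth_on V P1" "smooth_on V P2"
    unfolding P1_def P2_def by (rule smooth_on_pder[OF V(3)], simp add: Basis_real2)+
  have cont: "continuous_on W (\<lambda>t. (X t, Y t))"
    by (intro continuous_on_Pair continuous_at_imp_continuous_on ballI DERIV_isCont[OF der(1)] DERIV_isCont[OF der(2)])
  define W' where "W' = W \<inter> (\<lambda>t. (X t, Y t)) -` V"
  have W': "open W'" "0 \<in> W'" unfolding W'_def using W V z by (auto intro: continuous_open_preimage[OF cont])
  have "isCont (\<lambda>t. (X t, Y t)) 0" using cont W by (simp add: continuous_on_eq_continuous_at)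
  then have lim: "((\<lambda>t. (X t, Y t)) \<longlongrightarrow> (0,0)) (nhds 0)"
    using tendsto_at_iff_tendsto_nhds[of "\<lambda>t. (X t, Y t)" 0] z by (simp add: isCont_def)
  have "(\<lambda>t. P (X t, Y t) - (P (0,0) + P1 (0,0) * X t + P2 (0,0) * Y t)) \<in> O[nhds 0](\<lambda>t. t ^ Suc 7)"
  proof (rule bigo_integrate[OF W'])
    fix t assume "t \<in> W'"
    then have t: "t \<in> W" "(X t, Y t) \<in> V" by (auto simp: W'_def)
    have "((\<lambda>t. (X t, Y t)) has_derivative (\<lambda>s. (X' t * s, Y' t * s))) (at t)"
      using der(1)[OF t(1)] der(2)[OF t(1)] unfolding has_field_derivative_def by (rule has_derivative_Pair)
    from has_derivative_compose[OF this smooth_on_differentiable2[OF V(1) t(2) V(3)]]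
    have "((\<lambda>t. P (X t, Y t)) has_real_derivative P1 (X t, Y t) * X' t + P2 (X t, Y t) * Y' t) (at t)"
      unfolding has_field_derivative_def P1_def P2_def fst_conv snd_conv
      by (rule has_derivative_eq_rhs) (simp add: fun_eq_iff algebra_simps)
    then show "((\<lambda>t. P (X t, Y t) - (P (0,0) + P1 (0,0) * X t + P2 (0,0) * Y t)) has_real_derivative
      (P1 (X t, Y t) - P1 (0,0)) * X' t + (P2 (X t, Y t) - P2 (0,0)) * Y' t) (at t)"
      using der(1)[OF t(1)] der(2)[OF t(1)] by (auto intro!: derivative_eq_intros simp: algebra_simps)
  next
    show "P (X 0, Y 0) - (P (0,0) + P1 (0,0) * X 0 + P2 (0,0) * Y 0) = 0" using z by simp
    have "(\<lambda>t. (P1 (X t, Y t) - P1 (0,0)) * X' t + (P2 (X t, Y t) - P2 (0,0)) * Y' t) \<in> O[nhds 0](\<lambda>t. t ^ (4 + 3))"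
      by (intro sum_in_bigo bigo_mult_power bigo_compose_first_order[OF V(1,2) _ lim O(1,2)] sm O)
    then show "(\<lambda>t. (P1 (X t, Y t) - P1 (0,0)) * X' t + (P2 (X t, Y t) - P2 (0,0)) * Y' t) \<in> O[nhds 0](\<lambda>t. t ^ 7)"
      by simp
  qed
  then show ?thesis unfolding P1_def P2_def by simp
qed

text \<open>After a factor t is taken out of the quartic, its cofactor Q enters as Q^4 modulo t^4,
  Q^5 modulo t^3 and Q^7 modulo t. The remainders are explicit polynomials, so that smoothness and
  the identity can both be checked directly.\<close>

lemma quartic_power_expansion:
  fixes c1 c2 c3 c4 e p q :: real
  obtains s where "smooth s" "\<And>t. p * (c1 * t + c2 * t\<^sup>2 + c3 * t ^ 3 + c4 * t ^ 4) ^ 4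
      + q * ((c1 * t + c2 * t\<^sup>2 + c3 * t ^ 3 + c4 * t ^ 4) ^ 5 + e * (c1 * t + c2 * t\<^sup>2 + c3 * t ^ 3 + c4 * t ^ 4) ^ 7)
    = p * c1 ^ 4 * t ^ 4 + (p * (4 * c1 ^ 3 * c2) + q * c1 ^ 5) * t ^ 5
      + (p * (4 * c1 ^ 3 * c3 + 6 * c1\<^sup>2 * c2\<^sup>2) + q * (5 * c1 ^ 4 * c2)) * t ^ 6
      + (p * (4 * c1 ^ 3 * c4 + 12 * c1\<^sup>2 * c2 * c3 + 4 * c1 * c2 ^ 3) + q * (5 * c1 ^ 4 * c3 + 10 * c1 ^ 3 * c2\<^sup>2 + e * c1 ^ 7)) * t ^ 7
      + t ^ 8 * s t"
proof -
  define A B where "A t = c1 + c2 * t" and "B t = c3 + c4 * t" for t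
  define Q where "Q t = A t + t\<^sup>2 * B t" for t
  define s4 where "s4 t = c2 ^ 4 + 4 * (3 * c1\<^sup>2 * c2 * c4 + (3 * c1 * c2\<^sup>2 + c2 ^ 3 * t) * B t)
    + 6 * (A t)\<^sup>2 * (B t)\<^sup>2 + 4 * t\<^sup>2 * A t * B t ^ 3 + t ^ 4 * B t ^ 4" for t
  define r4 where "r4 t = 4 * c1 ^ 3 * c2 + 6 * c1\<^sup>2 * c2\<^sup>2 * t + 4 * c1 * c2 ^ 3 * t\<^sup>2 + c2 ^ 4 * t ^ 3" for t
  define s5 where "s5 t = 10 * c1\<^sup>2 * c2 ^ 3 + 5 * c1 * c2 ^ 4 * t + c2 ^ 5 * t\<^sup>2 + 5 * (c1 ^ 4 * c4 + r4 t * B t)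
    + t * (10 * A t ^ 3 * (B t)\<^sup>2 + 10 * (A t)\<^sup>2 * t\<^sup>2 * B t ^ 3 + 5 * A t * t ^ 4 * B t ^ 4 + t ^ 6 * B t ^ 5)" for t
  \<comment> \<open>The factorisation of Q^7 - c1^7 by Q - c1, where Q - c1 is itself t times c2 + t
    B.\<close>
  define s7 where "s7 t = (c2 + t * B t) * (Q t ^ 6 + Q t ^ 5 * c1 + Q t ^ 4 * c1\<^sup>2 + Q t ^ 3 * c1 ^ 3 + (Q t)\<^sup>2 * c1 ^ 4 + Q t * c1 ^ 5 + c1 ^ 6)" for t
  have Q4: "Q t ^ 4 = c1 ^ 4 + 4 * c1 ^ 3 * c2 * t + (4 * c1 ^ 3 * c3 + 6 * c1\<^sup>2 * c2\<^sup>2) * t\<^sup>2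
      + (4 * c1 ^ 3 * c4 + 12 * c1\<^sup>2 * c2 * c3 + 4 * c1 * c2 ^ 3) * t ^ 3 + t ^ 4 * s4 t" for t
    unfolding Q_def s4_def A_def B_def by algebra
  have Q5: "Q t ^ 5 = c1 ^ 5 + 5 * c1 ^ 4 * c2 * t + (5 * c1 ^ 4 * c3 + 10 * c1 ^ 3 * c2\<^sup>2) * t\<^sup>2 + t ^ 3 * s5 t" for t
    unfolding Q_def s5_def r4_def A_def B_def by algebra
  have Q7: "Q t ^ 7 = c1 ^ 7 + t * s7 t" for t
  proof -
    have "t * (c2 + t * B t) = Q t - c1" unfolding Q_def A_def by algebra
    then show ?thesis unfolding s7_def by algebra
  qed
  have tQ: "c1 * t + c2 * t\<^sup>2 + c3 * t ^ 3 + c4 * t ^ 4 = t * Q t" for t unfolding Q_def A_def B_def by algebra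
  define s where "s t = p * s4 t + q * (s5 t + e * s7 t)" for t
  show ?thesis
  proof (rule that[of s])
    show "smooth s" unfolding s_def s4_def s5_def s7_def r4_def Q_def A_def B_def by (intro smooth_intros open_UNIV)
    show "p * (c1 * t + c2 * t\<^sup>2 + c3 * t ^ 3 + c4 * t ^ 4) ^ 4
      + q * ((c1 * t + c2 * t\<^sup>2 + c3 * t ^ 3 + c4 * t ^ 4) ^ 5 + e * (c1 * t + c2 * t\<^sup>2 + c3 * t ^ 3 + c4 * t ^ 4) ^ 7)
    = p * c1 ^ 4 * t ^ 4 + (p * (4 * c1 ^ 3 * c2) + q * c1 ^ 5) * t ^ 5
      + (p * (4 * c1 ^ 3 * c3 + 6 * c1\<^sup>2 * c2\<^sup>2) + q * (5 * c1 ^ 4 * c2)) * t ^ 6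
      + (p * (4 * c1 ^ 3 * c4 + 12 * c1\<^sup>2 * c2 * c3 + 4 * c1 * c2 ^ 3) + q * (5 * c1 ^ 4 * c3 + 10 * c1 ^ 3 * c2\<^sup>2 + e * c1 ^ 7)) * t ^ 7
      + t ^ 8 * s t" for t
      unfolding tQ power_mult_distrib Q4 Q5 Q7 s_def by algebra
  qed
qed

text \<open>\<open>P\<close> is a component of the plane diffeomorphism and \<open>\<phi>\<close>
  the parameter change. On the curve the nonlinear part of \<open>P\<close> has order 8, and
  replacing \<open>\<phi>\<close> by its 4-jet is an error of order 8 as well, so p, q and c1, ...,
  c4 determine the 7-jet up to the value at 0.\<close>

lemma component_jet:
  fixes P :: "real \<times> real \<Rightarrow> real" and \<phi> f :: "real \<Rightarrow> real"
  assumes V: "open V" "(0,0) \<in> V" "smooth_on V P"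
    and W: "open W" "0 \<in> W" "smooth_on W \<phi>" "\<phi> 0 = 0"
    and I: "open I" "0 \<in> I" "smooth_on I f"
    and f: "\<forall>\<^sub>F t in nhds 0. P (\<phi> t ^ 4, \<phi> t ^ 5 + e * \<phi> t ^ 7) = f t"
    and pq: "p = pder (1,0) P (0,0)" "q = pder (0,1) P (0,0)"
    and c: "c1 = deriv \<phi> 0" "c2 = (deriv ^^ 2) \<phi> 0 / 2" "c3 = (deriv ^^ 3) \<phi> 0 / 6" "c4 = (deriv ^^ 4) \<phi> 0 / 24"
  shows "(deriv ^^ 1) f 0 = 0" "(deriv ^^ 2) f 0 = 0" "(deriv ^^ 3) f 0 = 0"
    "(deriv ^^ 4) f 0 = 24 * (p * c1 ^ 4)"
    "(deriv ^^ 5) f 0 = 120 * (p * (4 * c1 ^ 3 * c2) + q * c1 ^ 5)"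
    "(deriv ^^ 6) f 0 = 720 * (p * (4 * c1 ^ 3 * c3 + 6 * c1\<^sup>2 * c2\<^sup>2) + q * (5 * c1 ^ 4 * c2))"
    "(deriv ^^ 7) f 0 = 5040 * (p * (4 * c1 ^ 3 * c4 + 12 * c1\<^sup>2 * c2 * c3 + 4 * c1 * c2 ^ 3)
       + q * (5 * c1 ^ 4 * c3 + 10 * c1 ^ 3 * c2\<^sup>2 + e * c1 ^ 7))"
proof -
  define r where "r t = c1 * t + c2 * t\<^sup>2 + c3 * t ^ 3 + c4 * t ^ 4" for t
  have "(\<Sum>i<5. (deriv ^^ i) \<phi> 0 / fact i * t ^ i) = r t" for t
    unfolding r_def c using W(4) by (simp add: eval_nat_numeral)
  then have \<phi>r: "(\<lambda>t. \<phi> t - r t) \<in> O[nhds 0](\<lambda>t. t ^ 5)"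
    using Taylor_bigo[OF W(1-3), of 5] by (simp only:)
  have "smooth (\<lambda>t. c1 + c2 * t + c3 * t\<^sup>2 + c4 * t ^ 3)" by (intro smooth_intros open_UNIV)
  then have "(\<lambda>t. r t - 0) \<in> O[nhds 0](\<lambda>t. t ^ 1)"
    by (rule smooth_remainder_bigo) (simp add: r_def algebra_simps eval_nat_numeral)
  then have rO: "r \<in> O[nhds 0](\<lambda>t. t ^ 1)" by (simp only: diff_zero)
  have "(\<lambda>t. (\<phi> t - r t) + r t) \<in> O[nhds 0](\<lambda>t. t ^ 1)"
    by (intro sum_in_bigo bigo_mono_power[OF \<phi>r] rO) simp
  then have \<phi>O: "\<phi> \<in> O[nhds 0](\<lambda>t. t ^ 1)" by (simp only: diff_add_cancel)
  have "isCont (deriv \<phi>) 0"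
    using smooth_on_continuous[OF smooth_on_deriv[OF W(3)]] W(1,2) by (simp add: continuous_on_eq_continuous_at)
  from continuous_bigo_1[OF this] have \<phi>'O: "deriv \<phi> \<in> O[nhds 0](\<lambda>t. t ^ 0)" by (simp only: power_0)
  have pw: "(\<lambda>t. \<phi> t ^ n) \<in> O[nhds 0](\<lambda>t. t ^ m)" if "m \<le> n" for m n
    using bigo_mono_power[OF bigo_power[OF \<phi>O, of n]] that by simp
  define X Y where "X t = \<phi> t ^ 4" and "Y t = \<phi> t ^ 5 + e * \<phi> t ^ 7" for t
  define X' Y' where "X' t = (4 * \<phi> t ^ 3) * deriv \<phi> t" and "Y' t = (5 * \<phi> t ^ 4 + (e * 7) * \<phi> t ^ 6) * deriv \<phi> t" for t
  have "(\<lambda>t. P (X t, Y t) - (P (0,0) + pder (1,0) P (0,0) * X t + pder (0,1) P (0,0) * Y t)) \<in> O[nhds 0](\<lambda>t. t ^ 8)"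
  proof (rule bigo_compose_second_order[OF V W(1,2), of X X' Y Y'])
    show "X \<in> O[nhds 0](\<lambda>t. t ^ 4)" unfolding X_def by (rule pw) simp
    show "Y \<in> O[nhds 0](\<lambda>t. t ^ 4)" unfolding Y_def by (intro sum_in_bigo bigo_const_mult pw) simp_all
    have "X' \<in> O[nhds 0](\<lambda>t. t ^ (3 + 0))" "Y' \<in> O[nhds 0](\<lambda>t. t ^ (3 + 0))"
      unfolding X'_def Y'_def by (intro sum_in_bigo bigo_mult_power bigo_const_mult pw \<phi>'O; simp)+
    then show "X' \<in> O[nhds 0](\<lambda>t. t ^ 3)" "Y' \<in> O[nhds 0](\<lambda>t. t ^ 3)" by simp_all
    fix t assume "t \<in> W"
    note d = smooth_on_has_derivative[OF W(3) this]
    show "(X has_real_derivative X' t) (at t)" unfolding X_def X'_def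
      by (auto intro!: derivative_eq_intros d)
    show "(Y has_real_derivative Y' t) (at t)" unfolding Y_def Y'_def
      by (auto intro!: derivative_eq_intros d simp: algebra_simps)
  qed (simp_all add: X_def Y_def W(4))
  then have 1: "(\<lambda>t. P (X t, Y t) - (P (0,0) + p * X t + q * Y t)) \<in> O[nhds 0](\<lambda>t. t ^ 8)"
    unfolding pq .
  \<comment> \<open>The error 5 of \<open>\<phi> - r\<close> grows to 5 + n, which is at least 8
    exactly from the fourth power on.\<close>
  have d: "(\<lambda>t. \<phi> t ^ Suc n - r t ^ Suc n) \<in> O[nhds 0](\<lambda>t. t ^ 8)" if "n \<ge> 3" for n
    by (rule bigo_mono_power[OF bigo_power_diff[OF \<phi>O rO \<phi>r]]) (use that in simp)
  have "(\<lambda>t. p * (\<phi> t ^ Suc 3 - r t ^ Suc 3) + (q * (\<phi> t ^ Suc 4 - r t ^ Suc 4) + (q * e) * (\<phi> t ^ Suc 6 - r t ^ Suc 6))) \<in> O[nhds 0](\<lambda>t. t ^ 8)"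
    by (intro sum_in_bigo(1) bigo_const_mult d) simp_all
  moreover have "(\<lambda>t. p * (\<phi> t ^ Suc 3 - r t ^ Suc 3) + (q * (\<phi> t ^ Suc 4 - r t ^ Suc 4) + (q * e) * (\<phi> t ^ Suc 6 - r t ^ Suc 6)))
     = (\<lambda>t. (P (0,0) + p * X t + q * Y t) - (P (0,0) + (p * r t ^ 4 + q * (r t ^ 5 + e * r t ^ 7))))"
    unfolding X_def Y_def by (simp add: fun_eq_iff algebra_simps)
  ultimately have 2: "(\<lambda>t. (P (0,0) + p * X t + q * Y t) - (P (0,0) + (p * r t ^ 4 + q * (r t ^ 5 + e * r t ^ 7)))) \<in> O[nhds 0](\<lambda>t. t ^ 8)"
    by (simp only:)
  define m4 m5 m6 m7 where m: "m4 = p * c1 ^ 4" "m5 = p * (4 * c1 ^ 3 * c2) + q * c1 ^ 5"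
    "m6 = p * (4 * c1 ^ 3 * c3 + 6 * c1\<^sup>2 * c2\<^sup>2) + q * (5 * c1 ^ 4 * c2)"
    "m7 = p * (4 * c1 ^ 3 * c4 + 12 * c1\<^sup>2 * c2 * c3 + 4 * c1 * c2 ^ 3) + q * (5 * c1 ^ 4 * c3 + 10 * c1 ^ 3 * c2\<^sup>2 + e * c1 ^ 7)"
  obtain s where s: "smooth s" "\<And>t. p * r t ^ 4 + q * (r t ^ 5 + e * r t ^ 7) = m4 * t ^ 4 + m5 * t ^ 5 + m6 * t ^ 6 + m7 * t ^ 7 + t ^ 8 * s t"
    unfolding r_def m by (rule quartic_power_expansion) blast
  have 3: "(\<lambda>t. (P (0,0) + (p * r t ^ 4 + q * (r t ^ 5 + e * r t ^ 7))) - (P (0,0) + m4 * t ^ 4 + m5 * t ^ 5 + m6 * t ^ 6 + m7 * t ^ 7)) \<in> O[nhds 0](\<lambda>t. t ^ 8)"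
    by (rule smooth_remainder_bigo[OF s(1)]) (simp add: s(2))
  define a where "a i = (if i = 0 then P (0,0) else if i = 4 then m4 else if i = 5 then m5 else if i = 6 then m6 else if i = 7 then m7 else 0)" for i :: nat
  have a: "(\<Sum>i<8. a i * t ^ i) = P (0,0) + m4 * t ^ 4 + m5 * t ^ 5 + m6 * t ^ 6 + m7 * t ^ 7" for t
    by (simp add: a_def eval_nat_numeral)
  have "(\<lambda>t. P (X t, Y t) - (\<Sum>i<8. a i * t ^ i)) \<in> O[nhds 0](\<lambda>t. t ^ 8)"
    using sum_in_bigo(1)[OF 1 sum_in_bigo(1)[OF 2 3]] unfolding a by (simp add: algebra_simps)
  then have 4: "(\<lambda>t. f t - (\<Sum>i<8. a i * t ^ i)) \<in> O[nhds 0](\<lambda>t. t ^ 8)"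
    by (rule landau_o.big.in_cong[THEN iffD1, rotated]) (use f in \<open>auto simp: X_def Y_def elim: eventually_mono\<close>)
  have der: "(deriv ^^ i) f 0 = fact i * a i" if "i < 8" for i
    using polynomial_bigo_unique[OF Taylor_bigo[OF I, of 8] 4 that] by (simp add: field_simps)
  have av: "a 1 = 0" "a 2 = 0" "a 3 = 0" "a 4 = m4" "a 5 = m5" "a 6 = m6" "a 7 = m7" by (simp_all add: a_def)
  have fv: "fact 4 = (24::real)" "fact 5 = (120::real)" "fact 6 = (720::real)" "fact 7 = (5040::real)"
    by (simp_all add: fact_numeral)
  have d: "(deriv ^^ 1) f 0 = fact 1 * a 1" "(deriv ^^ 2) f 0 = fact 2 * a 2" "(deriv ^^ 3) f 0 = fact 3 * a 3"
    "(deriv ^^ 4) f 0 = fact 4 * a 4" "(deriv ^^ 5) f 0 = fact 5 * a 5"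
    "(deriv ^^ 6) f 0 = fact 6 * a 6" "(deriv ^^ 7) f 0 = fact 7 * a 7"
    by (rule der, simp)+
  show "(deriv ^^ 1) f 0 = 0" "(deriv ^^ 2) f 0 = 0" "(deriv ^^ 3) f 0 = 0"
    "(deriv ^^ 4) f 0 = 24 * (p * c1 ^ 4)"
    "(deriv ^^ 5) f 0 = 120 * (p * (4 * c1 ^ 3 * c2) + q * c1 ^ 5)"
    "(deriv ^^ 6) f 0 = 720 * (p * (4 * c1 ^ 3 * c3 + 6 * c1\<^sup>2 * c2\<^sup>2) + q * (5 * c1 ^ 4 * c2))"
    "(deriv ^^ 7) f 0 = 5040 * (p * (4 * c1 ^ 3 * c4 + 12 * c1\<^sup>2 * c2 * c3 + 4 * c1 * c2 ^ 3)
       + q * (5 * c1 ^ 4 * c3 + 10 * c1 ^ 3 * c2\<^sup>2 + e * c1 ^ 7))"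
    unfolding d av fv m mult_zero_right by (rule refl)+
qed


section \<open>Invariance of the sign of the cuspidal curvature\<close>

lemma diffeo_real_deriv_nonzero:
  fixes \<psi> :: "real \<Rightarrow> real"
  assumes d: "Cr_diffeo \<infinity> U \<psi>" and x: "x \<in> U"
  shows "deriv (inv_into U \<psi>) (\<psi> x) \<noteq> 0"
proof -
  have o: "open U" "open (\<psi> ` U)" "inj_on \<psi> U" and sm: "smooth_on U \<psi>" "smooth_on (\<psi> ` U) (inv_into U \<psi>)"
    using d by (auto simp: Cr_diffeo_def Cr_real_iff smooth_on_def)
  have 1: "(inv_into U \<psi> has_real_derivative deriv (inv_into U \<psi>) (\<psi> x)) (at (\<psi> x))"
    using smooth_on_has_derivative[OF sm(2)] x by blast
  have 2: "(\<psi> has_real_derivative deriv \<psi> x) (at x)" using smooth_on_has_derivative[OF sm(1) x] .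
  have "((\<lambda>s. inv_into U \<psi> (\<psi> s)) has_real_derivative deriv (inv_into U \<psi>) (\<psi> x) * deriv \<psi> x) (at x)"
    by (rule DERIV_chain2[OF 1 2])
  then have "((\<lambda>s. s) has_real_derivative deriv (inv_into U \<psi>) (\<psi> x) * deriv \<psi> x) (at x)"
    by (rule has_field_derivative_transform_within_open[OF _ o(1) x]) (use o in simp)
  from DERIV_unique[OF this DERIV_ident] show ?thesis by auto
qed

text \<open>The chain rule for the smooth inverse makes the product of the two Jacobian determinants
  equal to 1.\<close>

lemma diffeo_real2_jacobian_nonzero:
  fixes \<Psi> :: "real \<times> real \<Rightarrow> real \<times> real"
  assumes d: "Cr_diffeo \<infinity> V \<Psi>" and z: "z \<in> V"
  shows "pder (1,0) (\<lambda>z. fst (\<Psi> z)) z * pder (0,1) (\<lambda>z. snd (\<Psi> z)) z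
    - pder (0,1) (\<lambda>z. fst (\<Psi> z)) z * pder (1,0) (\<lambda>z. snd (\<Psi> z)) z \<noteq> 0"
proof -
  let ?T = "inv_into V \<Psi>"
  have o: "open V" "open (\<Psi> ` V)" "inj_on \<Psi> V" "\<Psi> z \<in> \<Psi> ` V"
    and sm: "smooth_on V (\<lambda>z. fst (\<Psi> z))" "smooth_on V (\<lambda>z. snd (\<Psi> z))"
      "smooth_on (\<Psi> ` V) (\<lambda>z. fst (?T z))" "smooth_on (\<Psi> ` V) (\<lambda>z. snd (?T z))"
    using d z by (auto simp: Cr_diffeo_def Cr_pair_iff smooth_on_def)
  define p1 q1 p2 q2 where defs: "p1 = pder (1,0) (\<lambda>z. fst (\<Psi> z)) z" "q1 = pder (0,1) (\<lambda>z. fst (\<Psi> z)) z"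
    "p2 = pder (1,0) (\<lambda>z. snd (\<Psi> z)) z" "q2 = pder (0,1) (\<lambda>z. snd (\<Psi> z)) z"
  have "((\<lambda>z. (fst (\<Psi> z), snd (\<Psi> z))) has_derivative (\<lambda>h. (p1 * fst h + q1 * snd h, p2 * fst h + q2 * snd h))) (at z)"
    unfolding defs by (intro has_derivative_Pair smooth_on_differentiable2[OF o(1) z] sm)
  then have D: "(\<Psi> has_derivative (\<lambda>h. (p1 * fst h + q1 * snd h, p2 * fst h + q2 * snd h))) (at z)" by simp
  obtain a b where ab: "((\<lambda>w. fst (?T w)) has_derivative (\<lambda>h. a * fst h + b * snd h)) (at (\<Psi> z))"
    using smooth_on_differentiable2[OF o(2,4) sm(3)] by blast
  obtain c d where cd: "((\<lambda>w. snd (?T w)) has_derivative (\<lambda>h. c * fst h + d * snd h)) (at (\<Psi> z))"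
    using smooth_on_differentiable2[OF o(2,4) sm(4)] by blast
  have "((\<lambda>z. fst (?T (\<Psi> z))) has_derivative (\<lambda>h. a * (p1 * fst h + q1 * snd h) + b * (p2 * fst h + q2 * snd h))) (at z)"
    using has_derivative_compose[OF D ab] by simp
  then have "(fst has_derivative (\<lambda>h. a * (p1 * fst h + q1 * snd h) + b * (p2 * fst h + q2 * snd h))) (at z)"
    by (rule has_derivative_transform_within_open[OF _ o(1) z]) (use o in simp)
  from has_derivative_unique[OF this has_derivative_fst[OF has_derivative_ident]]
  have 1: "a * (p1 * x + q1 * y) + b * (p2 * x + q2 * y) = x" for x y
    by (metis fst_conv snd_conv)
  have "((\<lambda>z. snd (?T (\<Psi> z))) has_derivative (\<lambda>h. c * (p1 * fst h + q1 * snd h) + d * (p2 * fst h + q2 * snd h))) (at z)"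
    using has_derivative_compose[OF D cd] by simp
  then have "(snd has_derivative (\<lambda>h. c * (p1 * fst h + q1 * snd h) + d * (p2 * fst h + q2 * snd h))) (at z)"
    by (rule has_derivative_transform_within_open[OF _ o(1) z]) (use o in simp)
  from has_derivative_unique[OF this has_derivative_snd[OF has_derivative_ident]]
  have 2: "c * (p1 * x + q1 * y) + d * (p2 * x + q2 * y) = y" for x y
    by (metis fst_conv snd_conv)
  have "a * p1 + b * p2 = 1" "a * q1 + b * q2 = 0" "c * p1 + d * p2 = 0" "c * q1 + d * q2 = 1"
    using 1[of 1 0] 1[of 0 1] 2[of 1 0] 2[of 0 1] by simp_all
  then have "(a * d - b * c) * (p1 * q2 - q1 * p2) = 1" by algebra
  then show ?thesis unfolding defs[symmetric] by auto
qed

theorem A_equiv_normal_form_kappa: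
  assumes I: "open I" "0 \<in> I" and \<gamma>: "Cr \<infinity> I \<gamma>" and eq: "A_equiv \<gamma> (\<lambda>t. (t ^ 4, t ^ 5 + e * t ^ 7))"
  shows "cusp45 \<gamma>" and "\<exists>K>0. kappa_q \<gamma> = K * e"
proof -
  let ?g = "\<lambda>t::real. (t ^ 4, t ^ 5 + e * t ^ 7)"
  let ?x = "\<lambda>t. fst (\<gamma> t)" and ?y = "\<lambda>t. snd (\<gamma> t)"
  have sm: "smooth_on I ?x" "smooth_on I ?y" using \<gamma> by (simp_all add: Cr_pair_iff smooth_on_def)
  have "isCont \<gamma> 0" using Cr_continuous[OF \<gamma>] I by (simp add: continuous_on_eq_continuous_at)
  \<comment> \<open>In this direction \<open>\<gamma>\<close> becomes the image of the normal form,
    so its derivatives at 0 can be computed rather than constrained.\<close>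
  then have "Cr_equiv \<infinity> ?g \<gamma>" using Cr_equiv_sym eq unfolding A_equiv_def by blast
  then obtain U \<psi> V \<Psi> where U: "0 \<in> U" "Cr_diffeo \<infinity> U \<psi>" "\<psi> 0 = 0" and V0: "?g 0 \<in> V" "Cr_diffeo \<infinity> V \<Psi>"
    and ev: "\<forall>\<^sub>F s in nhds 0. \<Psi> (?g (inv_into U \<psi> s)) = \<gamma> s"
    unfolding Cr_equiv_def by blast
  define \<phi> where "\<phi> = inv_into U \<psi>"
  have W: "open (\<psi> ` U)" "0 \<in> \<psi> ` U" "smooth_on (\<psi> ` U) \<phi>" "\<phi> 0 = 0"
  proof -
    have inj: "inj_on \<psi> U" using U(2) by (simp add: Cr_diffeo_def)
    show "open (\<psi> ` U)" "smooth_on (\<psi> ` U) \<phi>"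
      using U(2) by (simp_all add: Cr_diffeo_def Cr_real_iff smooth_on_def \<phi>_def)
    show "0 \<in> \<psi> ` U" using U by (metis imageI)
    show "\<phi> 0 = 0" unfolding \<phi>_def using inv_into_f_f[OF inj U(1)] U(3) by simp
  qed
  define c where "c = deriv \<phi> 0"
  have c0: "c \<noteq> 0" using diffeo_real_deriv_nonzero[OF U(2,1)] U(3) by (simp add: c_def \<phi>_def)
  have V: "open V" "(0,0) \<in> V" "smooth_on V (\<lambda>z. fst (\<Psi> z))" "smooth_on V (\<lambda>z. snd (\<Psi> z))"
    using V0 by (simp_all add: Cr_diffeo_def Cr_pair_iff smooth_on_def)
  define p1 q1 p2 q2 where defs: "p1 = pder (1,0) (\<lambda>z. fst (\<Psi> z)) (0,0)" "q1 = pder (0,1) (\<lambda>z. fst (\<Psi> z)) (0,0)"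
    "p2 = pder (1,0) (\<lambda>z. snd (\<Psi> z)) (0,0)" "q2 = pder (0,1) (\<lambda>z. snd (\<Psi> z)) (0,0)"
  define \<Delta> where "\<Delta> = p1 * q2 - q1 * p2"
  have \<Delta>: "\<Delta> \<noteq> 0" using diffeo_real2_jacobian_nonzero[OF V0(2) V(2)] by (simp add: \<Delta>_def defs)
  define c2 c3 c4 where cs: "c2 = (deriv ^^ 2) \<phi> 0 / 2" "c3 = (deriv ^^ 3) \<phi> 0 / 6" "c4 = (deriv ^^ 4) \<phi> 0 / 24"
  have evx: "\<forall>\<^sub>F t in nhds 0. fst (\<Psi> (\<phi> t ^ 4, \<phi> t ^ 5 + e * \<phi> t ^ 7)) = fst (\<gamma> t)"
    and evy: "\<forall>\<^sub>F t in nhds 0. snd (\<Psi> (\<phi> t ^ 4, \<phi> t ^ 5 + e * \<phi> t ^ 7)) = snd (\<gamma> t)"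
    using ev unfolding \<phi>_def[symmetric] by (auto elim: eventually_mono)
  note jx = component_jet[OF V(1,2,3) W I sm(1) evx defs(1,2) c_def cs]
  note jy = component_jet[OF V(1,2,4) W I sm(2) evy defs(3,4) c_def cs]
  have A: "det2 (cder 5 \<gamma> 0) (cder 4 \<gamma> 0) = - 2880 * c ^ 9 * \<Delta>"
    unfolding det2_def cder_def fst_conv snd_conv jx jy \<Delta>_def by algebra
  have A0: "det2 (cder 5 \<gamma> 0) (cder 4 \<gamma> 0) \<noteq> 0" unfolding A using c0 \<Delta> by simp
  have "cder 1 \<gamma> 0 = 0" "cder 2 \<gamma> 0 = 0" "cder 3 \<gamma> 0 = 0"
    unfolding cder_def jx jy by (simp_all add: zero_prod_def)
  then show "cusp45 \<gamma>" using A0 by (simp add: cusp45_def)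
  have B: "det2 (cder 6 \<gamma> 0) (cder 4 \<gamma> 0) = - 86400 * c ^ 8 * c2 * \<Delta>"
    unfolding det2_def cder_def fst_conv snd_conv jx jy \<Delta>_def by algebra
  \<comment> \<open>The terms of the seventh derivative with \<open>c4\<close> and
    \<open>c2 * c3\<close> point along (p1, p2), the direction of the fourth derivative, and drop
    out of the determinant.\<close>
  have C: "det2 (cder 7 \<gamma> 0) (cder 4 \<gamma> 0) = - 120960 * c ^ 4 * (5 * c ^ 4 * c3 + 10 * c ^ 3 * c2\<^sup>2 + e * c ^ 7) * \<Delta>"
    unfolding det2_def cder_def fst_conv snd_conv jx jy \<Delta>_def by algebra
  have D: "det2 (cder 6 \<gamma> 0) (cder 5 \<gamma> 0) = 86400 * ((4 * c ^ 3 * c3 + 6 * c\<^sup>2 * c2\<^sup>2) * c ^ 5 - 5 * c ^ 4 * c2 * (4 * c ^ 3 * c2)) * \<Delta>"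
    unfolding det2_def cder_def fst_conv snd_conv jx jy \<Delta>_def by algebra
  \<comment> \<open>Every term with \<open>c2\<close> or \<open>c3\<close> cancels for these
    coefficients. What remains is the contribution of e to 60 A C, with constant 60 * 2880 * 120960
    = 20901888000.\<close>
  have N: "-77 * (det2 (cder 6 \<gamma> 0) (cder 4 \<gamma> 0))\<^sup>2 + 105 * det2 (cder 5 \<gamma> 0) (cder 4 \<gamma> 0) * det2 (cder 6 \<gamma> 0) (cder 5 \<gamma> 0)
      + 60 * det2 (cder 5 \<gamma> 0) (cder 4 \<gamma> 0) * det2 (cder 7 \<gamma> 0) (cder 4 \<gamma> 0) = (20901888000 * (c ^ 10 * \<Delta>)\<^sup>2) * e"
    unfolding A B C D by algebra
  have "cder 4 \<gamma> 0 \<noteq> 0" using A0 by (auto simp: det2_def)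
  then have n: "norm (cder 4 \<gamma> 0) ^ 5 > 0" by simp
  have "kappa_q \<gamma> = (20901888000 * (c ^ 10 * \<Delta>)\<^sup>2 / norm (cder 4 \<gamma> 0) ^ 5) * e"
    unfolding kappa_q_def Let_def N by simp
  moreover have "20901888000 * (c ^ 10 * \<Delta>)\<^sup>2 / norm (cder 4 \<gamma> 0) ^ 5 > 0" using n c0 \<Delta> by simp
  ultimately show "\<exists>K>0. kappa_q \<gamma> = K * e" by blast
qed

section \<open>Equivalence of class C^1\<close>

lemma abs_powr_mult_has_derivative:
  fixes y a :: real
  assumes a: "a > 0"
  shows "((\<lambda>y. y * \<bar>y\<bar> powr a) has_real_derivative (1 + a) * \<bar>y\<bar> powr a) (at y)"
proof -
  consider "y > 0" | "y < 0" | "y = 0" by linarith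
  then show ?thesis
  proof cases
    case 1
    have "((\<lambda>y. y * y powr a) has_real_derivative 1 * y powr a + (a * y powr (a - 1)) * y) (at y)"
      by (intro DERIV_mult DERIV_ident has_real_derivative_powr 1)
    moreover have "y powr (a - 1) * y = y powr a" using 1 by (simp add: powr_diff)
    ultimately have "((\<lambda>y. y * y powr a) has_real_derivative (1 + a) * \<bar>y\<bar> powr a) (at y)"
      using 1 by (simp add: algebra_simps)
    then show ?thesis
      by (rule has_field_derivative_transform_within_open[where S = "{0<..}"]) (use 1 in auto)
  next
    case 2
    have "((\<lambda>y. (- y) powr a) has_real_derivative (a * (- y) powr (a - 1)) * (- 1)) (at y)"
      by (rule DERIV_chain2[OF has_real_derivative_powr]) (use 2 in \<open>auto intro!: derivative_eq_intros\<close>)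
    from DERIV_mult[OF DERIV_ident this]
    have "((\<lambda>y. y * (- y) powr a) has_real_derivative 1 * (- y) powr a + (a * (- y) powr (a - 1)) * (- 1) * y) (at y)" .
    moreover have "(a * (- y) powr (a - 1)) * (- 1) * y = a * ((- y) powr (a - 1) * (- y))" by simp
    then have "1 * (- y) powr a + (a * (- y) powr (a - 1)) * (- 1) * y = (1 + a) * \<bar>y\<bar> powr a"
      using 2 by (simp add: powr_diff distrib_right)
    ultimately have "((\<lambda>y. y * (- y) powr a) has_real_derivative (1 + a) * \<bar>y\<bar> powr a) (at y)" by (simp only:)
    then show ?thesis
      by (rule has_field_derivative_transform_within_open[where S = "{..<0}"]) (use 2 in auto)
  next
    case 3
    \<comment> \<open>At 0 the difference quotient is |h|^a itself, which tends to 0 because a >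
      0.\<close>
    have "((\<lambda>h. \<bar>h\<bar> powr a) \<longlongrightarrow> \<bar>0\<bar> powr a) (at (0::real))"
      using a by (intro tendsto_intros) auto
    then have "((\<lambda>h. \<bar>h\<bar> powr a) \<longlongrightarrow> 0) (at (0::real))" by simp
    moreover have "\<forall>\<^sub>F h in at (0::real). \<bar>h\<bar> powr a = ((0 + h) * \<bar>0 + h\<bar> powr a - 0 * \<bar>0\<bar> powr a) / h"
      by (auto simp: eventually_at_filter)
    ultimately have "((\<lambda>h. ((0 + h) * \<bar>0 + h\<bar> powr a - 0 * \<bar>0\<bar> powr a) / h) \<longlongrightarrow> 0) (at (0::real))"
      by (rule Lim_transform_eventually)
    then show ?thesis using 3 by (simp add: DERIV_def)
  qed
qed

text \<open>For y = t^5 one has |y|^(2/5) = t^2, so the map adds e t^7 with the parameter left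
  unchanged. Its y-derivative 1 + (7/5) e |y|^(2/5) is continuous and equals 1 at y = 0, which is
  what the inverse function theorem asks for.\<close>

lemma C1_equiv_normal_form:
  "Cr_equiv 1 (\<lambda>t. (t ^ 4, t ^ 5 + 0 * t ^ 7)) (\<lambda>t. (t ^ 4, t ^ 5 + e * t ^ 7))"
proof -
  define h where "h y = y * \<bar>y\<bar> powr (2/5)" for y :: real
  have dh: "(h has_real_derivative (1 + 2/5) * \<bar>y\<bar> powr (2/5)) (at y)" for y
    unfolding h_def by (rule abs_powr_mult_has_derivative) simp
  define G where "G z = snd z + e * h (snd z)" for z :: "real \<times> real"
  define D where "D z = 1 + e * ((1 + 2/5) * \<bar>snd z\<bar> powr (2/5))" for z :: "real \<times> real"
  have dG: "(G has_derivative (\<lambda>k. D z * snd k)) (at z)" for z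
  proof -
    have "((\<lambda>z. h (snd z)) has_derivative (\<lambda>k. ((1 + 2/5) * \<bar>snd z\<bar> powr (2/5)) * snd k)) (at z)"
      using has_derivative_compose[OF has_derivative_snd[OF has_derivative_ident] dh[unfolded has_field_derivative_def]] by simp
    then have "((\<lambda>z. snd z + e * h (snd z)) has_derivative (\<lambda>k. snd k + e * (((1 + 2/5) * \<bar>snd z\<bar> powr (2/5)) * snd k))) (at z)"
      by (intro has_derivative_add has_derivative_mult_right has_derivative_snd has_derivative_ident)
    moreover have "(\<lambda>k. snd k + e * (((1 + 2/5) * \<bar>snd z\<bar> powr (2/5)) * snd k)) = (\<lambda>k :: real \<times> real. D z * snd k)"
      by (simp add: fun_eq_iff D_def algebra_simps)
    ultimately show ?thesis by (simp only: G_def[abs_def])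
  qed
  have contD: "continuous_on UNIV D" unfolding D_def
    by (intro continuous_intros continuous_on_powr') auto
  have CG: "Ck (Suc 0) UNIV G"
  proof (rule Ck_SucI[OF open_UNIV dG])
    show "Ck 0 UNIV (\<lambda>z. D z * snd b)" for b :: "real \<times> real"
      using contD by (auto intro!: continuous_on_mult_right)
  qed
  have germ: "diffeo_germ 1 (\<lambda>z. (fst z, G z)) (0,0)"
    unfolding diffeo_germ_def
  proof (rule local_diffeo_real2[OF open_UNIV])
    show "Ck k UNIV (fst :: real \<times> real \<Rightarrow> real)" for k by (intro Ck_bounded_linear open_UNIV bounded_linear_fst)
    show "Ck k UNIV G" if "enat k \<le> 1" for k
      by (rule Ck_mono[OF CG]) (use that in \<open>simp add: one_enat_def\<close>)
    show "(fst has_derivative (\<lambda>k. 1 * fst k + 0 * snd k)) (at (0::real,0::real))"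
      by (auto intro!: derivative_eq_intros)
    show "(G has_derivative (\<lambda>k. 0 * fst k + 1 * snd k)) (at (0,0))"
      using dG[of "(0,0)"] by (simp add: D_def)
  qed auto
  have "\<bar>t ^ 5\<bar> powr (2/5) = t\<^sup>2" for t :: real
  proof (cases "t = 0")
    case False
    have "\<bar>t ^ 5\<bar> = \<bar>t\<bar> powr 5" using False powr_realpow[of "\<bar>t\<bar>" 5] by (simp add: power_abs)
    then have "\<bar>t ^ 5\<bar> powr (2/5) = \<bar>t\<bar> powr (5 * (2/5))" by (simp only: powr_powr)
    also have "\<dots> = \<bar>t\<bar> powr 2" by (rule arg_cong[where f = "\<lambda>a. \<bar>t\<bar> powr a"]) simp
    finally have "\<bar>t ^ 5\<bar> powr (2/5) = \<bar>t\<bar> powr 2" .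
    then show ?thesis using False powr_realpow[of "\<bar>t\<bar>" 2] by simp
  qed simp
  then have "G (t ^ 4, t ^ 5 + 0 * t ^ 7) = t ^ 5 + e * t ^ 7" for t
    by (simp add: G_def h_def power_add[symmetric])
  then show ?thesis unfolding Cr_equiv_iff
    by (intro exI[of _ "\<lambda>t. t"] exI[of _ "\<lambda>z. (fst z, G z)"] conjI diffeo_germ_id)
      (use germ in simp_all)
qed

lemma smooth_normal_form: "Cr \<infinity> UNIV (\<lambda>t::real. (t ^ 4, t ^ 5 + e * t ^ 7))"
proof -
  have "smooth (\<lambda>t. t ^ 4)" "smooth (\<lambda>t. t ^ 5 + e * t ^ 7)" by (intro smooth_intros open_UNIV)+
  then show ?thesis unfolding Cr_pair_iff fst_conv snd_conv by (simp add: smooth_on_def)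
qed

text \<open>The reduction yields some normal form with parameter e' without saying which; the
  necessity part identifies e' as the sign of the curvature.\<close>

lemma A_equiv_normal_form_iff:
  assumes I: "open I" "0 \<in> I" and \<gamma>: "Cr \<infinity> I \<gamma>" and e: "e \<in> {0, 1, -1}"
  shows "A_equiv \<gamma> (\<lambda>t. (t ^ 4, t ^ 5 + e * t ^ 7)) \<longleftrightarrow> cusp45 \<gamma> \<and> sgn (kappa_q \<gamma>) = e"
proof -
  have nec: "cusp45 \<gamma> \<and> sgn (kappa_q \<gamma>) = e'"
    if "A_equiv \<gamma> (\<lambda>t. (t ^ 4, t ^ 5 + e' * t ^ 7))" "e' \<in> {0, 1, -1}" for e'
    using A_equiv_normal_form_kappa[OF I \<gamma> that(1)] that(2) by (auto simp: sgn_mult)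
  show ?thesis
  proof
    assume "cusp45 \<gamma> \<and> sgn (kappa_q \<gamma>) = e"
    then have cusp: "cusp45 \<gamma>" and s: "sgn (kappa_q \<gamma>) = e" by auto
    obtain e' where "e' \<in> {0, 1, -1}" "A_equiv \<gamma> (\<lambda>t. (t ^ 4, t ^ 5 + e' * t ^ 7))"
      by (rule cusp45_A_equiv_normal_form[OF I \<gamma> cusp])
    then show "A_equiv \<gamma> (\<lambda>t. (t ^ 4, t ^ 5 + e * t ^ 7))" using nec s by auto
  qed (use nec e in blast)
qed

text \<open>The criterion is applied to a normal form taken as the curve: reflexivity gives its
  curvature the sign e1, so it cannot also have the sign e2.\<close>

lemma normal_forms_not_A_equiv:
  assumes "e1 \<in> {0, 1, -1}" "e2 \<in> {0, 1, -1}" "e1 \<noteq> e2"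
  shows "\<not> A_equiv (\<lambda>t. (t ^ 4, t ^ 5 + e1 * t ^ 7)) (\<lambda>t. (t ^ 4, t ^ 5 + e2 * t ^ 7))"
  using A_equiv_normal_form_iff[OF open_UNIV UNIV_I smooth_normal_form assms(1), of e1]
    A_equiv_normal_form_iff[OF open_UNIV UNIV_I smooth_normal_form assms(2), of e1] assms(3)
    Cr_equiv_refl[of \<infinity> "\<lambda>t. (t ^ 4, t ^ 5 + e1 * t ^ 7)"]
  unfolding A_equiv_def by metis

text \<open>Both forms are linked to the one with parameter 0, which is where symmetry and
  transitivity come in.\<close>

lemma normal_forms_C1_equiv:
  "Cr_equiv 1 (\<lambda>t. (t ^ 4, t ^ 5 + e1 * t ^ 7)) (\<lambda>t. (t ^ 4, t ^ 5 + e2 * t ^ 7))"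
proof -
  have "isCont (\<lambda>t::real. (t ^ 4, t ^ 5 + 0 * t ^ 7)) 0" by (intro isCont_Pair_smooth smooth_intros open_UNIV)
  from Cr_equiv_sym[OF C1_equiv_normal_form this] show ?thesis
    by (rule Cr_equiv_trans) (rule C1_equiv_normal_form)
qed

theorem mainTheorem16:
  fixes \<gamma> :: "real \<Rightarrow> real \<times> real" and I :: "real set"
  assumes "open I" and "is_interval I" and "0 \<in> I" and "Cr \<infinity> I \<gamma>"
  shows "(A_equiv \<gamma> (\<lambda>t. (t^4, t^5)) \<longleftrightarrow> cusp45 \<gamma> \<and> kappa_q \<gamma> = 0)
       \<and> (A_equiv \<gamma> (\<lambda>t. (t^4, t^5 + t^7)) \<longleftrightarrow> cusp45 \<gamma> \<and> kappa_q \<gamma> > 0)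
       \<and> (A_equiv \<gamma> (\<lambda>t. (t^4, t^5 - t^7)) \<longleftrightarrow> cusp45 \<gamma> \<and> kappa_q \<gamma> < 0)
       \<and> (\<forall>g1\<in>{(\<lambda>t. (t^4, t^5)), (\<lambda>t. (t^4, t^5 + t^7)), (\<lambda>t. (t^4, t^5 - t^7))}.
          \<forall>g2\<in>{(\<lambda>t. (t^4, t^5)), (\<lambda>t. (t^4, t^5 + t^7)), (\<lambda>t. (t^4, t^5 - t^7))}.
            g1 \<noteq> g2 \<longrightarrow> \<not> A_equiv g1 g2 \<and> Cr_equiv 1 g1 g2)"
proof -
  \<comment> \<open>The three germs are members of one family, so every claim becomes an instance of
    a statement about e in {0, 1, -1}.\<close>
  define g where "g e = (\<lambda>t::real. (t ^ 4, t ^ 5 + e * t ^ 7))" for e :: real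
  have g: "(\<lambda>t::real. (t^4, t^5)) = g 0" "(\<lambda>t::real. (t^4, t^5 + t^7)) = g 1" "(\<lambda>t::real. (t^4, t^5 - t^7)) = g (- 1)"
    by (simp_all add: g_def)
  have iff: "A_equiv \<gamma> (g e) \<longleftrightarrow> cusp45 \<gamma> \<and> sgn (kappa_q \<gamma>) = e" if "e \<in> {0, 1, -1}" for e
    unfolding g_def by (rule A_equiv_normal_form_iff[OF assms(1,3,4) that])
  have four: "\<not> A_equiv (g e1) (g e2) \<and> Cr_equiv 1 (g e1) (g e2)"
    if "e1 \<in> {0, 1, -1}" "e2 \<in> {0, 1, -1}" "g e1 \<noteq> g e2" for e1 e2
  proof -
    have "e1 \<noteq> e2" using that(3) by blast
    then show ?thesis
      unfolding g_def using normal_forms_not_A_equiv[OF that(1,2)] normal_forms_C1_equiv by blast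
  qed
  show ?thesis unfolding g
  proof (intro conjI ballI impI)
    show "A_equiv \<gamma> (g 0) \<longleftrightarrow> cusp45 \<gamma> \<and> kappa_q \<gamma> = 0" using iff[of 0] by (simp add: sgn_0_0)
    show "A_equiv \<gamma> (g 1) \<longleftrightarrow> cusp45 \<gamma> \<and> kappa_q \<gamma> > 0" using iff[of 1] by (simp add: sgn_1_pos)
    show "A_equiv \<gamma> (g (- 1)) \<longleftrightarrow> cusp45 \<gamma> \<and> kappa_q \<gamma> < 0" using iff[of "- 1"] by (simp add: sgn_1_neg)
    fix g1 g2 assume "g1 \<in> {g 0, g 1, g (- 1)}" "g2 \<in> {g 0, g 1, g (- 1)}" and ne: "g1 \<noteq> g2"
    then obtain e1 e2 where e: "e1 \<in> {0, 1, -1}" "e2 \<in> {0, 1, -1}" "g1 = g e1" "g2 = g e2" by blast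
    then show "\<not> A_equiv g1 g2" "Cr_equiv 1 g1 g2" using four[OF e(1,2)] ne by auto
  qed
qed

end
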